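(* Let $(N,\mathcal D,\mathcal L_1\oplus\mathcal L_2)$ be a product-form Hadamard triple with $N>\#\mathcal D$, let $\mu_{N,\mathcal D}$ be the associated equal-weight self-similar measure, and let $\mathcal T_*$ be its product-form Hadamard multiplier set. Then for any $s\in\left[0,\frac{\log\#\mathcal D}{\log N}\right]$, the spectral eigen-subspace $$V^{(s)}(\mu_{N,\mathcal D},\mathcal T_* ):=\{\Lambda\in V(\mu_{N,\mathcal D},\mathcal T_* ):\dim_{Be}(\Lambda)=s\}$$ has the cardinality of the continuum.
   Context: Spectra. A Borel probability measure $\mu$ on $\mathbb R$ is spectral if there is a countable set $\Lambda\subset\mathbb R$ such that $\{e^{2\pi i\lambda x}:\lambda\in\Lambda\}$ is an orthogonal basis of $L^2(\mu)$; such a $\Lambda$ is called a spectrum of $\mu$. For $A\subset\mathbb R$, $$V(\mu,A)=\{\Lambda:\ \Lambda\text{ is a spectrum of }\mu\text{ and }a\Lambda\text{ is a spectrum of }\mu\text{ for all }a\in A\},$$ where spectra are usually considered up to translation. Self-similar measure. For an integer $N\ge2$ and a finite $\mathcal D\subset\mathbb Z$, $\mu_{N,\mathcal D}$ is the unique Borel probability measure with $\mu(E)=\frac1{\#\mathcal D}\sum_{d\in\mathcal D}\mu(\phi_d^{-1}(E))$ for all Borel $E$, where $\phi_d(x)=\frac1N(x+d)$. Hadamard triple. For an integer $N\ge2$ and finite $D,L\subset\mathbb Z$ with $\#D=\#L$, $(N,D,L)$ is a Hadamard triple if the matrix $\frac1{\sqrt{\#D}}\left(e^{-2\pi i ld/N}\right)_{l\in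 L,d\in D}$ is unitary; equivalently $\sum_{d\in D}e^{-2\pi i(l_1-l_2)d/N}=0$ for all distinct $l_1,l_2\in L$. $X\oplus Y$ denotes the sum set $X+Y$ when all sums $x+y$ are distinct. Product-form Hadamard triple. Let $N\ge2$ be an integer, let $\mathcal A=\{a_s:s=0,1,\dots,n-1\}$ be a set of $n$ integers, and for each $s$ let $\mathcal B_s$ be a finite set of integers; let $\mathcal L_1,\mathcal L_2\subset\mathbb Z$ be finite. $(N,\mathcal D,\mathcal L_1\oplus\mathcal L_2)$ is a product-form Hadamard triple (and $\mathcal D$ is a product-form digit set) if there exists an integer $r\ge0$ such that $$\mathcal D=\bigcup_{s=0}^{n-1}(a_s+N^r\mathcal B_s)$$ and (i) $(N,\mathcal A,\mathcal L_1)$ and $(N,\mathcal B_s,\mathcal L_2)$ are Hadamard triples for all $s\in\{0,\dots,n-1\}$; (ii) $(N,\mathcal A\oplus\mathcal B_s,\mathcal L_1\oplus\mathcal L_2)$ is a Hadamard triple for all $s\in\{0,\dots,n-1\}$. Multiplier set. $\mathcal T_*$ is the set of all $t\in\mathbb Z$ such that for every $s\in\{0,\dots,n-1\}$ the triples $(N,\mathcal A,t\mathcal L_1)$, $(N,\mathcal B_s,t\mathcal L_2)$ and $(N,\mathcal A\oplus\mathcal B_s,t\mathcal L_1\oplus t\mathcal L_2)$ are Hadamard triples. Beurling dimension. For a countable $\Lambda\subset\mathbb R$, $$\dim_{Be}(\Lambda)=\limsup_{h\to\infty}\sup_{x\in\mathbb R}\frac{\log\#\left(\Lambda\cap(x-\frac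 h2,x+\frac h2)\right)}{\log h}.$$
   Formalization: For r=0 it is additionally assumed that (N, D, t(L1+L2)) is a Hadamard triple for every t in T_*; without this the claim fails, e.g. N=8, A={0,1}, L1={0,4}, B_0={0,2}, B_1={9,11}, L2={0,2}, where the measure has no spectrum. Nothing is added for r≥1. *)

theory Defs
  imports "HOL-Probability.Probability" "HOL-Library.Set_Algebras" "HOL-Library.Equipollence"
begin

text \<open>Throughout, \<open>X + Y\<close>, \<open>c +o X\<close> and \<open>c *o X\<close> are the sum set, translate and dilate of
  \<open>Set_Algebras\<close>.\<close>

subsection \<open>Spectra\<close>

definition expo :: "real \<Rightarrow> real \<Rightarrow> complex" where
  "expo \<xi> x = cis (2 * pi * \<xi> * x)"

text \<open>The orthogonal basis is understood as a family indexed by \<open>\<Lambda>\<close>: distinct frequencies must give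
  orthogonal exponentials (and not, say, functions that agree almost everywhere).  Completeness is
  density of the linear span in the space of square integrable functions.\<close>

definition is_spectrum :: "real measure \<Rightarrow> real set \<Rightarrow> bool" where
  "is_spectrum M \<Lambda> \<longleftrightarrow>
     countable \<Lambda> \<and>
     (\<forall>\<xi>\<in>\<Lambda>. \<forall>\<xi>'\<in>\<Lambda>. \<xi> \<noteq> \<xi>' \<longrightarrow> (LINT x|M. expo \<xi> x * cnj (expo \<xi>' x)) = 0) \<and>
     (\<forall>f\<in>borel_measurable M. integrable M (\<lambda>x. (cmod (f x))\<^sup>2) \<longrightarrow>
        (\<forall>\<epsilon>>0. \<exists>F c. finite F \<and> F \<subseteq> \<Lambda> \<and>
           (LINT x|M. (cmod (f x - (\<Sum>\<xi>\<in>F. c \<xi> * expo \<xi> x)))\<^sup>2) < \<epsilon>))"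

definition V :: "real measure \<Rightarrow> real set \<Rightarrow> real set set" where
  "V M A = {\<Lambda>. is_spectrum M \<Lambda> \<and> (\<forall>a\<in>A. is_spectrum M (a *o \<Lambda>))}"

definition translation_rel :: "(real set \<times> real set) set" where
  "translation_rel = {(\<Lambda>, \<Lambda>'). \<exists>c. \<Lambda>' = c +o \<Lambda>}"

subsection \<open>Beurling dimension\<close>

definition log_card :: "real set \<Rightarrow> ereal" where
  "log_card S = (if infinite S then \<infinity> else if S = {} then -\<infinity> else ereal (ln (real (card S))))"

definition beurling_dim :: "real set \<Rightarrow> ereal" where
  "beurling_dim \<Lambda> =
     Limsup at_top (\<lambda>h::real. SUP x::real. log_card (\<Lambda> \<inter> {x - h/2 <..< x + h/2}) / ereal (ln h))"

definition V_dim :: "real \<Rightarrow> real measure \<Rightarrow> real set \<Rightarrow> real set set" where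
  "V_dim s M A = {\<Lambda> \<in> V M A. beurling_dim \<Lambda> = ereal s}"

subsection \<open>Self-similar measures\<close>

definition is_self_similar_measure :: "nat \<Rightarrow> int set \<Rightarrow> real measure \<Rightarrow> bool" where
  "is_self_similar_measure N D M \<longleftrightarrow>
     prob_space M \<and> sets M = sets borel \<and>
     (\<forall>E\<in>sets borel. measure M E =
        1 / real (card D) *
        (\<Sum>d\<in>D. measure M ((\<lambda>x. 1 / real N * (x + real_of_int d)) -` E)))"

definition self_similar_measure :: "nat \<Rightarrow> int set \<Rightarrow> real measure" where
  "self_similar_measure N D = (THE M. is_self_similar_measure N D M)"

subsection \<open>Hadamard triples\<close>

definition hadamard_entry :: "nat \<Rightarrow> int set \<Rightarrow> int \<Rightarrow> int \<Rightarrow> complex" where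
  "hadamard_entry N D l d =
     complex_of_real (1 / sqrt (real (card D))) *
     cis (- 2 * pi * real_of_int l * real_of_int d / real N)"

text \<open>The last two conjuncts say that the matrix with rows indexed by \<open>L\<close> and columns indexed by
  \<open>D\<close> is unitary.  Non-emptiness of \<open>D\<close> is implicit in the factor \<open>1 / sqrt (card D)\<close>.\<close>

definition hadamard_triple :: "nat \<Rightarrow> int set \<Rightarrow> int set \<Rightarrow> bool" where
  "hadamard_triple N D L \<longleftrightarrow>
     2 \<le> N \<and> finite D \<and> finite L \<and> D \<noteq> {} \<and> card D = card L \<and>
     (\<forall>l\<in>L. \<forall>l'\<in>L.
        (\<Sum>d\<in>D. hadamard_entry N D l d * cnj (hadamard_entry N D l' d)) = (if l = l' then 1 else 0)) \<and>
     (\<forall>d\<in>D. \<forall>d'\<in>D.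
        (\<Sum>l\<in>L. cnj (hadamard_entry N D l d) * hadamard_entry N D l d') = (if d = d' then 1 else 0))"

definition direct_sum :: "int set \<Rightarrow> int set \<Rightarrow> bool" where
  "direct_sum X Y \<longleftrightarrow> inj_on (\<lambda>(x, y). x + y) (X \<times> Y)"

text \<open>The conditions (i) and (ii) shared by the definitions of product-form Hadamard triples and
  of the multiplier set.\<close>

definition hadamard_system ::
    "nat \<Rightarrow> nat \<Rightarrow> (nat \<Rightarrow> int) \<Rightarrow> (nat \<Rightarrow> int set) \<Rightarrow> int set \<Rightarrow> int set \<Rightarrow> bool" where
  "hadamard_system N n a B L1 L2 \<longleftrightarrow>
     (\<forall>s<n. hadamard_triple N (a ` {..<n}) L1 \<and>
            hadamard_triple N (B s) L2 \<and>
            direct_sum (a ` {..<n}) (B s) \<and> direct_sum L1 L2 \<and>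
            hadamard_triple N (a ` {..<n} + B s) (L1 + L2))"

text \<open>The set \<open>A\<close> is enumerated injectively by \<open>a 0, \<dots>, a (n - 1)\<close>.  For \<open>r = 0\<close> the
  conditions say nothing about \<open>D\<close> itself: its pieces may overlap, and even if they are disjoint,
  \<open>D\<close> need not be a Hadamard digit set, as \<open>N = 8\<close>, \<open>A = {0, 1}\<close>, \<open>L1 = {0, 4}\<close>, \<open>B 0 = L2 = {0, 2}\<close>,
  \<open>B 1 = {9, 11}\<close> shows (here the self-similar measure has no spectrum).  Statements that include the
  case \<open>r = 0\<close> therefore require the Hadamard property of \<open>D\<close> separately; it is automatic when all
  \<open>B s\<close> coincide.\<close>

definition product_form_hadamard ::
    "nat \<Rightarrow> nat \<Rightarrow> (nat \<Rightarrow> int) \<Rightarrow> (nat \<Rightarrow> int set) \<Rightarrow> int set \<Rightarrow> int set \<Rightarrow> nat \<Rightarrow> int set \<Rightarrow> bool" where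
  "product_form_hadamard N n a B L1 L2 r D \<longleftrightarrow>
     2 \<le> N \<and> 1 \<le> n \<and> inj_on a {..<n} \<and>
     (\<forall>s<n. finite (B s)) \<and> finite L1 \<and> finite L2 \<and>
     D = (\<Union>s<n. a s +o (int N ^ r *o B s)) \<and>
     hadamard_system N n a B L1 L2"

definition multiplier_set ::
    "nat \<Rightarrow> nat \<Rightarrow> (nat \<Rightarrow> int) \<Rightarrow> (nat \<Rightarrow> int set) \<Rightarrow> int set \<Rightarrow> int set \<Rightarrow> int set" where
  "multiplier_set N n a B L1 L2 = {t. hadamard_system N n a B (t *o L1) (t *o L2)}"

end

theory Submission
  imports Defs "HOL-Computational_Algebra.Polynomial" "HOL-Real_Asymp.Real_Asymp"
begin

text \<open>
  Spectra are built as increasing unions of finite sets.  A stage adds digits \<open>N ^ i * l\<close>, \<open>l \<in> L\<close>,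
  at the levels \<open>k, \<dots>, k' - 1\<close>, and may shift each new element by an arbitrary multiple of
  \<open>N ^ k'\<close>: this preserves a finite Parseval identity for every dilate by a multiplier \<open>t\<close> at once.
  The union is complete for the dilate by \<open>t\<close> if, at infinitely many stages, the transform of
  the measure is bounded below at the points \<open>t * u / N ^ k'\<close> with \<open>u\<close> new; since the
  stages can be distributed among the countably many multipliers, each stage has to serve only one.
  Suitable shifts exist because \<open>N > card D\<close>: the zeros of the transform are isolated, while a point all of
  whose translates by multiples of \<open>t\<close> are zeros would have too many preimages of the same kind.

  As shifts can moreover be taken arbitrarily large, most new elements are placed in a lacunary way
  and do not contribute to the Beurling dimension.  The exceptions are clusters of \<open>card D ^ m\<close> elements
  spaced by \<open>N ^ e\<close>, where \<open>m / (e + m)\<close> tends to \<open>s * log N / log (card D)\<close>.  Two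
  choices at every stage give continuum many spectra containing \<open>0\<close>, and only countably many
  of them are translates of a given one.
\<close>

section \<open>Self-similar measures and their Fourier transforms\<close>

text \<open>A lower bound for the transform cannot hold at every new point: where the weight
  \<open>g\<close> vanishes, the transform vanishes at all integer translates. Bounds are therefore
  available only where \<open>g\<close> reaches a threshold, with a constant depending on that
  threshold, and thresholds must be scheduled together with the multipliers. What the remaining
  elements carry is controlled by a second estimate, valid for every stage that \<open>step\<close>
  produces: with the factor \<open>g\<close> left out, the Parseval sum is at most a fixed
  \<open>P\<close>, so elements with \<open>g\<close> below \<open>2 * \<epsilon>\<close> account
  for at most \<open>2 * \<epsilon> * P\<close> of the total. When \<open>D\<close> is itself a
  Hadamard digit set, \<open>g = 1\<close> and the difficulty disappears.\<close>

definition digit_mask :: "int set \<Rightarrow> real \<Rightarrow> complex" where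
  "digit_mask D \<xi> = (\<Sum>d\<in>D. expo \<xi> (real_of_int d)) / of_nat (card D)"

text \<open>The exponent has the positive sign, so that \<open>FT M \<xi>\<close> is
  \<open>char M (2 * pi * \<xi>)\<close>; continuity and Levy's uniqueness theorem are taken from
  there.\<close>

definition FT :: "real measure \<Rightarrow> real \<Rightarrow> complex" where
  "FT M \<xi> = (LINT x|M. expo \<xi> x)"

lemma expo_measurable [measurable]: "expo \<xi> \<in> borel_measurable borel"
proof -
  have "continuous_on UNIV (expo \<xi>)"
    unfolding expo_def[abs_def] cis_conv_exp by (intro continuous_intros)
  then show ?thesis by (rule borel_measurable_continuous_onI)
qed

lemma norm_expo [simp]: "cmod (expo \<xi> x) = 1"
  by (simp add: expo_def)

lemma expo_0 [simp]: "expo 0 x = 1" "expo \<xi> 0 = 1"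
  by (simp_all add: expo_def)

lemma expo_add: "expo \<xi> (x + y) = expo \<xi> x * expo \<xi> y"
  by (simp add: expo_def cis_mult ring_distribs)

lemma expo_add_left: "expo (\<xi> + \<eta>) x = expo \<xi> x * expo \<eta> x"
  by (simp add: expo_def cis_mult ring_distribs)

lemma cnj_expo: "cnj (expo \<xi> x) = expo (- \<xi>) x"
  by (simp add: expo_def cis_cnj)

lemma expo_mult_cnj: "expo \<xi> x * cnj (expo \<eta> x) = expo (\<xi> - \<eta>) x"
  unfolding cnj_expo expo_add_left[symmetric] by simp

lemma expo_int: "expo (of_int z) (of_int d) = 1"
proof -
  have "cis (2 * pi * real_of_int (z * d)) = 1" by (rule cis_multiple_2pi) simp
  then show ?thesis by (simp add: expo_def mult.assoc)
qed

lemma expo_swap: "expo \<xi> x = expo x \<xi>" by (simp add: expo_def mult_ac)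

lemma digit_mask_0 [simp]: "finite D \<Longrightarrow> D \<noteq> {} \<Longrightarrow> digit_mask D 0 = 1"
  by (simp add: digit_mask_def)

lemma digit_mask_periodic: "digit_mask D (\<xi> + of_int z) = digit_mask D \<xi>"
  by (simp add: digit_mask_def expo_add_left expo_int)

lemma norm_mask_le: "cmod (digit_mask D \<xi>) \<le> 1"
proof (cases "card D = 0")
  case False
  have "cmod (\<Sum>d\<in>D. expo \<xi> (real_of_int d)) \<le> (\<Sum>d\<in>D. 1)"
    by (rule sum_norm_le) simp
  then show ?thesis using False by (simp add: digit_mask_def norm_divide divide_le_eq)
qed (auto simp: digit_mask_def)

definition digit_mask_prod :: "nat \<Rightarrow> int set \<Rightarrow> nat \<Rightarrow> real \<Rightarrow> complex" where
  "digit_mask_prod N D m \<xi> = (\<Prod>j=1..m. digit_mask D (\<xi> / real N ^ j))"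

text \<open>Self-similarity says that \<open>M\<close> is the law of \<open>(X + d) / N\<close> with
  \<open>d\<close> uniform on \<open>D\<close> and independent of \<open>X\<close>; in this form
  integrals can be computed by Fubini.\<close>

lemma is_self_similar_measure_distr:
  assumes "is_self_similar_measure N D M" "finite D" "D \<noteq> {}"
  shows "M = distr (measure_pmf (pmf_of_set D) \<Otimes>\<^sub>M M) borel
               (\<lambda>p. 1 / real N * (snd p + real_of_int (fst p)))" (is "M = ?R")
proof -
  interpret prob_space M using assms by (simp add: is_self_similar_measure_def)
  have sM [measurable_cong]: "sets M = sets borel"
    using assms by (simp add: is_self_similar_measure_def)
  have spM: "space M = UNIV" using sets_eq_imp_space_eq[OF sM] by simp
  show ?thesis
  proof (rule measure_eqI)
    fix E assume "E \<in> sets M"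
    then have E [measurable]: "E \<in> sets borel" by (simp add: sM)
    have m [measurable]: "(\<lambda>p. 1 / real N * (snd p + real_of_int (fst p)))
        \<in> measurable (measure_pmf (pmf_of_set D) \<Otimes>\<^sub>M M) borel" by measurable
    have "emeasure ?R E = emeasure (measure_pmf (pmf_of_set D) \<Otimes>\<^sub>M M)
        ((\<lambda>p. 1 / real N * (snd p + real_of_int (fst p))) -` E \<inter> space (measure_pmf (pmf_of_set D) \<Otimes>\<^sub>M M))"
      by (rule emeasure_distr) measurable
    also have "\<dots> = (\<integral>\<^sup>+d. emeasure M ((\<lambda>x. 1 / real N * (x + real_of_int d)) -` E) \<partial>measure_pmf (pmf_of_set D))"
      by (subst emeasure_pair_measure_alt[OF measurable_sets[OF m E]])
        (auto simp: space_pair_measure spM intro!: nn_integral_cong arg_cong[where f="emeasure M"])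
    also have "\<dots> = (\<Sum>d\<in>D. emeasure M ((\<lambda>x. 1 / real N * (x + real_of_int d)) -` E)) / card D"
      using assms by (simp add: nn_integral_pmf_of_set)
    also have "\<dots> = ennreal (1 / real (card D) * (\<Sum>d\<in>D. measure M ((\<lambda>x. 1 / real N * (x + real_of_int d)) -` E)))"
      using assms(2,3)
      by (simp add: emeasure_eq_measure sum_ennreal ennreal_of_nat_eq_real_of_nat divide_ennreal sum_nonneg card_gt_0_iff)
    also have "\<dots> = ennreal (measure M E)"
      using assms(1) E by (simp add: is_self_similar_measure_def)
    finally show "emeasure M E = emeasure ?R E" by (simp add: emeasure_eq_measure)
  qed (simp add: sM)
qed

lemma integrable_expo:
  assumes "prob_space M" "sets M = sets borel"
  shows "integrable M (expo \<xi>)"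
proof -
  interpret prob_space M by fact
  note assms(2)[measurable_cong]
  show ?thesis by (rule integrable_const_bound[where B=1]) auto
qed

lemma FT_functional_equation:
  assumes "is_self_similar_measure N D M" "finite D" "D \<noteq> {}"
  shows "FT M \<xi> = digit_mask D (\<xi> / real N) * FT M (\<xi> / real N)"
proof -
  let ?P = "measure_pmf (pmf_of_set D)"
  let ?f = "\<lambda>p. 1 / real N * (snd p + real_of_int (fst p))"
  interpret M: prob_space M using assms by (simp add: is_self_similar_measure_def)
  have sM [measurable_cong]: "sets M = sets borel"
    using assms by (simp add: is_self_similar_measure_def)
  interpret pair_prob_space "?P" M by standard
  have m: "?f \<in> measurable (?P \<Otimes>\<^sub>M M) borel" by measurable
  have int: "integrable (?P \<Otimes>\<^sub>M M) (\<lambda>p. expo \<xi> (?f p))"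
    by (rule integrable_const_bound[where B=1]) auto
  have *: "expo \<xi> (?f (d, x)) = expo (\<xi> / real N) (real_of_int d) * expo (\<xi> / real N) x" for d x
    by (simp add: expo_def cis_mult add_divide_distrib ring_distribs mult_ac)
  have "FT M \<xi> = (LINT p|(?P \<Otimes>\<^sub>M M). expo \<xi> (?f p))"
    unfolding FT_def
    by (subst is_self_similar_measure_distr[OF assms]) (rule integral_distr[OF m expo_measurable])
  also have "\<dots> = (LINT d|?P. (LINT x|M. expo \<xi> (?f (d, x))))"
    using integral_fst'[OF int] by simp
  also have "\<dots> = (LINT d|?P. expo (\<xi> / real N) (real_of_int d) * FT M (\<xi> / real N))"
    unfolding * FT_def by simp
  also have "\<dots> = (\<Sum>d\<in>D. pmf (pmf_of_set D) d *\<^sub>R (expo (\<xi> / real N) (real_of_int d) * FT M (\<xi> / real N)))"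
    using assms by (intro integral_measure_pmf) auto
  also have "\<dots> = digit_mask D (\<xi> / real N) * FT M (\<xi> / real N)"
    using assms by (simp add: digit_mask_def sum_distrib_left sum_distrib_right sum_divide_distrib scaleR_conv_of_real field_simps)
  finally show ?thesis .
qed

lemma FT_0: "prob_space M \<Longrightarrow> FT M 0 = 1"
  by (simp add: FT_def prob_space.prob_space)

lemma norm_FT_le:
  assumes "prob_space M" "sets M = sets borel"
  shows "cmod (FT M \<xi>) \<le> 1"
proof -
  interpret prob_space M by fact
  have "cmod (FT M \<xi>) \<le> (LINT x|M. cmod (expo \<xi> x))"
    unfolding FT_def by (rule integral_norm_bound)
  then show ?thesis by (simp add: prob_space)
qed

lemma FT_minus: "FT M (- \<xi>) = cnj (FT M \<xi>)"
  unfolding FT_def cnj_expo[symmetric] by simp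

lemma FT_eq_mask_prod:
  assumes "is_self_similar_measure N D M" "finite D" "D \<noteq> {}"
  shows "FT M \<xi> = digit_mask_prod N D m \<xi> * FT M (\<xi> / real N ^ m)"
proof (induction m)
  case (Suc m)
  have "FT M (\<xi> / real N ^ m) = digit_mask D (\<xi> / real N ^ Suc m) * FT M (\<xi> / real N ^ Suc m)"
    using FT_functional_equation[OF assms, of "\<xi> / real N ^ m"] by (simp add: mult.commute)
  then show ?case using Suc by (simp add: digit_mask_prod_def mult.assoc)
qed (simp add: digit_mask_prod_def)

lemma FT_continuous:
  assumes "prob_space M" "sets M = sets borel"
  shows "isCont (FT M) \<xi>"
proof -
  interpret prob_space M by fact
  have s: "space M = UNIV" using sets_eq_imp_space_eq[OF assms(2)] by simp
  interpret real_distribution M by standard (use assms s in auto)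
  have "FT M = (\<lambda>\<xi>. char M (2 * pi * \<xi>))"
    by (auto simp: FT_def char_def expo_def cis_conv_exp mult_ac fun_eq_iff)
  moreover have "isCont (\<lambda>\<xi>. char M (2 * pi * \<xi>)) \<xi>"
    by (rule isCont_o2[where g="char M"]) (auto intro!: isCont_char)
  ultimately show ?thesis by simp
qed

text \<open>Both transforms tend to \<open>1\<close> at \<open>\<xi> / N ^ m\<close>, so both are
  limits of the same mask products. Multiplying each by the tail of the other avoids the infinite
  product itself.\<close>

lemma self_similar_measure_unique:
  assumes "is_self_similar_measure N D M" "is_self_similar_measure N D M'" "finite D" "D \<noteq> {}" "2 \<le> N"
  shows "M = M'"
proof -
  have *: "prob_space M" "prob_space M'" "sets M = sets borel" "sets M' = sets borel"
    using assms by (auto simp: is_self_similar_measure_def)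
  have s: "space M = UNIV" "space M' = UNIV"
    using sets_eq_imp_space_eq[OF *(3)] sets_eq_imp_space_eq[OF *(4)] by auto
  interpret M: prob_space M by fact
  interpret M': prob_space M' by fact
  have rd: "real_distribution M" "real_distribution M'"
    using s * by (auto simp: real_distribution_def real_distribution_axioms_def)
  have lim: "(\<lambda>m. FT K (\<xi> / real N ^ m)) \<longlonglongrightarrow> 1" if "prob_space K" "sets K = sets borel" for K \<xi>
  proof -
    have "(\<lambda>m. \<xi> * (1 / real N) ^ m) \<longlonglongrightarrow> \<xi> * 0"
      using assms(5) by (intro tendsto_mult tendsto_const LIMSEQ_power_zero) auto
    then have "(\<lambda>m. \<xi> / real N ^ m) \<longlonglongrightarrow> 0" by (simp add: power_divide)
    from isCont_tendsto_compose[OF FT_continuous[OF that] this] show ?thesis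
      using that by (simp add: FT_0)
  qed
  have eq: "FT M \<xi> = FT M' \<xi>" for \<xi>
  proof -
    have "(\<lambda>m. FT M \<xi> * FT M' (\<xi> / real N ^ m)) \<longlonglongrightarrow> FT M \<xi> * 1"
      by (intro tendsto_intros lim *)
    moreover have "FT M \<xi> * FT M' (\<xi> / real N ^ m) = FT M' \<xi> * FT M (\<xi> / real N ^ m)" for m
      by (subst (1 3) FT_eq_mask_prod[where m=m, OF _ assms(3,4)]) (use assms in auto)
    then have "(\<lambda>m. FT M \<xi> * FT M' (\<xi> / real N ^ m)) = (\<lambda>m. FT M' \<xi> * FT M (\<xi> / real N ^ m))" by auto
    moreover have "(\<lambda>m. FT M' \<xi> * FT M (\<xi> / real N ^ m)) \<longlonglongrightarrow> FT M' \<xi> * 1"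
      by (intro tendsto_intros lim *)
    ultimately show ?thesis using LIMSEQ_unique by fastforce
  qed
  have "char M = char M'"
  proof
    fix x
    have "char K x = FT K (x / (2 * pi))" for K
      by (simp add: FT_def char_def expo_def cis_conv_exp mult_ac)
    then show "char M x = char M' x" using eq by simp
  qed
  then show ?thesis using Levy_uniqueness rd by blast
qed

text \<open>The law of the random series of \<open>\<omega> !! j / N ^ Suc j\<close> with
  independent uniform digits: prefixing a digit \<open>d\<close> to the stream turns the value
  \<open>x\<close> into \<open>(x + d) / N\<close>. The series is uniformly bounded, which gives the
  bounded support needed for completeness.\<close>

lemma self_similar_measure_exists:
  assumes "finite D" "D \<noteq> {}" "2 \<le> N"
  shows "\<exists>M R. is_self_similar_measure N D M \<and> (AE x in M. \<bar>x\<bar> \<le> R)"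
proof -
  define P where "P = measure_pmf (pmf_of_set D)"
  interpret P: prob_space P unfolding P_def by (rule prob_space_measure_pmf)
  have sP [measurable_cong]: "sets P = sets (count_space UNIV)" by (simp add: P_def)
  have spP: "space P = UNIV" by (simp add: P_def)
  define S where "S = stream_space P"
  interpret S: prob_space S unfolding S_def by (rule P.prob_space_stream_space)
  have spS: "space S = UNIV" by (simp add: S_def space_stream_space spP)
  obtain C where C: "\<And>d. d \<in> D \<Longrightarrow> \<bar>real_of_int d\<bar> \<le> C" "0 \<le> C"
  proof
    show "\<bar>real_of_int d\<bar> \<le> (\<Sum>d\<in>D. \<bar>real_of_int d\<bar>)" if "d \<in> D" for d
      using that assms by (intro member_le_sum) auto
  qed (simp add: sum_nonneg)
  \<comment> \<open>Replacing digits outside \<open>D\<close> by \<open>0\<close> makes the series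
    converge on every stream, not only on almost every one.\<close>
  define \<kappa> where "\<kappa> = (\<lambda>d::int. if d \<in> D then real_of_int d else 0)"
  have \<kappa>: "\<bar>\<kappa> d\<bar> \<le> C" for d using C by (auto simp: \<kappa>_def)
  define X where "X = (\<lambda>\<omega>. \<Sum>j. \<kappa> (\<omega> !! j) / real N ^ Suc j)"
  have geo: "summable (\<lambda>j. C * (1 / real N) ^ Suc j)"
    using assms by (intro summable_mult) (simp add: summable_geometric)
  have bnd: "norm (\<kappa> (\<omega> !! j) / real N ^ Suc j) \<le> C * (1 / real N) ^ Suc j" for \<omega> j
    using \<kappa>[of "\<omega> !! j"] by (simp add: power_divide divide_right_mono)
  have summ: "summable (\<lambda>j. \<kappa> (\<omega> !! j) / real N ^ Suc j)" for \<omega>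
    by (rule summable_comparison_test'[OF geo]) (use bnd in auto)
  have Xm [measurable]: "X \<in> borel_measurable S"
    unfolding X_def S_def by measurable
  have Xb: "\<bar>X \<omega>\<bar> \<le> (\<Sum>j. C * (1 / real N) ^ Suc j)" for \<omega>
  proof -
    have s: "summable (\<lambda>j. norm (\<kappa> (\<omega> !! j) / real N ^ Suc j))"
      by (rule summable_comparison_test'[OF geo]) (use bnd in auto)
    have "norm (X \<omega>) \<le> (\<Sum>j. norm (\<kappa> (\<omega> !! j) / real N ^ Suc j))"
      unfolding X_def by (rule summable_norm[OF s])
    also have "\<dots> \<le> (\<Sum>j. C * (1 / real N) ^ Suc j)"
      by (rule suminf_le[OF bnd s geo])
    finally show ?thesis by simp
  qed
  have Xs: "X (d ## \<omega>) = 1 / real N * (X \<omega> + \<kappa> d)" for d \<omega>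
  proof -
    have "X (d ## \<omega>) = (\<Sum>j. \<kappa> ((d ## \<omega>) !! (Suc j)) / real N ^ Suc (Suc j)) + \<kappa> d / real N"
      unfolding X_def using suminf_split_head[OF summ[of "d ## \<omega>"]] by (simp add: algebra_simps)
    also have "(\<Sum>j. \<kappa> ((d ## \<omega>) !! (Suc j)) / real N ^ Suc (Suc j))
        = (\<Sum>j. (1 / real N) * (\<kappa> (\<omega> !! j) / real N ^ Suc j))" by simp
    also have "\<dots> = (1 / real N) * X \<omega>" unfolding X_def by (rule suminf_mult[OF summ])
    finally show ?thesis by (simp add: algebra_simps)
  qed
  define M where "M = distr S borel X"
  have pM: "prob_space M" unfolding M_def by (rule S.prob_space_distr) measurable
  interpret M: prob_space M by fact
  have "measure M E = 1 / real (card D) * (\<Sum>d\<in>D. measure M ((\<lambda>x. 1 / real N * (x + real_of_int d)) -` E))"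
    if E [measurable]: "E \<in> sets borel" for E
  proof -
    have pre: "(\<lambda>x. 1 / real N * (x + real_of_int d)) -` E \<in> sets borel" for d
      by (rule measurable_sets_borel[OF _ E]) measurable
    have "emeasure M E = emeasure S (X -` E \<inter> space S)"
      unfolding M_def by (rule emeasure_distr) measurable
    also have "\<dots> = (\<integral>\<^sup>+d. emeasure S {\<omega>\<in>space S. d ## \<omega> \<in> X -` E \<inter> space S} \<partial>P)"
      unfolding S_def by (rule P.emeasure_stream_space) (use measurable_sets[OF Xm E] in \<open>simp add: S_def\<close>)
    also have "\<dots> = (\<Sum>d\<in>D. emeasure S {\<omega>\<in>space S. d ## \<omega> \<in> X -` E \<inter> space S}) / card D"
      unfolding P_def using assms by (simp add: nn_integral_pmf_of_set)
    also have "\<dots> = (\<Sum>d\<in>D. emeasure M ((\<lambda>x. 1 / real N * (x + real_of_int d)) -` E)) / card D"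
    proof (rule arg_cong2[where f="(/)"], rule sum.cong)
      fix d assume d: "d \<in> D"
      have "emeasure M ((\<lambda>x. 1 / real N * (x + real_of_int d)) -` E)
          = emeasure S (X -` ((\<lambda>x. 1 / real N * (x + real_of_int d)) -` E) \<inter> space S)"
        unfolding M_def by (rule emeasure_distr[OF Xm pre])
      also have "X -` ((\<lambda>x. 1 / real N * (x + real_of_int d)) -` E) \<inter> space S
          = {\<omega>\<in>space S. d ## \<omega> \<in> X -` E \<inter> space S}"
        using d by (auto simp: spS Xs \<kappa>_def)
      finally show "emeasure S {\<omega>\<in>space S. d ## \<omega> \<in> X -` E \<inter> space S}
          = emeasure M ((\<lambda>x. 1 / real N * (x + real_of_int d)) -` E)" by simp
    qed auto
    finally show ?thesis
      using assms(1,2)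
      by (simp add: M.emeasure_eq_measure sum_ennreal ennreal_of_nat_eq_real_of_nat divide_ennreal sum_nonneg card_gt_0_iff)
  qed
  then have "is_self_similar_measure N D M"
    using pM by (simp add: is_self_similar_measure_def M_def)
  moreover have "AE x in M. \<bar>x\<bar> \<le> (\<Sum>j. C * (1 / real N) ^ Suc j)"
    unfolding M_def using Xb by (subst AE_distr_iff) auto
  ultimately show ?thesis by blast
qed

lemma
  assumes "finite D" "D \<noteq> {}" "2 \<le> N"
  shows self_similar_measure: "is_self_similar_measure N D (self_similar_measure N D)"
    and self_similar_measure_bounded: "\<exists>R. AE x in self_similar_measure N D. \<bar>x\<bar> \<le> R"
proof -
  obtain M R where M: "is_self_similar_measure N D M" "AE x in M. \<bar>x\<bar> \<le> R"
    using self_similar_measure_exists[OF assms] by blast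
  have "self_similar_measure N D = M"
    unfolding self_similar_measure_def
    by (rule the_equality) (use M self_similar_measure_unique assms in blast)+
  with M show "is_self_similar_measure N D (self_similar_measure N D)"
    "\<exists>R. AE x in self_similar_measure N D. \<bar>x\<bar> \<le> R" by auto
qed

section \<open>Completeness from Parseval sums\<close>

text \<open>Generated inductively, so that closure properties follow by rule induction. A frequency
  may be added repeatedly; its coefficients are merged only in \<open>trig_poly_sum\<close>.\<close>

inductive_set trig_poly :: "real set \<Rightarrow> (real \<Rightarrow> complex) set" for \<Lambda> where
  zero: "(\<lambda>x. 0) \<in> trig_poly \<Lambda>"
| step: "t \<in> trig_poly \<Lambda> \<Longrightarrow> \<xi> \<in> \<Lambda> \<Longrightarrow> (\<lambda>x. t x + c * expo \<xi> x) \<in> trig_poly \<Lambda>"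

lemma trig_poly_add: "t \<in> trig_poly \<Lambda> \<Longrightarrow> u \<in> trig_poly \<Lambda> \<Longrightarrow> (\<lambda>x. t x + u x) \<in> trig_poly \<Lambda>"
proof (induction t rule: trig_poly.induct)
  case (step t \<xi> c)
  from trig_poly.step[OF step.IH[OF step.prems] step.hyps(2), of c] show ?case
    by (simp add: add_ac)
qed simp

lemma trig_poly_scale: "t \<in> trig_poly \<Lambda> \<Longrightarrow> (\<lambda>x. a * t x) \<in> trig_poly \<Lambda>"
proof (induction t rule: trig_poly.induct)
  case (step t \<xi> c)
  from trig_poly.step[OF step.IH step.hyps(2), of "a * c"] show ?case
    by (simp add: algebra_simps)
qed (simp add: trig_poly.zero)

lemma trig_poly_expo: "\<xi> \<in> \<Lambda> \<Longrightarrow> (\<lambda>x. c * expo \<xi> x) \<in> trig_poly \<Lambda>"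
  using trig_poly.step[OF trig_poly.zero, of \<xi> \<Lambda> c] by simp

lemma trig_poly_const: "(\<lambda>x. c) \<in> trig_poly UNIV"
  using trig_poly_expo[of 0 UNIV c] by simp

lemma trig_poly_mult:
  "t \<in> trig_poly UNIV \<Longrightarrow> u \<in> trig_poly UNIV \<Longrightarrow> (\<lambda>x. t x * u x) \<in> trig_poly UNIV"
proof (induction t rule: trig_poly.induct)
  case (step t \<xi> c)
  have "(\<lambda>x. expo \<xi> x * u x) \<in> trig_poly UNIV" using step.prems
  proof (induction u rule: trig_poly.induct)
    case (step u \<eta> d)
    from trig_poly.step[OF step.IH UNIV_I[of "\<xi> + \<eta>"], of d] show ?case
      by (simp add: expo_add_left algebra_simps)
  qed (simp add: trig_poly.zero)
  from trig_poly_add[OF step.IH[OF step.prems] trig_poly_scale[OF this, of c]] show ?case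
    by (simp add: algebra_simps)
qed (simp add: trig_poly.zero)

lemma trig_poly_measurable: "t \<in> trig_poly \<Lambda> \<Longrightarrow> t \<in> borel_measurable borel"
  by (induction rule: trig_poly.induct) auto

lemma trig_poly_bounded: "t \<in> trig_poly \<Lambda> \<Longrightarrow> \<exists>C. \<forall>x. cmod (t x) \<le> C"
proof (induction rule: trig_poly.induct)
  case (step t \<xi> c)
  then obtain C where C: "\<And>x. cmod (t x) \<le> C" by blast
  have "cmod (t x + c * expo \<xi> x) \<le> C + cmod c" for x
    using norm_triangle_ineq[of "t x" "c * expo \<xi> x"] C[of x] by (simp add: norm_mult)
  then show ?case by blast
qed auto

lemma trig_poly_sum:
  "t \<in> trig_poly \<Lambda> \<Longrightarrow> \<exists>F c. finite F \<and> F \<subseteq> \<Lambda> \<and> t = (\<lambda>x. \<Sum>\<xi>\<in>F. c \<xi> * expo \<xi> x)"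
proof (induction rule: trig_poly.induct)
  case zero
  then show ?case by (intro exI[of _ "{}"]) simp
next
  case (step t \<xi> c)
  then obtain F a where F: "finite F" "F \<subseteq> \<Lambda>" "t = (\<lambda>x. \<Sum>\<xi>\<in>F. a \<xi> * expo \<xi> x)" by blast
  define b where "b = (\<lambda>\<zeta>. (if \<zeta> \<in> F then a \<zeta> else 0) + (if \<zeta> = \<xi> then c else 0))"
  have "t x + c * expo \<xi> x = (\<Sum>\<zeta>\<in>insert \<xi> F. b \<zeta> * expo \<zeta> x)" for x
  proof -
    have "(\<Sum>\<zeta>\<in>insert \<xi> F. b \<zeta> * expo \<zeta> x)
      = (\<Sum>\<zeta>\<in>insert \<xi> F. (if \<zeta> \<in> F then a \<zeta> * expo \<zeta> x else 0))
        + (\<Sum>\<zeta>\<in>insert \<xi> F. (if \<zeta> = \<xi> then c * expo \<zeta> x else 0))"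
      unfolding b_def sum.distrib[symmetric] by (intro sum.cong) (auto simp: algebra_simps)
    also have "(\<Sum>\<zeta>\<in>insert \<xi> F. (if \<zeta> \<in> F then a \<zeta> * expo \<zeta> x else 0)) = (\<Sum>\<zeta>\<in>F. a \<zeta> * expo \<zeta> x)"
      using F(1) by (intro sum.mono_neutral_cong_right) auto
    also have "(\<Sum>\<zeta>\<in>insert \<xi> F. (if \<zeta> = \<xi> then c * expo \<zeta> x else 0)) = c * expo \<xi> x"
      using F(1) by simp
    finally show ?thesis using F(3) by simp
  qed
  then show ?case using F step.hyps(2) by (intro exI[of _ "insert \<xi> F"] exI[of _ b]) auto
qed

section \<open>Mean square approximation by exponentials\<close>

locale borel_prob = prob_space M for M :: "real measure" +
  assumes sets_eq [measurable_cong]: "sets M = sets borel"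
begin

lemma space_eq: "space M = UNIV"
  using sets_eq_imp_space_eq[OF sets_eq] by simp

lemma borel_eq: "borel_measurable M = borel_measurable borel"
  by (rule measurable_cong_sets) (simp_all add: sets_eq)

definition approximable :: "real set \<Rightarrow> (real \<Rightarrow> complex) \<Rightarrow> bool" where
  "approximable \<Lambda> f \<longleftrightarrow> (\<forall>\<epsilon>>0. \<exists>t\<in>trig_poly \<Lambda>. (LINT x|M. (cmod (f x - t x))\<^sup>2) < \<epsilon>)"

definition square_int :: "(real \<Rightarrow> complex) \<Rightarrow> bool" where
  "square_int f \<longleftrightarrow> f \<in> borel_measurable borel \<and> integrable M (\<lambda>x. (cmod (f x))\<^sup>2)"

lemma square_int_bounded:
  assumes "f \<in> borel_measurable borel" "\<And>x. cmod (f x) \<le> C"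
  shows "square_int f"
  unfolding square_int_def
proof
  have [measurable]: "f \<in> borel_measurable M" using assms by (simp add: borel_eq)
  show "integrable M (\<lambda>x. (cmod (f x))\<^sup>2)"
    by (rule integrable_const_bound[where B="C\<^sup>2"]) (use assms(2) in \<open>auto intro!: power_mono\<close>)
qed fact

lemma trig_poly_square_int: "t \<in> trig_poly \<Lambda> \<Longrightarrow> square_int t"
  using trig_poly_bounded trig_poly_measurable square_int_bounded by blast

lemma norm_square_add: "(cmod (a + b))\<^sup>2 \<le> 2 * (cmod a)\<^sup>2 + 2 * (cmod b)\<^sup>2"
proof -
  have "(cmod (a + b))\<^sup>2 \<le> (cmod a + cmod b)\<^sup>2"
    by (intro power_mono norm_triangle_ineq) simp
  also have "\<dots> \<le> 2 * (cmod a)\<^sup>2 + 2 * (cmod b)\<^sup>2"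
    using zero_le_power2[of "cmod a - cmod b"] by (simp add: power2_eq_square algebra_simps)
  finally show ?thesis .
qed

lemma square_int_add:
  assumes "square_int f" "square_int h"
  shows "square_int (\<lambda>x. f x + h x)"
  unfolding square_int_def
proof
  have [measurable]: "f \<in> borel_measurable borel" "h \<in> borel_measurable borel"
    using assms by (auto simp: square_int_def)
  show "(\<lambda>x. f x + h x) \<in> borel_measurable borel" by measurable
  have "integrable M (\<lambda>x. 2 * (cmod (f x))\<^sup>2 + 2 * (cmod (h x))\<^sup>2)"
    using assms by (auto simp: square_int_def)
  then show "integrable M (\<lambda>x. (cmod (f x + h x))\<^sup>2)"
    by (rule Bochner_Integration.integrable_bound) (auto intro!: AE_I2 norm_square_add)
qed

lemma square_int_scale: "square_int f \<Longrightarrow> square_int (\<lambda>x. a * f x)"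
  by (auto simp: square_int_def norm_mult power_mult_distrib)

lemma square_int_diff:
  assumes "square_int f" "square_int h"
  shows "square_int (\<lambda>x. f x - h x)"
  using square_int_add[OF assms(1) square_int_scale[OF assms(2), of "-1"]] by simp

lemma approximable_closed:
  assumes "square_int f"
    and "\<And>\<epsilon>. 0 < \<epsilon> \<Longrightarrow> \<exists>h. square_int h \<and> approximable \<Lambda> h \<and> (LINT x|M. (cmod (f x - h x))\<^sup>2) < \<epsilon>"
  shows "approximable \<Lambda> f"
  unfolding approximable_def
proof (intro allI impI)
  fix \<epsilon> :: real assume "0 < \<epsilon>"
  then obtain h where h: "square_int h" "approximable \<Lambda> h" "(LINT x|M. (cmod (f x - h x))\<^sup>2) < \<epsilon> / 4"
    using assms(2)[of "\<epsilon> / 4"] by auto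
  then obtain t where t: "t \<in> trig_poly \<Lambda>" "(LINT x|M. (cmod (h x - t x))\<^sup>2) < \<epsilon> / 4"
    using \<open>0 < \<epsilon>\<close> unfolding approximable_def by (metis zero_less_divide_iff zero_less_numeral)
  have i: "integrable M (\<lambda>x. (cmod (f x - h x))\<^sup>2)" "integrable M (\<lambda>x. (cmod (h x - t x))\<^sup>2)"
      "integrable M (\<lambda>x. (cmod (f x - t x))\<^sup>2)"
    using square_int_diff assms(1) h(1) trig_poly_square_int[OF t(1)] by (auto simp: square_int_def)
  have "(LINT x|M. (cmod (f x - t x))\<^sup>2) \<le> (LINT x|M. 2 * (cmod (f x - h x))\<^sup>2 + 2 * (cmod (h x - t x))\<^sup>2)"
    using i norm_square_add[of "f x - h x" "h x - t x" for x] by (intro integral_mono) auto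
  also have "\<dots> < \<epsilon>" using i h(3) t(2) by simp
  finally show "\<exists>t\<in>trig_poly \<Lambda>. (LINT x|M. (cmod (f x - t x))\<^sup>2) < \<epsilon>" using t(1) by blast
qed

lemma approximable_add:
  assumes "square_int f" "square_int h" "approximable \<Lambda> f" "approximable \<Lambda> h"
  shows "approximable \<Lambda> (\<lambda>x. f x + h x)"
  unfolding approximable_def
proof (intro allI impI)
  fix \<epsilon> :: real assume e: "0 < \<epsilon>"
  then have "0 < \<epsilon> / 4" by simp
  then obtain t u where t: "t \<in> trig_poly \<Lambda>" "(LINT x|M. (cmod (f x - t x))\<^sup>2) < \<epsilon> / 4"
    and u: "u \<in> trig_poly \<Lambda>" "(LINT x|M. (cmod (h x - u x))\<^sup>2) < \<epsilon> / 4"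
    using assms(3,4) unfolding approximable_def by blast
  have si: "square_int (\<lambda>x. f x - t x)" "square_int (\<lambda>x. h x - u x)"
    using square_int_diff assms(1,2) trig_poly_square_int t(1) u(1) by auto
  have i: "integrable M (\<lambda>x. (cmod (f x - t x))\<^sup>2)" "integrable M (\<lambda>x. (cmod (h x - u x))\<^sup>2)"
      "integrable M (\<lambda>x. (cmod ((f x - t x) + (h x - u x)))\<^sup>2)"
    using si square_int_add[OF si] by (auto simp: square_int_def)
  have "(LINT x|M. (cmod ((f x - t x) + (h x - u x)))\<^sup>2)
      \<le> (LINT x|M. 2 * (cmod (f x - t x))\<^sup>2 + 2 * (cmod (h x - u x))\<^sup>2)"
    using i norm_square_add by (intro integral_mono) auto
  also have "\<dots> < \<epsilon>" using i t(2) u(2) by simp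
  finally have "(LINT x|M. (cmod ((f x + h x) - (t x + u x)))\<^sup>2) < \<epsilon>" by (simp add: algebra_simps)
  then show "\<exists>t\<in>trig_poly \<Lambda>. (LINT x|M. (cmod ((f x + h x) - t x))\<^sup>2) < \<epsilon>"
    by (intro bexI[of _ "\<lambda>x. t x + u x"]) (use trig_poly_add[OF t(1) u(1)] in auto)
qed

lemma approximable_scale:
  assumes "approximable \<Lambda> f"
  shows "approximable \<Lambda> (\<lambda>x. a * f x)"
  unfolding approximable_def
proof (intro allI impI)
  fix \<epsilon> :: real assume e: "0 < \<epsilon>"
  define \<delta> where "\<delta> = \<epsilon> / (1 + (cmod a)\<^sup>2)"
  have d: "0 < \<delta>" using e by (simp add: \<delta>_def add_pos_nonneg)
  then obtain t where t: "t \<in> trig_poly \<Lambda>" "(LINT x|M. (cmod (f x - t x))\<^sup>2) < \<delta>"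
    using assms unfolding approximable_def by blast
  have "(LINT x|M. (cmod (a * f x - a * t x))\<^sup>2) = (cmod a)\<^sup>2 * (LINT x|M. (cmod (f x - t x))\<^sup>2)"
    by (simp add: right_diff_distrib[symmetric] norm_mult power_mult_distrib)
  also have "\<dots> \<le> (cmod a)\<^sup>2 * \<delta>" using t(2) by (intro mult_left_mono) auto
  also have "\<dots> < (1 + (cmod a)\<^sup>2) * \<delta>" using d by simp
  also have "\<dots> = \<epsilon>"
  proof -
    have "1 + (cmod a)\<^sup>2 \<noteq> 0" using add_pos_nonneg[of 1 "(cmod a)\<^sup>2"] by simp
    then show ?thesis by (simp add: \<delta>_def)
  qed
  finally show "\<exists>t\<in>trig_poly \<Lambda>. (LINT x|M. (cmod (a * f x - t x))\<^sup>2) < \<epsilon>"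
    by (intro bexI[of _ "\<lambda>x. a * t x"]) (use trig_poly_scale[OF t(1)] in auto)
qed

lemma approximable_0: "approximable \<Lambda> (\<lambda>x. 0)"
  unfolding approximable_def by (auto intro!: bexI[OF _ trig_poly.zero])

lemma approximable_sum:
  assumes "finite I" "\<And>i. i \<in> I \<Longrightarrow> square_int (f i) \<and> approximable \<Lambda> (f i)"
  shows "approximable \<Lambda> (\<lambda>x. \<Sum>i\<in>I. f i x) \<and> square_int (\<lambda>x. \<Sum>i\<in>I. f i x)"
  using assms
proof (induction I rule: finite_induct)
  case empty
  show ?case by (simp add: approximable_0 square_int_bounded[of _ 0])
qed (simp add: approximable_add square_int_add)

text \<open>Under a square integrable majorant, dominated convergence turns pointwise limits into
  limits in mean square.\<close>

lemma approximable_limit: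
  assumes h: "\<And>n::nat. approximable \<Lambda> (h n)" "\<And>n. h n \<in> borel_measurable borel"
    and f: "f \<in> borel_measurable borel" and lim: "\<And>x. (\<lambda>n. h n x) \<longlonglongrightarrow> f x"
    and w: "w \<in> borel_measurable borel" "integrable M (\<lambda>x. (w x)\<^sup>2)"
    and bound: "\<And>n x. cmod (h n x) \<le> w x" "\<And>x. cmod (f x) \<le> w x"
  shows "approximable \<Lambda> f"
proof (rule approximable_closed)
  have [measurable]: "h n \<in> borel_measurable borel" "f \<in> borel_measurable borel" for n
    using h f by auto
  have w0: "0 \<le> w x" for x using bound(2)[of x] norm_ge_zero order_trans by blast
  show "square_int f" unfolding square_int_def
    by (intro conjI Bochner_Integration.integrable_bound[OF w(2)])
      (use bound(2) w0 in \<open>auto intro!: power_mono\<close>)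
  have sh: "square_int (h n)" for n unfolding square_int_def
    by (intro conjI Bochner_Integration.integrable_bound[OF w(2)])
      (use bound(1) w0 in \<open>auto intro!: power_mono\<close>)
  fix \<epsilon> :: real assume e: "0 < \<epsilon>"
  have "(\<lambda>n. LINT x|M. (cmod (f x - h n x))\<^sup>2) \<longlonglongrightarrow> (LINT x|M. 0)"
  proof (rule integral_dominated_convergence[where w="\<lambda>x. 4 * (w x)\<^sup>2"])
    show "AE x in M. (\<lambda>n. (cmod (f x - h n x))\<^sup>2) \<longlonglongrightarrow> 0"
    proof (rule AE_I2)
      fix x
      have "(\<lambda>n. (cmod (f x - h n x))\<^sup>2) \<longlonglongrightarrow> (cmod (f x - f x))\<^sup>2"
        by (intro tendsto_intros lim)
      then show "(\<lambda>n. (cmod (f x - h n x))\<^sup>2) \<longlonglongrightarrow> 0" by simp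
    qed
    show "AE x in M. norm ((cmod (f x - h n x))\<^sup>2) \<le> 4 * (w x)\<^sup>2" for n
    proof (rule AE_I2)
      fix x
      have "cmod (f x - h n x) \<le> 2 * w x"
        using norm_triangle_ineq4[of "f x" "h n x"] bound(1)[of n x] bound(2)[of x] by simp
      then have "(cmod (f x - h n x))\<^sup>2 \<le> (2 * w x)\<^sup>2" by (intro power_mono) auto
      then show "norm ((cmod (f x - h n x))\<^sup>2) \<le> 4 * (w x)\<^sup>2" by (simp add: power_mult_distrib)
    qed
  qed (use w in auto)
  then have "\<forall>\<^sub>F n in sequentially. (LINT x|M. (cmod (f x - h n x))\<^sup>2) < \<epsilon>"
    using e by (intro order_tendstoD) auto
  then obtain n where "(LINT x|M. (cmod (f x - h n x))\<^sup>2) < \<epsilon>"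
    by (auto simp: eventually_sequentially)
  then show "\<exists>h. square_int h \<and> approximable \<Lambda> h \<and> (LINT x|M. (cmod (f x - h x))\<^sup>2) < \<epsilon>"
    using sh h(1) by blast
qed

lemma integrable_expo': "integrable M (expo \<xi>)"
  by (rule integrable_expo[OF prob_space_axioms sets_eq])

text \<open>\<open>FT M (\<eta> - \<xi>)\<close> is the inner product of two exponentials, so the
  sum on the left is the orthogonal projection of \<open>expo \<eta>\<close> and the right side its
  squared distance from the span. Completeness thus becomes a matter of Parseval sums close to
  \<open>1\<close>.\<close>

lemma Bessel_identity:
  assumes "finite F" and orth: "\<And>\<xi> \<xi>'. \<xi> \<in> F \<Longrightarrow> \<xi>' \<in> F \<Longrightarrow> \<xi> \<noteq> \<xi>' \<Longrightarrow> FT M (\<xi> - \<xi>') = 0"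
  shows "(LINT x|M. (cmod (expo \<eta> x - (\<Sum>\<xi>\<in>F. FT M (\<eta> - \<xi>) * expo \<xi> x)))\<^sup>2)
     = 1 - (\<Sum>\<xi>\<in>F. (cmod (FT M (\<eta> - \<xi>)))\<^sup>2)"
proof -
  define c where "c = (\<lambda>\<xi>. FT M (\<eta> - \<xi>))"
  let ?S = "\<Sum>\<xi>\<in>F. complex_of_real ((cmod (c \<xi>))\<^sup>2)"
  have cc: "c \<xi> * cnj (c \<xi>) = complex_of_real ((cmod (c \<xi>))\<^sup>2)" for \<xi>
    by (metis complex_norm_square)
  have cm: "FT M (\<xi> - \<eta>) = cnj (c \<xi>)" for \<xi>
    unfolding c_def FT_minus[symmetric] by simp
  have expand: "complex_of_real ((cmod (expo \<eta> x - (\<Sum>\<xi>\<in>F. c \<xi> * expo \<xi> x)))\<^sup>2)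
     = 1 - (\<Sum>\<xi>\<in>F. cnj (c \<xi>) * expo (\<eta> - \<xi>) x) - (\<Sum>\<xi>\<in>F. c \<xi> * expo (\<xi> - \<eta>) x)
       + (\<Sum>\<xi>\<in>F. \<Sum>\<xi>'\<in>F. c \<xi> * cnj (c \<xi>') * expo (\<xi> - \<xi>') x)" for x
  proof -
    have "complex_of_real ((cmod (expo \<eta> x - (\<Sum>\<xi>\<in>F. c \<xi> * expo \<xi> x)))\<^sup>2)
      = (expo \<eta> x - (\<Sum>\<xi>\<in>F. c \<xi> * expo \<xi> x)) * (cnj (expo \<eta> x) - (\<Sum>\<xi>\<in>F. cnj (c \<xi>) * cnj (expo \<xi> x)))"
      using complex_norm_square[of "expo \<eta> x - (\<Sum>\<xi>\<in>F. c \<xi> * expo \<xi> x)"] by (simp add: cnj_sum)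
    also have "\<dots> = expo \<eta> x * cnj (expo \<eta> x) - (\<Sum>\<xi>\<in>F. cnj (c \<xi>) * (expo \<eta> x * cnj (expo \<xi> x)))
        - (\<Sum>\<xi>\<in>F. c \<xi> * (expo \<xi> x * cnj (expo \<eta> x)))
        + (\<Sum>\<xi>\<in>F. \<Sum>\<xi>'\<in>F. c \<xi> * cnj (c \<xi>') * (expo \<xi> x * cnj (expo \<xi>' x)))"
    proof -
      have "(\<Sum>\<xi>\<in>F. cnj (c \<xi>) * (expo \<eta> x * cnj (expo \<xi> x))) = expo \<eta> x * (\<Sum>\<xi>\<in>F. cnj (c \<xi>) * cnj (expo \<xi> x))"
        by (simp add: sum_distrib_left mult_ac)
      moreover have "(\<Sum>\<xi>\<in>F. c \<xi> * (expo \<xi> x * cnj (expo \<eta> x))) = (\<Sum>\<xi>\<in>F. c \<xi> * expo \<xi> x) * cnj (expo \<eta> x)"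
        by (simp only: sum_distrib_right mult.assoc)
      moreover have "(\<Sum>\<xi>\<in>F. \<Sum>\<xi>'\<in>F. c \<xi> * cnj (c \<xi>') * (expo \<xi> x * cnj (expo \<xi>' x)))
          = (\<Sum>\<xi>\<in>F. c \<xi> * expo \<xi> x) * (\<Sum>\<xi>\<in>F. cnj (c \<xi>) * cnj (expo \<xi> x))"
        by (simp add: sum_product mult_ac)
      ultimately show ?thesis by (simp only:) (simp add: algebra_simps)
    qed
    finally show ?thesis by (simp only: expo_mult_cnj) simp
  qed
  have "(LINT x|M. complex_of_real ((cmod (expo \<eta> x - (\<Sum>\<xi>\<in>F. c \<xi> * expo \<xi> x)))\<^sup>2))
     = 1 - (\<Sum>\<xi>\<in>F. cnj (c \<xi>) * FT M (\<eta> - \<xi>)) - (\<Sum>\<xi>\<in>F. c \<xi> * FT M (\<xi> - \<eta>))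
       + (\<Sum>\<xi>\<in>F. \<Sum>\<xi>'\<in>F. c \<xi> * cnj (c \<xi>') * FT M (\<xi> - \<xi>'))"
    unfolding expand FT_def using integrable_expo'
    by (simp add: prob_space Bochner_Integration.integral_sum)
  also have "(\<Sum>\<xi>\<in>F. \<Sum>\<xi>'\<in>F. c \<xi> * cnj (c \<xi>') * FT M (\<xi> - \<xi>')) = ?S"
  proof (rule sum.cong)
    fix \<xi> assume "\<xi> \<in> F"
    then have "(\<Sum>\<xi>'\<in>F. c \<xi> * cnj (c \<xi>') * FT M (\<xi> - \<xi>'))
        = (\<Sum>\<xi>'\<in>F. if \<xi>' = \<xi> then c \<xi> * cnj (c \<xi>') * FT M (\<xi> - \<xi>') else 0)"
      using orth by (intro sum.cong) auto
    also have "\<dots> = complex_of_real ((cmod (c \<xi>))\<^sup>2)"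
      using assms(1) \<open>\<xi> \<in> F\<close> FT_0[OF prob_space_axioms] by (simp add: cc)
    finally show "(\<Sum>\<xi>'\<in>F. c \<xi> * cnj (c \<xi>') * FT M (\<xi> - \<xi>')) = complex_of_real ((cmod (c \<xi>))\<^sup>2)" .
  qed simp
  also have "(\<Sum>\<xi>\<in>F. cnj (c \<xi>) * FT M (\<eta> - \<xi>)) = ?S"
    by (rule sum.cong[OF refl]) (metis cc c_def mult.commute)
  also have "(\<Sum>\<xi>\<in>F. c \<xi> * FT M (\<xi> - \<eta>)) = ?S"
    unfolding cm cc ..
  finally have "complex_of_real (LINT x|M. (cmod (expo \<eta> x - (\<Sum>\<xi>\<in>F. c \<xi> * expo \<xi> x)))\<^sup>2)
      = complex_of_real (1 - (\<Sum>\<xi>\<in>F. (cmod (c \<xi>))\<^sup>2))"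
    by (simp only: integral_complex_of_real of_real_diff of_real_1 of_real_sum diff_add_cancel)
  then show ?thesis unfolding c_def of_real_eq_iff .
qed

lemma approximable_trig_poly:
  assumes "\<And>\<eta>. approximable \<Lambda> (expo \<eta>)" "t \<in> trig_poly UNIV"
  shows "approximable \<Lambda> t"
  using assms(2)
proof (induction rule: trig_poly.induct)
  case (step t \<xi> c)
  show ?case
    by (intro approximable_add approximable_scale assms(1) step.IH square_int_scale
        trig_poly_square_int[OF step.hyps(1)] square_int_bounded[of _ 1]) auto
qed (rule approximable_0)

text \<open>The support lies in a compact interval, where Stone-Weierstrass gives uniform
  approximation by real trigonometric polynomials with arbitrary frequencies.\<close>

lemma approximable_continuous:
  fixes h :: "real \<Rightarrow> real"
  assumes expo: "\<And>\<eta>. approximable \<Lambda> (expo \<eta>)" and supp: "AE x in M. \<bar>x\<bar> \<le> R"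
    and h: "continuous_on UNIV h" "\<And>x. \<bar>h x\<bar> \<le> C"
  shows "approximable \<Lambda> (\<lambda>x. complex_of_real (h x))"
proof (rule approximable_closed)
  have [measurable]: "h \<in> borel_measurable borel"
    using h(1) by (rule borel_measurable_continuous_onI)
  show sh: "square_int (\<lambda>x. complex_of_real (h x))"
    by (rule square_int_bounded[where C=C]) (use h(2) in auto)
  fix \<epsilon> :: real assume e: "0 < \<epsilon>"
  let ?P = "\<lambda>f :: real \<Rightarrow> real. (\<lambda>x. complex_of_real (f x)) \<in> trig_poly UNIV"
  have cont: "continuous_on S f" if Pf: "?P f" for f S
  proof -
    obtain F c where F: "(\<lambda>x. complex_of_real (f x)) = (\<lambda>x. \<Sum>\<xi>\<in>F. c \<xi> * expo \<xi> x)"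
      using trig_poly_sum[OF Pf] by blast
    have "f = (\<lambda>x. Re (\<Sum>\<xi>\<in>F. c \<xi> * expo \<xi> x))"
      using F by (metis Re_complex_of_real)
    moreover have "continuous_on S (\<lambda>x. Re (\<Sum>\<xi>\<in>F. c \<xi> * expo \<xi> x))"
      unfolding expo_def cis_conv_exp by (intro continuous_intros)
    ultimately show ?thesis by simp
  qed
  have "\<exists>g. ?P g \<and> (\<forall>x\<in>{-R..R}. \<bar>h x - g x\<bar> < sqrt \<epsilon> / 2)"
  proof (rule Stone_Weierstrass_HOL)
    fix f g :: "real \<Rightarrow> real" assume fg: "?P f \<and> ?P g"
    show "?P (\<lambda>x. f x + g x)" "?P (\<lambda>x. f x * g x)"
      using fg trig_poly_add[of _ UNIV] trig_poly_mult by (simp_all add: trig_poly_add trig_poly_mult)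
  next
    fix x y :: real assume xy: "x \<in> {-R..R} \<and> y \<in> {-R..R} \<and> x \<noteq> y"
    \<comment> \<open>At this frequency the argument of the sine stays within \<open>pi / 2\<close>
      in modulus, where sine is injective; a single function separates all points of the
      interval.\<close>
    define \<xi> where "\<xi> = 1 / (4 * (R + 1))"
    have R: "0 \<le> R" using xy by auto
    have "?P (\<lambda>x. sin (2 * pi * \<xi> * x))"
    proof -
      have "complex_of_real (sin (2 * pi * \<xi> * x)) = (0 + 1 / (2 * \<i>) * expo \<xi> x) + - 1 / (2 * \<i>) * expo (- \<xi>) x" for x
        by (rule complex_eqI) (simp_all add: expo_def Re_divide Im_divide)
      then show ?thesis
        by (simp only:) (intro trig_poly.intros UNIV_I)
    qed
    moreover have "sin (2 * pi * \<xi> * x) \<noteq> sin (2 * pi * \<xi> * y)"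
    proof
      have b: "\<bar>2 * pi * \<xi> * u\<bar> \<le> pi / 2" if "u \<in> {-R..R}" for u
      proof -
        have "\<bar>u\<bar> \<le> R + 1" using that by auto
        then show ?thesis using R by (simp add: \<xi>_def abs_mult divide_simps)
      qed
      assume "sin (2 * pi * \<xi> * x) = sin (2 * pi * \<xi> * y)"
      then have "2 * pi * \<xi> * x = 2 * pi * \<xi> * y"
      proof (rule sin_inj_pi[rotated 4])
      qed (use b[of x] b[of y] xy in \<open>auto simp only: abs_le_iff minus_le_iff\<close>)
      then show False using xy R by (simp add: \<xi>_def)
    qed
    ultimately show "\<exists>f. ?P f \<and> f x \<noteq> f y"
      by (intro exI[of _ "\<lambda>x. sin (2 * pi * \<xi> * x)"]) simp
  qed (use e h cont trig_poly_const in \<open>auto intro: continuous_on_subset\<close>)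
  then obtain g where g: "?P g" "\<And>x. x \<in> {-R..R} \<Longrightarrow> \<bar>h x - g x\<bar> < sqrt \<epsilon> / 2" by blast
  have sg: "square_int (\<lambda>x. complex_of_real (g x))" by (rule trig_poly_square_int[OF g(1)])
  have i: "integrable M (\<lambda>x. (cmod (complex_of_real (h x) - complex_of_real (g x)))\<^sup>2)"
    using square_int_diff[OF sh sg] by (simp add: square_int_def)
  have "(LINT x|M. (cmod (complex_of_real (h x) - complex_of_real (g x)))\<^sup>2) \<le> (LINT x|M. \<epsilon> / 4)"
  proof (rule integral_mono_AE[OF i])
    show "AE x in M. (cmod (complex_of_real (h x) - complex_of_real (g x)))\<^sup>2 \<le> \<epsilon> / 4"
      using supp
    proof eventually_elim
      fix x assume "\<bar>x\<bar> \<le> R"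
      then have "\<bar>h x - g x\<bar> \<le> sqrt \<epsilon> / 2" using g(2)[of x] by (auto simp: abs_le_iff)
      then have "\<bar>h x - g x\<bar>\<^sup>2 \<le> (sqrt \<epsilon> / 2)\<^sup>2" by (intro power_mono) auto
      then show "(cmod (complex_of_real (h x) - complex_of_real (g x)))\<^sup>2 \<le> \<epsilon> / 4"
        using e unfolding of_real_diff[symmetric] norm_of_real by (simp add: power_divide)
    qed
  qed simp
  also have "\<dots> < \<epsilon>" using e by (simp add: prob_space)
  finally show "\<exists>h'. square_int h' \<and> approximable \<Lambda> h' \<and> (LINT x|M. (cmod (complex_of_real (h x) - h' x))\<^sup>2) < \<epsilon>"
    using sg approximable_trig_poly[OF expo g(1)]
    by (intro exI[of _ "\<lambda>x. complex_of_real (g x)"]) auto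
qed

text \<open>Continuous ramps that fall from \<open>1\<close> to \<open>0\<close> with slope
  \<open>n\<close> to the right of \<open>a\<close> converge pointwise to the indicator.\<close>

lemma approximable_atMost:
  assumes expo: "\<And>\<eta>. approximable \<Lambda> (expo \<eta>)" and supp: "AE x in M. \<bar>x\<bar> \<le> R"
  shows "approximable \<Lambda> (\<lambda>x. indicator {..a} x)"
proof (rule approximable_limit[where w="\<lambda>x. 1"])
  let ?h = "\<lambda>n x. max 0 (min 1 (1 - real n * (x - a)))"
  show "approximable \<Lambda> (\<lambda>x. complex_of_real (?h n x))" for n
    by (rule approximable_continuous[OF expo supp, of _ 1]) (auto intro!: continuous_intros)
  show "(\<lambda>n. complex_of_real (?h n x)) \<longlonglongrightarrow> indicator {..a} x" for x
  proof (cases "x \<le> a")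
    case True
    have "?h n x = 1" for n
    proof -
      have "real n * (x - a) \<le> 0" using True by (simp add: mult_le_0_iff)
      then show ?thesis by simp
    qed
    then show ?thesis using True by simp
  next
    case False
    then obtain n0 :: nat where n0: "1 < real n0 * (x - a)"
      using ex_less_of_nat_mult[of "x - a" 1] by auto
    have "\<forall>\<^sub>F n in sequentially. complex_of_real (?h n x) = 0"
    proof (rule eventually_sequentiallyI)
      fix n assume "n0 \<le> n"
      then have "real n0 * (x - a) \<le> real n * (x - a)" using False by (intro mult_right_mono) auto
      then show "complex_of_real (?h n x) = 0" using n0 by simp
    qed
    then show ?thesis using False by (simp add: tendsto_eventually)
  qed
qed (auto simp: prob_space indicator_def)

text \<open>Dynkin's argument, starting from the closed half-lines: complements and disjoint
  countable unions preserve approximability.\<close>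

lemma approximable_indicator:
  assumes expo: "\<And>\<eta>. approximable \<Lambda> (expo \<eta>)" and supp: "AE x in M. \<bar>x\<bar> \<le> R"
    and E: "E \<in> sets borel"
  shows "approximable \<Lambda> (\<lambda>x. indicator E x)"
proof -
  have "Int_stable (range (\<lambda>a::real. {..a}))"
    by (auto simp: Int_stable_def)
  moreover have "range (\<lambda>a::real. {..a}) \<subseteq> Pow UNIV" by auto
  moreover have "E \<in> sigma_sets UNIV (range (\<lambda>a::real. {..a}))"
    using E by (simp add: borel_eq_atMost)
  ultimately show ?thesis
  proof (induction rule: sigma_sets_induct_disjoint)
    case (basic A)
    then show ?case using approximable_atMost[OF expo supp] by auto
  next
    case empty
    then show ?case by (simp add: approximable_0)
  next
    case (compl A)
    then have A: "A \<in> sets borel" by (simp add: borel_eq_atMost)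
    have "approximable \<Lambda> (\<lambda>x. expo 0 x + (-1) * indicator A x)"
      using A by (intro approximable_add expo approximable_scale compl.IH square_int_scale
          square_int_bounded[of _ 1]) (auto simp: indicator_def)
    moreover have "(\<lambda>x. expo 0 x + (-1) * indicator A x) = (\<lambda>x. indicator (UNIV - A) x)"
      by (auto simp: fun_eq_iff indicator_def)
    ultimately show ?case by simp
  next
    case (union A)
    then have A [measurable]: "A i \<in> sets borel" for i by (auto simp: borel_eq_atMost)
    have sA: "square_int (\<lambda>x. indicator (A i) x)" for i
      by (rule square_int_bounded[of _ 1]) (auto simp: indicator_def)
    have eq: "(\<Sum>i<n. indicator (A i) x) = (indicator (\<Union>i<n. A i) x :: complex)" for n x
    proof -
      have "disjoint_family_on A {..<n}" using union(1) by (auto simp: disjoint_family_on_def)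
      then show ?thesis by (simp add: indicator_UN_disjoint)
    qed
    show ?case
    proof (rule approximable_limit[where w="\<lambda>x. 1" and h="\<lambda>n x. \<Sum>i<n. indicator (A i) x"])
      show "approximable \<Lambda> (\<lambda>x. \<Sum>i<n. indicator (A i) x)" for n
        using approximable_sum[of "{..<n}" "\<lambda>i x. indicator (A i) x"] sA union.IH by simp
      show "(\<lambda>n. \<Sum>i<n. indicator (A i) x) \<longlonglongrightarrow> (indicator (\<Union> (range A)) x :: complex)" for x
        unfolding eq
        by (rule LIMSEQ_indicator_UN)
      show "cmod (\<Sum>i<n. indicator (A i) x) \<le> 1" for n x
        unfolding eq by (simp add: indicator_def)
    qed (auto simp: prob_space indicator_def)
  qed
qed

lemma approximable_square_int:
  assumes expo: "\<And>\<eta>. approximable \<Lambda> (expo \<eta>)" and supp: "AE x in M. \<bar>x\<bar> \<le> R"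
    and f: "square_int f"
  shows "approximable \<Lambda> f"
proof -
  have fm: "f \<in> borel_measurable M" using f by (simp add: square_int_def borel_eq)
  obtain F where F: "\<And>i. simple_function M (F i)" "\<And>x. (\<lambda>i. F i x) \<longlonglongrightarrow> f x"
      "\<And>i x. cmod (F i x) \<le> 2 * cmod (f x)"
    using borel_measurable_implies_sequence_metric[OF fm, of 0] by (auto simp: space_eq)
  show ?thesis
  proof (rule approximable_limit[where w="\<lambda>x. 2 * cmod (f x)" and h=F])
    fix i
    show Fm: "F i \<in> borel_measurable borel"
      using borel_measurable_simple_function[OF F(1)] by (simp add: borel_eq)
    have "square_int (\<lambda>x. y * indicator (F i -` {y}) x) \<and> approximable \<Lambda> (\<lambda>x. y * indicator (F i -` {y}) x)" for y
    proof
      have E: "F i -` {y} \<in> sets borel" using measurable_sets_borel[OF Fm, of "{y}"] by simp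
      show "square_int (\<lambda>x. y * indicator (F i -` {y}) x)"
      proof (intro square_int_scale square_int_bounded[of _ 1])
        show "(\<lambda>x. indicator (F i -` {y}) x :: complex) \<in> borel_measurable borel"
          using E by (rule borel_measurable_indicator)
      qed (simp add: indicator_def)
      show "approximable \<Lambda> (\<lambda>x. y * indicator (F i -` {y}) x)"
        by (intro approximable_scale approximable_indicator[OF expo supp] E)
    qed
    moreover have "finite (range (F i))" using F(1)[of i] by (simp add: simple_function_def space_eq)
    ultimately have "approximable \<Lambda> (\<lambda>x. \<Sum>y\<in>range (F i). y * indicator (F i -` {y}) x)"
      using approximable_sum[of "range (F i)" "\<lambda>y x. y * indicator (F i -` {y}) x"] by blast
    moreover have "(\<Sum>y\<in>range (F i). y * indicator (F i -` {y}) x) = F i x" for x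
    proof -
      have "(\<Sum>y\<in>range (F i). y * indicator (F i -` {y}) x) = (\<Sum>y\<in>range (F i). if y = F i x then y else 0)"
        by (intro sum.cong) (auto simp: indicator_def)
      also have "\<dots> = F i x"
        using F(1)[of i] by (simp add: simple_function_def space_eq)
      finally show ?thesis .
    qed
    ultimately show "approximable \<Lambda> (F i)" by simp
  qed (use f F in \<open>auto simp: square_int_def power_mult_distrib\<close>)
qed

text \<open>Only exponentials have to be approximated: continuous functions, half-lines, Borel sets,
  simple functions and finally square integrable functions follow in turn.\<close>

lemma is_spectrumI:
  assumes supp: "AE x in M. \<bar>x\<bar> \<le> R" and "countable \<Lambda>"
    and orth: "\<And>\<xi> \<xi>'. \<xi> \<in> \<Lambda> \<Longrightarrow> \<xi>' \<in> \<Lambda> \<Longrightarrow> \<xi> \<noteq> \<xi>' \<Longrightarrow> FT M (\<xi> - \<xi>') = 0"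
    and compl: "\<And>\<eta> \<epsilon>. 0 < \<epsilon> \<Longrightarrow>
      \<exists>F. finite F \<and> F \<subseteq> \<Lambda> \<and> 1 - \<epsilon> < (\<Sum>\<xi>\<in>F. (cmod (FT M (\<eta> - \<xi>)))\<^sup>2)"
  shows "is_spectrum M \<Lambda>"
proof -
  have expo: "approximable \<Lambda> (expo \<eta>)" for \<eta>
    unfolding approximable_def
  proof (intro allI impI)
    fix \<epsilon> :: real assume "0 < \<epsilon>"
    then obtain F where F: "finite F" "F \<subseteq> \<Lambda>" "1 - \<epsilon> < (\<Sum>\<xi>\<in>F. (cmod (FT M (\<eta> - \<xi>)))\<^sup>2)"
      using compl by blast
    let ?t = "\<lambda>x. \<Sum>\<xi>\<in>F. FT M (\<eta> - \<xi>) * expo \<xi> x"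
    have "?t \<in> trig_poly \<Lambda>" using F(1,2)
      by (induction F rule: finite_induct)
        (auto intro: trig_poly.zero trig_poly_add[OF trig_poly_expo])
    moreover have "(LINT x|M. (cmod (expo \<eta> x - ?t x))\<^sup>2) < \<epsilon>"
      using F orth by (subst Bessel_identity) auto
    ultimately show "\<exists>t\<in>trig_poly \<Lambda>. (LINT x|M. (cmod (expo \<eta> x - t x))\<^sup>2) < \<epsilon>"
      by (intro bexI[of _ ?t]) auto
  qed
  show ?thesis
    unfolding is_spectrum_def
  proof (intro conjI ballI impI allI)
    fix \<xi> \<xi>' assume "\<xi> \<in> \<Lambda>" "\<xi>' \<in> \<Lambda>" "\<xi> \<noteq> \<xi>'"
    then show "(LINT x|M. expo \<xi> x * cnj (expo \<xi>' x)) = 0"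
      using orth by (simp add: expo_mult_cnj FT_def)
  next
    fix f :: "real \<Rightarrow> complex" and \<epsilon> :: real
    assume f: "f \<in> borel_measurable M" "integrable M (\<lambda>x. (cmod (f x))\<^sup>2)" and e: "0 < \<epsilon>"
    then have "square_int f" by (simp add: square_int_def borel_eq)
    from approximable_square_int[OF expo supp this] e
    obtain t where t: "t \<in> trig_poly \<Lambda>" "(LINT x|M. (cmod (f x - t x))\<^sup>2) < \<epsilon>"
      unfolding approximable_def by blast
    then show "\<exists>F c. finite F \<and> F \<subseteq> \<Lambda> \<and> (LINT x|M. (cmod (f x - (\<Sum>\<xi>\<in>F. c \<xi> * expo \<xi> x)))\<^sup>2) < \<epsilon>"
      using trig_poly_sum[OF t(1)] by blast
  qed fact
qed

end

section \<open>Zeros of the Fourier transform\<close>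

lemma finite_expo_eq: "finite {x \<in> {a..b}. expo x 1 = w}"
proof (cases "{x \<in> {a..b}. expo x 1 = w} = {}")
  case False
  then obtain x0 where x0: "expo x0 1 = w" by blast
  have "{x \<in> {a..b}. expo x 1 = w} \<subseteq> (\<lambda>z. x0 + of_int z) ` {\<lfloor>a - x0\<rfloor>..\<lceil>b - x0\<rceil>}"
  proof
    fix x assume x: "x \<in> {x \<in> {a..b}. expo x 1 = w}"
    have "expo (x - x0) 1 = 1"
      using x x0 expo_mult_cnj[of x 1 x0] by (metis (mono_tags) expo_0(1) expo_mult_cnj mem_Collect_eq right_minus_eq)
    then have "cos (2 * pi * (x - x0)) = 1" by (simp add: expo_def complex_eq_iff)
    then obtain z :: int where "2 * pi * (x - x0) = of_int z * 2 * pi"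
      using cos_one_2pi_int by blast
    then have "2 * pi * (x - x0) = 2 * pi * of_int z" by (simp only: mult_ac)
    then have z: "x = x0 + of_int z" by simp
    moreover have "\<lfloor>a - x0\<rfloor> \<le> z" "z \<le> \<lceil>b - x0\<rceil>"
      using x z by (auto simp: floor_le_iff le_ceiling_iff)
    ultimately show "x \<in> (\<lambda>z. x0 + of_int z) ` {\<lfloor>a - x0\<rfloor>..\<lceil>b - x0\<rceil>}" by auto
  qed
  then show ?thesis by (rule finite_subset) simp
qed (simp only: finite.emptyI)

text \<open>After division by the lowest exponential the sum is a polynomial in
  \<open>expo x 1\<close>. It is not the zero polynomial, since its value at \<open>1\<close> is
  \<open>card D\<close>, and each of its roots is met finitely often in an interval.\<close>

lemma finite_mask_zeros:
  assumes "finite D" "D \<noteq> {}"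
  shows "finite {x \<in> {a..b}. digit_mask D x = 0}"
proof -
  define d0 where "d0 = Min D"
  define p :: "complex poly" where "p = (\<Sum>d\<in>D. monom 1 (nat (d - d0)))"
  have "poly p 1 = of_nat (card D)" by (simp add: p_def poly_sum poly_monom)
  then have "p \<noteq> 0" using assms by (metis card_0_eq of_nat_eq_0_iff poly_0)
  then have fin: "finite {w. poly p w = 0}" by (rule poly_roots_finite)
  have "poly p (expo x 1) = 0" if "digit_mask D x = 0" for x
  proof -
    have "expo x (of_int d) = expo x (of_int d0) * expo x 1 ^ nat (d - d0)" if "d \<in> D" for d
    proof -
      have "d0 \<le> d" using that assms by (simp add: d0_def)
      then have "real_of_int d = of_int d0 + real (nat (d - d0))" by simp
      moreover have "expo x (real n) = expo x 1 ^ n" for n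
        by (induction n) (simp_all add: expo_add)
      ultimately show ?thesis by (metis expo_add)
    qed
    then have "(\<Sum>d\<in>D. expo x (of_int d)) = expo x (of_int d0) * poly p (expo x 1)"
      by (simp add: p_def poly_sum poly_monom sum_distrib_left)
    moreover have "expo x (of_int d0) \<noteq> 0" using norm_expo[of x "of_int d0"] by fastforce
    ultimately show ?thesis using that assms by (simp add: digit_mask_def)
  qed
  then have "{x \<in> {a..b}. digit_mask D x = 0} \<subseteq> (\<Union>w\<in>{w. poly p w = 0}. {x \<in> {a..b}. expo x 1 = w})"
    by blast
  then show ?thesis by (rule finite_subset) (use fin finite_expo_eq in blast)
qed

text \<open>At the levels \<open>j \<le> m\<close> the shift moves the argument by an integer, which
  the mask ignores. This is what makes shifts of new elements by multiples of \<open>N ^ m\<close>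
  free.\<close>

lemma digit_mask_prod_periodic: "digit_mask_prod N D m (x + of_int z * real N ^ m) = digit_mask_prod N D m x" if "2 \<le> N"
  unfolding digit_mask_prod_def
proof (rule prod.cong)
  fix j assume j: "j \<in> {1..m}"
  have "real N ^ m = real N ^ j * real N ^ (m - j)" using j by (simp flip: power_add)
  then have "(x + of_int z * real N ^ m) / real N ^ j = x / real N ^ j + of_int (z * int N ^ (m - j))"
    using that by (simp add: field_simps)
  then show "digit_mask D ((x + of_int z * real N ^ m) / real N ^ j) = digit_mask D (x / real N ^ j)"
    by (metis digit_mask_periodic)
qed simp

lemma digit_mask_prod_add: "digit_mask_prod N D (k + m) x = digit_mask_prod N D k x * digit_mask_prod N D m (x / real N ^ k)"
  by (induction m) (simp_all add: digit_mask_prod_def mult_ac power_add)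

lemma digit_mask_prod_Suc: "digit_mask_prod N D (Suc m) x = digit_mask_prod N D m x * digit_mask D (x / real N ^ Suc m)"
  by (simp add: digit_mask_prod_def)

section \<open>Base \<open>N\<close> digit expansions\<close>

fun digit_sums :: "nat \<Rightarrow> int set \<Rightarrow> nat \<Rightarrow> int set" where
  "digit_sums N L 0 = {0}"
| "digit_sums N L (Suc m) = (\<lambda>(c, l). c + int N ^ m * l) ` (digit_sums N L m \<times> L)"

lemma digit_sums_subset:
  assumes "L \<subseteq> {0..<int N}"
  shows "digit_sums N L m \<subseteq> {0..<int N ^ m}"
proof (induction m)
  case (Suc m)
  show ?case
  proof
    fix x assume "x \<in> digit_sums N L (Suc m)"
    then obtain c l where x: "x = c + int N ^ m * l" "c \<in> digit_sums N L m" "l \<in> L" by auto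
    have c: "0 \<le> c" "c < int N ^ m" using x Suc by auto
    have l: "0 \<le> l" "l \<le> int N - 1" using x assms by auto
    have "int N ^ m * l \<le> int N ^ m * (int N - 1)" using l by (intro mult_left_mono) auto
    then have "x < int N ^ Suc m" using x c by (simp add: algebra_simps)
    moreover have "0 \<le> x" using x c l by simp
    ultimately show "x \<in> {0..<int N ^ Suc m}" by simp
  qed
qed simp

lemma inj_on_digit_sums:
  assumes "L \<subseteq> {0..<int N}"
  shows "inj_on (\<lambda>(c, l). c + int N ^ m * l) (digit_sums N L m \<times> UNIV)"
proof (rule inj_onI, clarify)
  fix c l c' l' assume c: "c \<in> digit_sums N L m" "c' \<in> digit_sums N L m"
    and eq: "c + int N ^ m * l = c' + int N ^ m * l'"
  have b: "0 \<le> c" "c < int N ^ m" "0 \<le> c'" "c' < int N ^ m"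
    using c digit_sums_subset[OF assms, of m] by auto
  have "(c + int N ^ m * l) mod int N ^ m = c" "(c' + int N ^ m * l') mod int N ^ m = c'"
    using b by auto
  then have "c = c'" using eq by simp
  moreover from this have "int N ^ m * l = int N ^ m * l'" using eq by simp
  moreover have "int N ^ m \<noteq> 0" using b by linarith
  ultimately show "c = c' \<and> l = l'" by (metis mult_left_cancel)
qed

lemma finite_digit_sums: "finite L \<Longrightarrow> finite (digit_sums N L m)"
  by (induction m) auto

lemma sum_digit_sums_Suc:
  assumes "L \<subseteq> {0..<int N}"
  shows "sum f (digit_sums N L (Suc m)) = (\<Sum>c\<in>digit_sums N L m. \<Sum>l\<in>L. f (c + int N ^ m * l))"
proof -
  have "inj_on (\<lambda>(c, l). c + int N ^ m * l) (digit_sums N L m \<times> L)"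
    using inj_on_digit_sums[OF assms] by (rule inj_on_subset) auto
  then show ?thesis by (simp add: sum.reindex sum.cartesian_product case_prod_unfold)
qed

lemma card_digit_sums:
  assumes "L \<subseteq> {0..<int N}"
  shows "card (digit_sums N L m) = card L ^ m"
proof (induction m)
  case (Suc m)
  have "inj_on (\<lambda>(c, l). c + int N ^ m * l) (digit_sums N L m \<times> L)"
    using inj_on_digit_sums[OF assms] by (rule inj_on_subset) auto
  then show ?case using Suc by (simp add: card_image card_cartesian_product)
qed simp

lemma zero_in_digit_sums: "0 \<in> L \<Longrightarrow> 0 \<in> digit_sums N L m"
  by (induction m) force+

lemma digit_sums_add:
  assumes "c \<in> digit_sums N L k" "d \<in> digit_sums N L m"
  shows "c + int N ^ k * d \<in> digit_sums N L (k + m)"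
  using assms(2)
proof (induction m arbitrary: d)
  case (Suc m)
  then obtain d' l where d: "d = d' + int N ^ m * l" "d' \<in> digit_sums N L m" "l \<in> L" by auto
  have "c + int N ^ k * d = (c + int N ^ k * d') + int N ^ (k + m) * l"
    by (simp add: d power_add algebra_simps)
  then show ?case using Suc.IH[OF d(2)] d(3) by force
qed (use assms in simp)

text \<open>Peeling off the top digit: the lower mask factors do not see it, and the last factor
  falls under the identity for one level. Each level lowers the index \<open>i\<close> by one at the
  price of a factor \<open>p\<close>, until index \<open>0\<close> is reached, which is fixed; hence
  \<open>p ^ i\<close> and the condition \<open>i \<le> m\<close>. Index \<open>0\<close> yields
  invariance of the weight, an index with \<open>u i = 1\<close> yields the bound on unweighted
  sums.\<close>

lemma digit_sum_transfer:
  fixes u :: "nat \<Rightarrow> real \<Rightarrow> real" and p :: real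
  assumes N: "2 \<le> N" and L: "L \<subseteq> {0..<int N}"
    and u: "\<And>i x. i \<le> r \<Longrightarrow> (\<Sum>l\<in>L. (cmod (digit_mask D ((x + of_int t * of_int l) / real N)))\<^sup>2 * u i ((x + of_int t * of_int l) / real N))
      = (if i = 0 then u 0 x else p * u (i - 1) x)"
  shows "i \<le> m \<Longrightarrow> i \<le> r \<Longrightarrow> (\<Sum>c\<in>digit_sums N L m. (cmod (digit_mask_prod N D m (x + of_int t * of_int c)))\<^sup>2
    * u i ((x + of_int t * of_int c) / real N ^ m)) = p ^ i * u 0 x"
proof (induction m arbitrary: i)
  case 0
  then show ?case by (simp add: digit_mask_prod_def)
next
  case (Suc m)
  have step: "(cmod (digit_mask_prod N D (Suc m) (x + of_int t * of_int (c + int N ^ m * l))))\<^sup>2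
       * u i ((x + of_int t * of_int (c + int N ^ m * l)) / real N ^ Suc m)
     = (cmod (digit_mask_prod N D m (x + of_int t * of_int c)))\<^sup>2 *
       ((cmod (digit_mask D (((x + of_int t * of_int c) / real N ^ m + of_int t * of_int l) / real N)))\<^sup>2
        * u i (((x + of_int t * of_int c) / real N ^ m + of_int t * of_int l) / real N))" for c l
  proof -
    have eq: "x + of_int t * of_int (c + int N ^ m * l) = (x + of_int t * of_int c) + of_int (t * l) * real N ^ m"
      by (simp add: algebra_simps)
    have eq2: "((x + of_int t * of_int c) + of_int (t * l) * real N ^ m) / real N ^ Suc m
        = ((x + of_int t * of_int c) / real N ^ m + of_int t * of_int l) / real N"
      using N by (simp add: field_simps)
    show ?thesis
      unfolding digit_mask_prod_Suc eq eq2 digit_mask_prod_periodic[OF N]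
      by (simp add: norm_mult power_mult_distrib)
  qed
  have "(\<Sum>c\<in>digit_sums N L m. (cmod (digit_mask_prod N D m (x + of_int t * of_int c)))\<^sup>2
      * (if i = 0 then u 0 ((x + of_int t * of_int c) / real N ^ m) else p * u (i - 1) ((x + of_int t * of_int c) / real N ^ m)))
      = p ^ i * u 0 x"
  proof (cases i)
    case 0
    then show ?thesis using Suc.IH[of 0] by simp
  next
    case (Suc i')
    then have "(\<Sum>c\<in>digit_sums N L m. (cmod (digit_mask_prod N D m (x + of_int t * of_int c)))\<^sup>2
      * u i' ((x + of_int t * of_int c) / real N ^ m)) = p ^ i' * u 0 x" using Suc.IH[of i'] Suc.prems by simp
    then show ?thesis using Suc by (simp add: sum_distrib_left[symmetric] mult.left_commute[of _ p])
  qed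
  then show ?case
    unfolding sum_digit_sums_Suc[OF L] step sum_distrib_left[symmetric] using u[OF Suc.prems(2)] by simp
qed

text \<open>At \<open>x = - f i\<close> two indices with the same value would each contribute
  \<open>F 0 = 1\<close>. Distinctness of frequencies can thus be read off from a Parseval identity,
  without digit arithmetic.\<close>

lemma inj_on_of_sum_eq_1:
  fixes F :: "real \<Rightarrow> real"
  assumes "finite I" "\<And>x. (\<Sum>i\<in>I. F (x + f i)) = 1" "\<And>x. 0 \<le> F x" "F 0 = 1"
  shows "inj_on f I"
proof (rule inj_onI, rule ccontr)
  fix i j assume ij: "i \<in> I" "j \<in> I" "f i = f j" "i \<noteq> j"
  have "(\<Sum>k\<in>{i, j}. F (- f i + f k)) \<le> (\<Sum>k\<in>I. F (- f i + f k))"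
    using ij assms by (intro sum_mono2) auto
  then show False using ij assms(2)[of "- f i"] assms(4) by simp
qed

text \<open>The weight \<open>g\<close> is invariant under the transfer operators attached to the sets
  \<open>t * L\<close>.  It is \<open>1\<close> when \<open>D\<close> is itself a Hadamard digit set; for a product form with \<open>r > 0\<close> it
  accounts for the digits whose contribution the first factors of the infinite product do not see.
  The frequencies below are \<open>u + (sum of N ^ i * l i)\<close> with \<open>u \<in> L0\<close> and \<open>l i \<in> L\<close>, up to
  carries into higher levels.\<close>

locale spectral_tower = borel_prob M for M :: "real measure" +
  fixes N :: nat and D L :: "int set" and g :: "real \<Rightarrow> real" and L0 :: "real set" and T :: "int set"
    and r :: nat and P R :: real
  assumes N2: "2 \<le> N" and finite_D: "finite D" and card_D: "2 \<le> card D" "card D < N"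
    and self_similar: "is_self_similar_measure N D M" and supp: "AE x in M. \<bar>x\<bar> \<le> R"
    and L: "L \<subseteq> {0..<int N}" "0 \<in> L" "card L = card D"
    and g_continuous: "continuous_on UNIV g" and g_periodic: "g (x + of_int z) = g x"
    and g_nonneg: "0 \<le> g x" and g_le_1: "g x \<le> 1" and g_0: "g 0 = 1"
    and g_zero: "g x = 0 \<Longrightarrow> FT M x = 0"
    and one_in_T: "1 \<in> T"
    and transfer: "t \<in> T \<Longrightarrow>
      (\<Sum>l\<in>L. (cmod (digit_mask D ((x + of_int t * of_int l) / real N)))\<^sup>2 * g ((x + of_int t * of_int l) / real N)) = g x"
    and transfer_full: "t \<in> T \<Longrightarrow>
      (\<Sum>l<N. (cmod (digit_mask D ((x + of_int \<bar>t\<bar> * real l) / real N)))\<^sup>2 * g ((x + of_int \<bar>t\<bar> * real l) / real N))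
        = real N / real (card D) * g x"
    and L0: "finite L0" "0 \<in> L0"
    and base: "t \<in> T \<Longrightarrow> (\<Sum>u\<in>L0. g (x + of_int t * u)) = 1"
    and P_nonneg: "0 \<le> P"
    and unweighted: "t \<in> T \<Longrightarrow> r \<le> m \<Longrightarrow>
      (\<Sum>c\<in>digit_sums N L m. (cmod (digit_mask_prod N D m (x + of_int t * of_int c)))\<^sup>2) \<le> P * g x"
begin

section \<open>Nonvanishing of the transform along multiples of a multiplier\<close>

lemma N_gt: "1 < real N" "0 < real N"
  using N2 by auto

lemma D_nonempty: "D \<noteq> {}"
  using card_D by auto

lemma finite_L: "finite L"
  using L(1) by (rule finite_subset) simp

lemma FT_prod: "FT M x = digit_mask_prod N D m x * FT M (x / real N ^ m)"
  by (rule FT_eq_mask_prod[OF self_similar finite_D D_nonempty])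

lemma FT_zero: "FT M 0 = 1"
  by (rule FT_0[OF prob_space_axioms])

lemma norm_FT: "cmod (FT M x) \<le> 1"
  by (rule norm_FT_le[OF prob_space_axioms sets_eq])

lemma isCont_FT: "isCont (FT M) x"
  by (rule FT_continuous[OF prob_space_axioms sets_eq])

lemma continuous_on_FT: "continuous_on S (FT M)"
  by (rule continuous_at_imp_continuous_on) (simp add: isCont_FT)

lemma inverse_power_tendsto: "(\<lambda>m. x / real N ^ m) \<longlonglongrightarrow> 0"
proof -
  have "(\<lambda>m. x * (1 / real N) ^ m) \<longlonglongrightarrow> x * 0"
    using N_gt by (intro tendsto_mult tendsto_const LIMSEQ_power_zero) auto
  then show ?thesis by (simp add: power_divide)
qed

lemma g_eq_of_diff_int: "x - y \<in> \<int> \<Longrightarrow> g x = g y"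
proof -
  assume "x - y \<in> \<int>"
  then obtain z where "x - y = of_int z" by (rule Ints_cases)
  then have "x = y + of_int z" by simp
  then show ?thesis by (simp add: g_periodic)
qed

text \<open>The transform does not vanish near \<open>0\<close>, and division by
  \<open>N ^ k\<close> brings the whole interval into that neighbourhood; the zeros then come from
  the first \<open>k\<close> masks.\<close>

lemma finite_FT_zeros: "finite {x \<in> {a..b}. FT M x = 0}"
proof -
  have "\<forall>\<^sub>F u in at 0. cmod (FT M u) > 0"
    using isCont_FT[of 0] FT_zero by (intro order_tendstoD(1)[of _ 1]) (auto simp: isCont_def intro: tendsto_eq_intros)
  then obtain \<delta> where \<delta>: "0 < \<delta>" "\<And>u. \<bar>u\<bar> < \<delta> \<Longrightarrow> FT M u \<noteq> 0"
    unfolding eventually_at using FT_zero by (auto simp: dist_real_def) (metis zero_neq_one)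
  have "\<forall>\<^sub>F k in sequentially. max \<bar>a\<bar> \<bar>b\<bar> / real N ^ k < \<delta>"
    by (rule order_tendstoD(2)[OF inverse_power_tendsto \<delta>(1)])
  then obtain k where k: "max \<bar>a\<bar> \<bar>b\<bar> / real N ^ k < \<delta>" by (auto simp: eventually_sequentially)
  have nz: "FT M (x / real N ^ k) \<noteq> 0" if "x \<in> {a..b}" for x
  proof (rule \<delta>(2))
    have "\<bar>x\<bar> \<le> max \<bar>a\<bar> \<bar>b\<bar>" using that by auto
    then have "\<bar>x\<bar> / real N ^ k \<le> max \<bar>a\<bar> \<bar>b\<bar> / real N ^ k" by (intro divide_right_mono) auto
    then show "\<bar>x / real N ^ k\<bar> < \<delta>" using k by simp
  qed
  have "{x \<in> {a..b}. FT M x = 0} \<subseteq> (\<Union>j\<in>{1..k}. (\<lambda>u. u * real N ^ j) ` {u \<in> {a / real N ^ j..b / real N ^ j}. digit_mask D u = 0})"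
  proof
    fix x assume x: "x \<in> {x \<in> {a..b}. FT M x = 0}"
    then have "digit_mask_prod N D k x = 0" using nz FT_prod[of x k] by auto
    then obtain j where j: "j \<in> {1..k}" "digit_mask D (x / real N ^ j) = 0"
      by (auto simp: digit_mask_prod_def)
    moreover have "x / real N ^ j \<in> {a / real N ^ j..b / real N ^ j}"
      using x by (auto intro!: divide_right_mono)
    moreover have "x = x / real N ^ j * real N ^ j" using N_gt by simp
    ultimately show "x \<in> (\<Union>j\<in>{1..k}. (\<lambda>u. u * real N ^ j) ` {u \<in> {a / real N ^ j..b / real N ^ j}. digit_mask D u = 0})"
      by (intro UN_I[OF j(1)] image_eqI[of x _ "x / real N ^ j"]) auto
  qed
  then show ?thesis
    by (rule finite_subset) (intro finite_UN_I finite_imageI finite_mask_zeros finite_D D_nonempty finite_atLeastAtMost)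
qed

text \<open>For \<open>t = 0\<close> all \<open>N\<close> summands of \<open>transfer_full\<close>
  at \<open>x = 0\<close> equal \<open>1\<close>, which exceeds the total
  \<open>N / card D\<close>.\<close>

lemma T_nonzero: "t \<in> T \<Longrightarrow> t \<noteq> 0"
proof
  assume t: "t \<in> T" "t = 0"
  have "real N = real N / real (card D)"
    using transfer_full[OF t(1), of 0] t(2) finite_D D_nonempty by (simp add: g_0)
  then show False using N_gt card_D by (simp add: field_simps)
qed

text \<open>Counting with the weights \<open>g\<close>: the zeros \<open>x\<close> of the periodised transform are finite in
  number modulo \<open>t\<close>, all \<open>N\<close> preimages of \<open>x\<close> with nonzero mask are again
  such zeros, and by \<open>transfer_full\<close> the total weight is multiplied by
  \<open>N / card D > 1\<close> on passing to preimages.\<close>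

lemma FT_translate_nonzero:
  assumes t: "t \<in> T" and gx: "g x \<noteq> 0"
  shows "\<exists>z::int. FT M (x + of_int t * of_int z) \<noteq> 0"
proof (rule ccontr)
  assume contra: "\<not> ?thesis"
  \<comment> \<open>The multiples of \<open>t\<close> and of its absolute value form the same set; a
    positive period gives the fundamental domain used for \<open>X\<close>.\<close>
  define \<tau> where "\<tau> = real_of_int \<bar>t\<bar>"
  have \<tau>: "0 < \<tau>" using T_nonzero[OF t] by (simp add: \<tau>_def)
  define Z where "Z = {y. \<forall>z::int. FT M (y + \<tau> * of_int z) = 0}"
  have xZ: "x \<in> Z"
  proof -
    have "FT M (x + \<tau> * of_int z) = 0" for z
    proof -
      have eq: "\<tau> * of_int z = of_int t * of_int (sgn t * z)"
        by (simp add: \<tau>_def abs_sgn flip: of_int_mult)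
      show ?thesis unfolding eq using contra by blast
    qed
    then show ?thesis by (simp add: Z_def)
  qed
  have shift: "y + \<tau> * of_int k \<in> Z" if y: "y \<in> Z" for y k
  proof -
    have "FT M (y + \<tau> * of_int k + \<tau> * of_int z) = 0" for z
    proof -
      have "FT M (y + \<tau> * of_int (k + z)) = 0" using y unfolding Z_def by blast
      then show ?thesis by (simp add: algebra_simps)
    qed
    then show ?thesis by (simp add: Z_def)
  qed
  define X where "X = Z \<inter> {0..<\<tau>}"
  have finX: "finite X"
  proof (rule finite_subset)
    show "X \<subseteq> {u \<in> {0..\<tau>}. FT M u = 0}"
    proof
      fix u assume u: "u \<in> X"
      then have "FT M (u + \<tau> * of_int 0) = 0" unfolding X_def Z_def by blast
      then show "u \<in> {u \<in> {0..\<tau>}. FT M u = 0}" using u by (simp add: X_def)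
    qed
  qed (rule finite_FT_zeros)
  \<comment> \<open>The \<open>N\<close> preimages of \<open>y\<close> under multiplication by
    \<open>N\<close> modulo \<open>\<tau>\<close>.\<close>
  define \<psi> where "\<psi> = (\<lambda>(y, l::nat). (y + \<tau> * real l) / real N)"
  define F where "F = (\<lambda>y. (cmod (digit_mask D y))\<^sup>2 * g y)"
  have inj: "inj_on \<psi> (X \<times> {..<N})"
  proof (rule inj_onI, clarify)
    fix y l y' l' assume y: "y \<in> X" "y' \<in> X" and eq: "\<psi> (y, l) = \<psi> (y', l')"
    have e: "y - y' = \<tau> * (real l' - real l)" using eq N_gt by (simp add: \<psi>_def field_simps)
    have "\<bar>y - y'\<bar> < \<tau>" using y by (auto simp: X_def abs_less_iff)
    then have "\<bar>real l' - real l\<bar> < 1" using \<tau> unfolding e by (simp add: abs_mult)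
    then have "l = l'" by linarith
    then show "y = y' \<and> l = l'" using e by simp
  qed
  \<comment> \<open>The functional equation relates the zero at
    \<open>y + \<tau> * (l + N * z)\<close> to the preimage shifted by \<open>\<tau> * z\<close>.
    The mask has the same nonzero value for all \<open>z\<close>, so the transform must vanish
    there.\<close>
  have img: "\<psi> p \<in> X" if p: "p \<in> X \<times> {..<N}" and nz: "F (\<psi> p) \<noteq> 0" for p
  proof -
    obtain y l where yl: "p = (y, l)" "y \<in> X" "l < N" using p by auto
    let ?u = "(y + \<tau> * real l) / real N"
    have m: "digit_mask D ?u \<noteq> 0" using nz by (simp add: F_def \<psi>_def yl)
    have "FT M (?u + \<tau> * of_int z) = 0" for z
    proof -
      have "y + \<tau> * of_int (int l + int N * z) = (?u + \<tau> * of_int z) * real N"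
        using N_gt by (simp add: field_simps)
      moreover have "FT M (y + \<tau> * of_int (int l + int N * z)) = 0"
        using yl(2) unfolding X_def Z_def by blast
      ultimately have "FT M ((?u + \<tau> * of_int z) * real N) = 0" by simp
      moreover have "FT M ((?u + \<tau> * of_int z) * real N) = digit_mask D (?u + \<tau> * of_int z) * FT M (?u + \<tau> * of_int z)"
        using FT_functional_equation[OF self_similar finite_D D_nonempty, of "(?u + \<tau> * of_int z) * real N"] N_gt
        by simp
      moreover have "digit_mask D (?u + \<tau> * of_int z) = digit_mask D ?u"
        using digit_mask_periodic[of D ?u "\<bar>t\<bar> * z"] by (simp add: \<tau>_def)
      ultimately show ?thesis using m by simp
    qed
    then have "?u \<in> Z" by (simp add: Z_def)
    moreover have "?u \<in> {0..<\<tau>}"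
    proof -
      have y: "0 \<le> y" "y < \<tau>" using yl(2) by (auto simp: X_def)
      have "\<tau> * real l \<le> \<tau> * (real N - 1)" using yl(3) \<tau> by (intro mult_left_mono) auto
      then have "y + \<tau> * real l < \<tau> * real N" using y by (simp add: algebra_simps)
      then show ?thesis using y \<tau> N_gt by (simp add: divide_simps)
    qed
    ultimately show ?thesis by (simp add: X_def \<psi>_def yl)
  qed
  have "real N / real (card D) * (\<Sum>y\<in>X. g y) = (\<Sum>y\<in>X. \<Sum>l<N. F (\<psi> (y, l)))"
    using transfer_full[OF t] by (simp add: F_def \<psi>_def \<tau>_def sum_distrib_left)
  also have "\<dots> = (\<Sum>p\<in>X \<times> {..<N}. F (\<psi> p))"
    by (simp add: sum.cartesian_product case_prod_unfold)
  also have "\<dots> = (\<Sum>p\<in>{p \<in> X \<times> {..<N}. F (\<psi> p) \<noteq> 0}. F (\<psi> p))"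
    using finX by (intro sum.mono_neutral_right) auto
  also have "\<dots> = sum F (\<psi> ` {p \<in> X \<times> {..<N}. F (\<psi> p) \<noteq> 0})"
    by (rule sum.reindex_cong[symmetric, of \<psi>]) (auto intro: inj_on_subset[OF inj])
  also have "\<dots> \<le> sum F X"
    by (rule sum_mono2[OF finX]) (use img g_nonneg in \<open>auto simp: F_def\<close>)
  also have "\<dots> \<le> (\<Sum>y\<in>X. g y)"
  proof (rule sum_mono)
    fix y
    have "(cmod (digit_mask D y))\<^sup>2 \<le> 1" using norm_mask_le[of D y] by (simp add: power_le_one)
    then show "F y \<le> g y" using g_nonneg[of y] by (simp add: F_def mult_left_le_one_le)
  qed
  finally have le: "real N / real (card D) * (\<Sum>y\<in>X. g y) \<le> (\<Sum>y\<in>X. g y)" .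
  have "1 < real N / real (card D)" using card_D by simp
  then have "\<not> 0 < (\<Sum>y\<in>X. g y)"
    using le mult_strict_right_mono[of 1 "real N / real (card D)" "\<Sum>y\<in>X. g y"] by linarith
  moreover have "0 \<le> (\<Sum>y\<in>X. g y)" by (simp add: sum_nonneg g_nonneg)
  ultimately have "(\<Sum>y\<in>X. g y) = 0" by linarith
  then have g0: "g y = 0" if "y \<in> X" for y
    using that finX by (simp add: sum_nonneg_eq_0_iff g_nonneg)
  \<comment> \<open>Moving \<open>x\<close> into the fundamental domain is an integer translation,
    so \<open>g x\<close> would be one of the weights just shown to vanish.\<close>
  define k where "k = \<lfloor>x / \<tau>\<rfloor>"
  have "x + \<tau> * of_int (- k) \<in> X"
  proof -
    have "of_int k \<le> x / \<tau>" "x / \<tau> < of_int k + 1" by (auto simp: k_def)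
    then have "\<tau> * of_int k \<le> x" "x < \<tau> * of_int k + \<tau>" using \<tau> by (simp_all add: field_simps)
    then show ?thesis using shift[OF xZ, of "- k"] by (simp add: X_def)
  qed
  from g0[OF this] have "g (x + of_int (- (\<bar>t\<bar> * k))) = 0" by (simp add: \<tau>_def)
  then show False using gx by (simp only: g_periodic)
qed

text \<open>In \<open>transfer_full\<close> at \<open>0\<close> the term \<open>l = 0\<close> is
  only \<open>1\<close>, less than the total \<open>N / card D\<close>, so some other digit has
  nonzero mask and weight; a translate of it makes the transform nonzero as well. Such a
  \<open>w\<close> supplies arbitrarily distant translates in \<open>ex_good\<close>.\<close>

lemma FT_int_multiple_nonzero:
  assumes t: "t \<in> T"
  shows "\<exists>w::int. w \<noteq> 0 \<and> FT M (of_int t * of_int w) \<noteq> 0"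
proof -
  let ?F = "\<lambda>l::nat. (cmod (digit_mask D (of_int \<bar>t\<bar> * real l / real N)))\<^sup>2 * g (of_int \<bar>t\<bar> * real l / real N)"
  have "(\<Sum>l<N. ?F l) = real N / real (card D)"
    using transfer_full[OF t, of 0] by (simp add: g_0)
  moreover have "(\<Sum>l<N. ?F l) = ?F 0 + (\<Sum>l\<in>{..<N} - {0}. ?F l)"
    using N2 by (intro sum.remove) auto
  moreover have "?F 0 = 1" using finite_D D_nonempty by (simp add: g_0)
  moreover have "1 < real N / real (card D)" using card_D by simp
  ultimately have "(\<Sum>l\<in>{..<N} - {0}. ?F l) \<noteq> 0" by linarith
  then obtain l where l: "l < N" "l \<noteq> 0" "?F l \<noteq> 0" by (metis (lifting) sum.neutral DiffE insertCI lessThan_iff)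
  define l' where "l' = sgn t * int l"
  have tl: "of_int t * real_of_int l' = of_int \<bar>t\<bar> * real l"
    unfolding l'_def by (simp add: abs_sgn)
  have m: "digit_mask D (of_int t * of_int l' / real N) \<noteq> 0" and gl: "g (of_int t * of_int l' / real N) \<noteq> 0"
    using l(3) unfolding tl by auto
  obtain z :: int where z: "FT M (of_int t * of_int l' / real N + of_int t * of_int z) \<noteq> 0"
    using FT_translate_nonzero[OF t gl] by blast
  have w: "(of_int t * of_int l' / real N + of_int t * of_int z) * real N = of_int t * of_int (l' + int N * z)"
    using N_gt by (simp add: field_simps)
  have "FT M (of_int t * of_int (l' + int N * z))
      = digit_mask D (of_int t * of_int l' / real N + of_int t * of_int z) * FT M (of_int t * of_int l' / real N + of_int t * of_int z)"
    using FT_functional_equation[OF self_similar finite_D D_nonempty, of "of_int t * of_int (l' + int N * z)"] N_gt w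
    by (metis less_numeral_extra(3) nonzero_mult_div_cancel_right)
  also have "digit_mask D (of_int t * of_int l' / real N + of_int t * of_int z) = digit_mask D (of_int t * of_int l' / real N)"
    using digit_mask_periodic[of D _ "t * z"] by simp
  finally have "FT M (of_int t * of_int (l' + int N * z)) \<noteq> 0" using m z by simp
  moreover have "l' + int N * z \<noteq> 0"
  proof
    assume "l' + int N * z = 0"
    then have "int N dvd l'" by (metis dvd_triv_left dvd_minus_iff eq_neg_iff_add_eq_0)
    then have "int N dvd int l" using T_nonzero[OF t] by (auto simp: l'_def sgn_if split: if_splits)
    then show False using l by (auto dest: zdvd_imp_le)
  qed
  ultimately show ?thesis by blast
qed

end

section \<open>Finite stages of the construction\<close>

context spectral_tower
begin

section \<open>Uniform lower bounds for the transform\<close>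

lemma eventually_le_power: "\<forall>\<^sub>F m in sequentially. b \<le> real N ^ m"
proof -
  have "\<forall>\<^sub>F m in sequentially. b / real N ^ m < 1"
    by (rule order_tendstoD(2)[OF inverse_power_tendsto]) simp
  then show ?thesis
  proof eventually_elim
    case (elim m)
    then show ?case using N_gt by (simp add: divide_less_eq)
  qed
qed

text \<open>The first clause bounds the shift by \<open>Z\<close>, as needed for clusters; the
  second puts the point beyond any \<open>b\<close>, as needed for lacunary elements.\<close>

definition good :: "int \<Rightarrow> real \<Rightarrow> real \<Rightarrow> nat \<Rightarrow> bool" where
  "good t \<epsilon> c Z \<longleftrightarrow> 0 < c \<and>
     (\<forall>y\<in>{0..1}. \<epsilon> \<le> g (of_int t * y) \<longrightarrow>
        (\<exists>z::int. \<bar>z\<bar> \<le> int Z \<and> c \<le> cmod (FT M (of_int t * (y + of_int z))))) \<and>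
     (\<forall>y b. \<epsilon> \<le> g (of_int t * y) \<longrightarrow>
        (\<exists>z::int. b \<le> \<bar>y + of_int z\<bar> \<and> c \<le> cmod (FT M (of_int t * (y + of_int z)))))"

text \<open>Near shifts: the open sets \<open>U n\<close> increase and cover the compact set
  \<open>K\<close>, so one of them contains it. Far shifts: adding \<open>N ^ m * w\<close> to a
  near shift keeps the first \<open>m\<close> mask factors and leaves as remaining factor a value of
  the transform close to the one at \<open>t * w\<close>.\<close>

lemma ex_good:
  assumes t: "t \<in> T" and e: "0 < \<epsilon>"
  shows "\<exists>c Z. good t \<epsilon> c Z"
proof -
  define K where "K = {0..1} \<inter> {y. \<epsilon> \<le> g (of_int t * y)}"
  have contg: "continuous_on UNIV (\<lambda>y. g (of_int t * y))"
    by (rule continuous_on_compose2[OF g_continuous]) (auto intro!: continuous_intros)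
  have "closed {y. \<epsilon> \<le> g (of_int t * y)}"
    by (rule closed_Collect_le) (auto intro: contg)
  then have K: "compact K" unfolding K_def by (intro compact_Int_closed) auto
  define U where "U = (\<lambda>n::nat. \<Union>z\<in>{- int n..int n}. {y. 1 / real (Suc n) < cmod (FT M (of_int t * (y + of_int z)))})"
  have openU: "open (U n)" for n
    unfolding U_def
    by (intro open_UN ballI open_Collect_less continuous_intros
        continuous_on_compose2[OF continuous_on_FT[of UNIV]]) auto
  have Umono: "U n \<subseteq> U m" if "n \<le> m" for n m
  proof
    fix y assume "y \<in> U n"
    then obtain z where z: "z \<in> {- int n..int n}" "1 / real (Suc n) < cmod (FT M (of_int t * (y + of_int z)))"
      by (auto simp: U_def)
    have "1 / real (Suc m) \<le> 1 / real (Suc n)" using that by (simp add: field_simps)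
    then have "1 / real (Suc m) < cmod (FT M (of_int t * (y + of_int z)))" using z(2) by linarith
    then show "y \<in> U m" using z(1) that unfolding U_def by (intro UN_I[of z]) auto
  qed
  have cover: "K \<subseteq> \<Union> (U ` UNIV)"
  proof
    fix y assume "y \<in> K"
    then have "g (of_int t * y) \<noteq> 0" using e by (auto simp: K_def)
    then obtain z :: int where z: "FT M (of_int t * y + of_int t * of_int z) \<noteq> 0"
      using FT_translate_nonzero[OF t] by blast
    then have "0 < cmod (FT M (of_int t * (y + of_int z)))" by (simp add: ring_distribs)
    then obtain n where n: "1 / real (Suc n) < cmod (FT M (of_int t * (y + of_int z)))"
      using nat_approx_posE by blast
    define m where "m = max n (nat \<bar>z\<bar>)"
    have "1 / real (Suc m) \<le> 1 / real (Suc n)" by (simp add: m_def field_simps)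
    then have "y \<in> U m" using n unfolding U_def m_def by (intro UN_I[of z]) auto
    then show "y \<in> \<Union> (U ` UNIV)" by blast
  qed
  obtain C' where C': "finite C'" "K \<subseteq> \<Union> (U ` C')"
    by (rule compactE_image[OF K _ cover]) (use openU in simp)
  define n where "n = Max (insert 0 C')"
  have KU: "K \<subseteq> U n"
  proof
    fix y assume "y \<in> K"
    then obtain j where j: "j \<in> C'" "y \<in> U j" using C'(2) by blast
    then have "j \<le> n" using C'(1) by (simp add: n_def)
    then show "y \<in> U n" using Umono j by blast
  qed
  obtain w :: int where w: "w \<noteq> 0" "FT M (of_int t * of_int w) \<noteq> 0"
    using FT_int_multiple_nonzero[OF t] by blast
  \<comment> \<open>Half of the limit, so that it is exceeded for all large
    \<open>m\<close>.\<close>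
  define a where "a = cmod (FT M (of_int t * of_int w)) / 2"
  have a: "0 < a" "a \<le> 1" using w norm_FT[of "of_int t * of_int w"] by (simp_all add: a_def)
  define c where "c = 1 / real (Suc n)"
  have c: "0 < c" by (simp add: c_def)
  have near: "\<exists>z::int. \<bar>z\<bar> \<le> int n \<and> c < cmod (FT M (of_int t * (y + of_int z)))"
    if "y \<in> {0..1}" "\<epsilon> \<le> g (of_int t * y)" for y
  proof -
    have "y \<in> U n" using that KU by (auto simp: K_def)
    then obtain z where "z \<in> {- int n..int n}" "1 / real (Suc n) < cmod (FT M (of_int t * (y + of_int z)))"
      by (auto simp: U_def)
    then show ?thesis unfolding c_def by (intro exI[of _ z]) auto
  qed
  have far: "\<exists>z::int. b \<le> \<bar>y + of_int z\<bar> \<and> a * c \<le> cmod (FT M (of_int t * (y + of_int z)))"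
    if gy: "\<epsilon> \<le> g (of_int t * y)" for y b
  proof -
    have "g (of_int t * (y - of_int \<lfloor>y\<rfloor>)) = g (of_int t * y)"
      by (rule g_eq_of_diff_int) (simp add: algebra_simps)
    moreover have "y - of_int \<lfloor>y\<rfloor> \<in> {0..1}" by (simp, linarith)
    ultimately obtain z1 :: int where z1: "c < cmod (FT M (of_int t * (y - of_int \<lfloor>y\<rfloor> + of_int z1)))"
      using near gy by metis
    define z0 where "z0 = z1 - \<lfloor>y\<rfloor>"
    have "y - of_int \<lfloor>y\<rfloor> + of_int z1 = y + of_int z0" by (simp add: z0_def)
    with z1 have z0: "c < cmod (FT M (of_int t * (y + of_int z0)))" by (simp only:)
    define x where "x = of_int t * (y + of_int z0)"
    have "(\<lambda>m. x / real N ^ m + of_int t * of_int w) \<longlonglongrightarrow> 0 + of_int t * of_int w"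
      by (intro tendsto_intros inverse_power_tendsto)
    then have "(\<lambda>m. cmod (FT M (x / real N ^ m + of_int t * of_int w))) \<longlonglongrightarrow> cmod (FT M (of_int t * of_int w))"
      by (intro tendsto_norm isCont_tendsto_compose[OF isCont_FT]) simp
    then have ev1: "\<forall>\<^sub>F m in sequentially. a < cmod (FT M (x / real N ^ m + of_int t * of_int w))"
      by (rule order_tendstoD(1)) (use a in \<open>simp add: a_def\<close>)
    have ev2: "\<forall>\<^sub>F m in sequentially. \<bar>y + of_int z0\<bar> + \<bar>b\<bar> \<le> real N ^ m"
      by (rule eventually_le_power)
    obtain m where m: "a < cmod (FT M (x / real N ^ m + of_int t * of_int w))"
      "\<bar>y + of_int z0\<bar> + \<bar>b\<bar> \<le> real N ^ m"
      using eventually_happens'[OF _ eventually_conj[OF ev1 ev2]] by auto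
    define z where "z = z0 + int N ^ m * w"
    have tz: "of_int t * (y + of_int z) = x + of_int (t * w) * real N ^ m"
      by (simp add: z_def x_def algebra_simps)
    have "cmod (FT M (of_int t * (y + of_int z)))
        = cmod (digit_mask_prod N D m x) * cmod (FT M (x / real N ^ m + of_int t * of_int w))"
    proof -
      have "(x + of_int (t * w) * real N ^ m) / real N ^ m = x / real N ^ m + of_int t * of_int w"
        using N_gt by (simp add: field_simps)
      then show ?thesis
        unfolding tz by (subst FT_prod[of _ m]) (simp add: norm_mult digit_mask_prod_periodic[OF N2] del: of_int_mult)
    qed
    \<comment> \<open>The transform at \<open>x\<close> is this product times a factor of modulus at
      most \<open>1\<close>, so the lower bound passes to the product.\<close>
    moreover have "c \<le> cmod (digit_mask_prod N D m x)"
    proof -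
      have "cmod (FT M x) \<le> cmod (digit_mask_prod N D m x) * 1"
        unfolding FT_prod[of x m] norm_mult by (intro mult_left_mono norm_FT) simp
      then show ?thesis using z0 by (simp add: x_def)
    qed
    ultimately have "a * c \<le> cmod (FT M (of_int t * (y + of_int z)))"
      using a c m(1) mult_mono[of c "cmod (digit_mask_prod N D m x)" a "cmod (FT M (x / real N ^ m + of_int t * of_int w))"]
      by (simp add: mult.commute)
    moreover have "b \<le> \<bar>y + of_int z\<bar>"
    proof -
      have "1 \<le> \<bar>real_of_int w\<bar>" using w(1) by linarith
      then have "real N ^ m * 1 \<le> real N ^ m * \<bar>real_of_int w\<bar>" by (intro mult_left_mono) auto
      then have "real N ^ m \<le> \<bar>real N ^ m * real_of_int w\<bar>" by (simp add: abs_mult)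
      moreover have "y + of_int z = (y + of_int z0) + real N ^ m * real_of_int w" by (simp add: z_def)
      ultimately show ?thesis using m(2) by linarith
    qed
    ultimately show ?thesis by blast
  qed
  have "a * c \<le> c" using a c by simp
  then have "good t \<epsilon> (a * c) n"
    unfolding good_def using near far a c by (meson less_imp_le mult_pos_pos order_trans)
  then show ?thesis by blast
qed

section \<open>Finite Parseval identities\<close>

definition weight :: "nat \<Rightarrow> real \<Rightarrow> real" where
  "weight k x = (cmod (digit_mask_prod N D k x))\<^sup>2 * g (x / real N ^ k)"

lemma weight_nonneg: "0 \<le> weight k x"
  by (simp add: weight_def g_nonneg)

lemma digit_mask_prod_zero: "digit_mask_prod N D k 0 = 1"
  using finite_D D_nonempty by (simp add: digit_mask_prod_def)

lemma weight_zero: "weight k 0 = 1"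
  by (simp add: weight_def digit_mask_prod_zero g_0)

text \<open>The identity is required for every \<open>t\<close> at once, so that one finite set
  serves all dilates, and with \<open>x\<close> free, so that suitable choices of \<open>x\<close>
  give orthogonality and distinctness.\<close>

definition parseval :: "real set \<Rightarrow> nat \<Rightarrow> bool" where
  "parseval \<Lambda> k \<longleftrightarrow> (\<forall>t\<in>T. \<forall>x. (\<Sum>u\<in>\<Lambda>. weight k (x + of_int t * u)) = 1)"

lemma transfer_power:
  assumes t: "t \<in> T"
  shows "(\<Sum>c\<in>digit_sums N L m. weight m (x + of_int t * of_int c)) = g x"
  using digit_sum_transfer[OF N2 L(1), where r=0 and i=0 and u="\<lambda>i. g" and p=1 and t=t and m=m and x=x] transfer[OF t]
  unfolding weight_def by simp

text \<open>The shift by \<open>N ^ (k + m) * z\<close> is invisible to the first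
  \<open>k + m\<close> masks and to \<open>g\<close>, for every integer \<open>t\<close>, so the sum
  factors into the old one and a digit sum over \<open>m\<close> levels. Hence \<open>z\<close> may
  be chosen freely for each pair. Injectivity is read off from the new identity at
  \<open>t = 1\<close>.\<close>

lemma extend:
  assumes fin: "finite \<Lambda>" and par: "parseval \<Lambda> k"
    and pos: "\<And>u c. u \<in> \<Lambda> \<Longrightarrow> c \<in> digit_sums N L m \<Longrightarrow>
      \<exists>z::int. pos (u, c) = u + real N ^ k * of_int c + real N ^ (k + m) * of_int z"
  shows "inj_on pos (\<Lambda> \<times> digit_sums N L m)" (is ?inj)
    and "parseval (pos ` (\<Lambda> \<times> digit_sums N L m)) (k + m)" (is ?par)
    and "r \<le> m \<Longrightarrow> t \<in> T \<Longrightarrow>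
      (\<Sum>u\<in>pos ` (\<Lambda> \<times> digit_sums N L m). (cmod (digit_mask_prod N D (k + m) (x + of_int t * u)))\<^sup>2) \<le> P" (is "_ \<Longrightarrow> _ \<Longrightarrow> ?bound")
proof -
  let ?C = "digit_sums N L m"
  have finC: "finite ?C" by (rule finite_digit_sums[OF finite_L])
  have H: "digit_mask_prod N D (k + m) (x + of_int t * pos (u, c))
      = digit_mask_prod N D k (x + of_int t * u) * digit_mask_prod N D m ((x + of_int t * u) / real N ^ k + of_int t * of_int c)"
    and G: "g ((x + of_int t * pos (u, c)) / real N ^ (k + m))
      = g (((x + of_int t * u) / real N ^ k + of_int t * of_int c) / real N ^ m)"
    if uc: "u \<in> \<Lambda>" "c \<in> ?C" for u c t x
  proof -
    obtain z :: int where z: "pos (u, c) = u + real N ^ k * of_int c + real N ^ (k + m) * of_int z"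
      using pos[OF uc] by blast
    have eq: "x + of_int t * pos (u, c) = (x + of_int t * u + of_int (t * c) * real N ^ k) + of_int (t * z) * real N ^ (k + m)"
      unfolding z by (simp add: algebra_simps)
    have eq2: "(x + of_int t * u + of_int (t * c) * real N ^ k) / real N ^ k = (x + of_int t * u) / real N ^ k + of_int t * of_int c"
      using N_gt by (simp add: field_simps)
    show "digit_mask_prod N D (k + m) (x + of_int t * pos (u, c))
      = digit_mask_prod N D k (x + of_int t * u) * digit_mask_prod N D m ((x + of_int t * u) / real N ^ k + of_int t * of_int c)"
      unfolding eq digit_mask_prod_periodic[OF N2]
      unfolding digit_mask_prod_add digit_mask_prod_periodic[OF N2] eq2 ..
    have "(x + of_int t * pos (u, c)) / real N ^ (k + m)
      = ((x + of_int t * u) / real N ^ k + of_int t * of_int c) / real N ^ m + of_int (t * z)"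
      unfolding eq using N_gt by (simp add: field_simps power_add)
    then show "g ((x + of_int t * pos (u, c)) / real N ^ (k + m))
      = g (((x + of_int t * u) / real N ^ k + of_int t * of_int c) / real N ^ m)"
      by (metis g_periodic)
  qed
  have sum1: "(\<Sum>p\<in>\<Lambda> \<times> ?C. weight (k + m) (x + of_int t * pos p)) = 1" if t: "t \<in> T" for t x
  proof -
    have "(\<Sum>p\<in>\<Lambda> \<times> ?C. weight (k + m) (x + of_int t * pos p))
        = (\<Sum>u\<in>\<Lambda>. \<Sum>c\<in>?C. weight (k + m) (x + of_int t * pos (u, c)))"
      by (simp add: sum.cartesian_product case_prod_unfold)
    also have "\<dots> = (\<Sum>u\<in>\<Lambda>. \<Sum>c\<in>?C. (cmod (digit_mask_prod N D k (x + of_int t * u)))\<^sup>2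
          * weight m ((x + of_int t * u) / real N ^ k + of_int t * of_int c))"
      by (intro sum.cong refl) (simp add: weight_def H G norm_mult power_mult_distrib)
    also have "\<dots> = (\<Sum>u\<in>\<Lambda>. weight k (x + of_int t * u))"
      unfolding sum_distrib_left[symmetric] transfer_power[OF t] by (simp add: weight_def)
    also have "\<dots> = 1" using par t by (simp add: parseval_def)
    finally show ?thesis .
  qed
  show inj: ?inj
    by (rule inj_on_of_sum_eq_1[where F="weight (k + m)"])
      (use sum1[OF one_in_T] fin finC weight_nonneg weight_zero in auto)
  show ?par unfolding parseval_def
    using sum1 by (simp add: sum.reindex[OF inj] del: mem_Times_iff)
  show ?bound if r: "r \<le> m" and t: "t \<in> T"
  proof -
    have "(\<Sum>u\<in>pos ` (\<Lambda> \<times> ?C). (cmod (digit_mask_prod N D (k + m) (x + of_int t * u)))\<^sup>2)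
        = (\<Sum>u\<in>\<Lambda>. \<Sum>c\<in>?C. (cmod (digit_mask_prod N D (k + m) (x + of_int t * pos (u, c))))\<^sup>2)"
      by (simp add: sum.reindex[OF inj] sum.cartesian_product case_prod_unfold)
    also have "\<dots> = (\<Sum>u\<in>\<Lambda>. (cmod (digit_mask_prod N D k (x + of_int t * u)))\<^sup>2
        * (\<Sum>c\<in>?C. (cmod (digit_mask_prod N D m ((x + of_int t * u) / real N ^ k + of_int t * of_int c)))\<^sup>2))"
      unfolding sum_distrib_left by (intro sum.cong refl) (simp add: H norm_mult power_mult_distrib)
    also have "\<dots> \<le> (\<Sum>u\<in>\<Lambda>. (cmod (digit_mask_prod N D k (x + of_int t * u)))\<^sup>2 * (P * g ((x + of_int t * u) / real N ^ k)))"
      by (intro sum_mono mult_left_mono unweighted[OF t r]) simp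
    also have "\<dots> = P * (\<Sum>u\<in>\<Lambda>. weight k (x + of_int t * u))"
      by (simp add: weight_def sum_distrib_left mult_ac)
    also have "\<dots> = P" using par t by (simp add: parseval_def)
    finally show ?thesis .
  qed
qed

lemma parseval_base: "parseval L0 0"
  unfolding parseval_def weight_def digit_mask_prod_def using base by simp

text \<open>At \<open>x = - t * v\<close> the term of \<open>v\<close> is already \<open>1\<close>,
  so the term of \<open>u\<close> is \<open>0\<close>. Then a mask factor or \<open>g\<close>
  vanishes, and in both cases the transform does.\<close>

lemma parseval_orthogonal:
  assumes "finite \<Lambda>" "parseval \<Lambda> k" "t \<in> T" "u \<in> \<Lambda>" "v \<in> \<Lambda>" "u \<noteq> v"
  shows "FT M (of_int t * u - of_int t * v) = 0"
proof -
  let ?x = "of_int t * u - of_int t * v"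
  have "(\<Sum>w\<in>{u, v}. weight k (- of_int t * v + of_int t * w)) \<le> (\<Sum>w\<in>\<Lambda>. weight k (- of_int t * v + of_int t * w))"
    using assms by (intro sum_mono2) (auto simp: weight_nonneg)
  also have "\<dots> = 1" using assms(2,3) unfolding parseval_def by (metis mult_minus_left)
  finally have "weight k ?x \<le> 0" using assms(6) by (simp add: weight_zero)
  then have "weight k ?x = 0" using weight_nonneg[of k ?x] by linarith
  then have "digit_mask_prod N D k ?x = 0 \<or> g (?x / real N ^ k) = 0" by (simp add: weight_def)
  then show ?thesis using FT_prod[of ?x k] g_zero[of "?x / real N ^ k"] by auto
qed

end

section \<open>Clusters and lacunary extensions\<close>

abbreviation window :: "real \<Rightarrow> real \<Rightarrow> real set" where
  "window x h \<equiv> {x - h / 2 <..< x + h / 2}"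

lemma digit_sums_split:
  assumes "L \<subseteq> {0..<int N}" "c \<in> digit_sums N L (i + j)"
  shows "\<exists>c0\<in>digit_sums N L i. \<exists>d. c = c0 + int N ^ i * d"
  using assms(2)
proof (induction j arbitrary: c)
  case 0
  then show ?case by (intro bexI[of _ c] exI[of _ 0]) auto
next
  case (Suc j)
  then obtain c' l where c: "c = c' + int N ^ (i + j) * l" "c' \<in> digit_sums N L (i + j)" by auto
  from Suc.IH[OF c(2)] obtain c0 d where "c0 \<in> digit_sums N L i" "c' = c0 + int N ^ i * d" by blast
  then show ?case
    by (intro bexI[of _ c0] exI[of _ "d + int N ^ j * l"]) (auto simp: c(1) power_add algebra_simps)
qed

text \<open>An open interval of length \<open>N ^ i\<close> meets at most two blocks that start at
  multiples of \<open>N ^ i\<close>, and within a block the lowest \<open>i\<close> digits determine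
  the point.\<close>

lemma card_digit_sums_interval:
  assumes L: "L \<subseteq> {0..<int N}" and N: "0 < N" and im: "i \<le> m"
  shows "card {c \<in> digit_sums N L m. \<alpha> < real_of_int c \<and> real_of_int c < \<alpha> + real N ^ i} \<le> 2 * card L ^ i"
    (is "card ?S \<le> _")
proof -
  define a where "a = \<alpha> / real N ^ i"
  have "finite L" using L by (rule finite_subset) simp
  then have fin: "finite (digit_sums N L i)" by (rule finite_digit_sums)
  have sub: "?S \<subseteq> (\<lambda>(c0, d). c0 + int N ^ i * d) ` (digit_sums N L i \<times> {\<lfloor>a\<rfloor>, \<lfloor>a\<rfloor> + 1})"
  proof
    fix c assume c: "c \<in> ?S"
    then obtain c0 d where cd: "c0 \<in> digit_sums N L i" "c = c0 + int N ^ i * d"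
      using digit_sums_split[OF L, of c i "m - i"] im by auto
    have Npos: "0 < real N ^ i" using N by simp
    have c0: "0 \<le> c0" "c0 < int N ^ i" using digit_sums_subset[OF L, of i] cd(1) by auto
    then have c0': "0 \<le> real_of_int c0" "real_of_int c0 < real N ^ i"
      by (simp, metis of_int_less_iff of_int_of_nat_eq of_int_power)
    have rc: "real_of_int c = real_of_int c0 + real N ^ i * real_of_int d" by (simp add: cd(2))
    have "\<alpha> < real N ^ i * (real_of_int d + 1)" "real N ^ i * real_of_int d < \<alpha> + real N ^ i"
      using c rc c0' by (auto simp: algebra_simps)
    then have "a < real_of_int d + 1" "real_of_int d < a + 1"
      using Npos by (simp_all add: a_def field_simps)
    then have "d \<in> {\<lfloor>a\<rfloor>, \<lfloor>a\<rfloor> + 1}" by (simp add: floor_eq_iff) linarith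
    then show "c \<in> (\<lambda>(c0, d). c0 + int N ^ i * d) ` (digit_sums N L i \<times> {\<lfloor>a\<rfloor>, \<lfloor>a\<rfloor> + 1})"
      using cd by force
  qed
  have "card ?S \<le> card (digit_sums N L i \<times> {\<lfloor>a\<rfloor>, \<lfloor>a\<rfloor> + 1})"
    by (rule order_trans[OF card_mono[OF _ sub] card_image_le]) (use fin in auto)
  also have "\<dots> = 2 * card L ^ i" by (simp add: card_cartesian_product card_digit_sums[OF L])
  finally show ?thesis .
qed

text \<open>The ideal length solves \<open>m * \<beta> = s * (e + m)\<close>, that is
  \<open>m = s * e / (\<beta> - s)\<close>; rounding up costs at most \<open>\<beta>\<close>. For
  \<open>s = \<beta>\<close> the formula breaks down, and \<open>m\<close> is taken so large that
  \<open>e\<close> becomes negligible.\<close>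

lemma ex_block_length:
  fixes s \<beta> \<eta> :: real and e :: nat
  assumes "0 \<le> s" "s \<le> \<beta>" "0 < \<beta>" "0 < \<eta>"
  shows "\<exists>m\<ge>1. real m * (\<beta> - s) \<le> s * real e + \<beta> \<and> (s - \<eta>) * real (e + m) \<le> real m * \<beta>"
proof (cases "s < \<beta>")
  case True
  define y where "y = s * real e / (\<beta> - s)"
  define m where "m = nat \<lfloor>y\<rfloor> + 1"
  have y0: "0 \<le> y" using True assms by (simp add: y_def)
  have m: "real m \<le> y + 1" "y < real m" using y0 by (simp_all add: m_def) linarith+
  have yb: "y * (\<beta> - s) = s * real e" using True by (simp add: y_def)
  have "real m * (\<beta> - s) \<le> (y + 1) * (\<beta> - s)" using m True by (intro mult_right_mono) auto
  then have 1: "real m * (\<beta> - s) \<le> s * real e + \<beta>" using yb assms by (simp add: algebra_simps)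
  have "y * (\<beta> - s) \<le> real m * (\<beta> - s)" using m True by (intro mult_right_mono) auto
  then have "s * real (e + m) \<le> real m * \<beta>" using yb by (simp add: algebra_simps)
  moreover have "(s - \<eta>) * real (e + m) \<le> s * real (e + m)" using assms by (intro mult_right_mono) auto
  ultimately have "(s - \<eta>) * real (e + m) \<le> real m * \<beta>" by linarith
  moreover have "1 \<le> m" by (simp add: m_def)
  ultimately show ?thesis using 1 by blast
next
  case False
  then have s: "s = \<beta>" using assms by simp
  define m where "m = nat \<lceil>s * real e / \<eta>\<rceil> + 1"
  have "s * real e / \<eta> \<le> real m" by (simp add: m_def) linarith
  then have "s * real e \<le> real m * \<eta>" using assms by (simp add: divide_le_eq)
  moreover have "0 \<le> \<eta> * real e" using assms by simp
  ultimately have "(s - \<eta>) * real (e + m) \<le> real m * \<beta>" using s by (simp add: algebra_simps)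
  moreover have "real m * (\<beta> - s) \<le> s * real e + \<beta>" using s assms by simp
  moreover have "1 \<le> m" by (simp add: m_def)
  ultimately show ?thesis by blast
qed

text \<open>The block \<open>e, m\<close> carries a cluster of \<open>card D ^ m\<close> points spaced by
  \<open>N ^ e\<close>: its counting function is at most \<open>h powr (s + \<delta>)\<close> at every scale, and
  at least \<open>h powr (s - \<delta>)\<close> at the scale of the whole cluster.\<close>

lemma ex_block_exponents:
  fixes s \<delta> :: real and N q Z :: nat
  assumes N: "2 \<le> N" and q: "2 \<le> q" and s: "0 \<le> s" "s \<le> ln (real q) / ln (real N)" and d: "0 < \<delta>"
  shows "\<forall>\<^sub>F e in sequentially. \<exists>m\<ge>1.
     (\<forall>i\<in>{1..m}. real (2 * (2 * Z + 1) * q ^ i) \<le> (real N ^ (e + i - 1)) powr (s + \<delta>)) \<and>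
     (2 * (real Z + 2) * real N ^ (e + m)) powr (s - \<delta>) \<le> real q ^ m"
proof -
  define \<beta> where "\<beta> = ln (real q) / ln (real N)"
  define l where "l = ln (real N)"
  have l: "0 < l" using N by (simp add: l_def)
  have b: "0 < \<beta>" using N q by (simp add: \<beta>_def)
  have lq: "ln (real q) = \<beta> * l" using l by (simp add: \<beta>_def l_def)
  \<comment> \<open>Logarithms of the constants lost on the way: two blocks for each of
    \<open>2 * Z + 1\<close> shifts in the count, and the factor \<open>2 * (Z + 2)\<close> in the
    diameter of the cluster. The slack \<open>\<delta>\<close> absorbs them once \<open>e\<close> is
    large.\<close>
  define C1 where "C1 = ln (real (2 * (2 * Z + 1)))"
  define C2 where "C2 = ln (2 * (real Z + 2))"
  have C2: "0 \<le> C2" by (simp add: C2_def)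
  have lin: "\<forall>\<^sub>F e in sequentially. b \<le> real e * a" if "0 < a" for a b :: real
  proof -
    have "filterlim (\<lambda>e. real e * a) at_top sequentially"
      using that by (intro filterlim_at_top_mult_tendsto_pos[OF tendsto_const _ filterlim_real_sequentially])
    then show ?thesis by (simp add: filterlim_at_top)
  qed
  have "\<forall>\<^sub>F e in sequentially. C1 + \<beta> * l + (s + \<delta>) * l \<le> real e * (\<delta> * l)"
    "\<forall>\<^sub>F e in sequentially. s * C2 \<le> real e * (\<delta> / 2 * l)"
    using l d by (auto intro!: lin)
  then show ?thesis
  proof eventually_elim
    case (elim e)
    obtain m where m: "1 \<le> m" "real m * (\<beta> - s) \<le> s * real e + \<beta>" "(s - \<delta> / 2) * real (e + m) \<le> real m * \<beta>"
      using ex_block_length[of s \<beta> "\<delta> / 2" e] s b d by (auto simp: \<beta>_def)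
    have "real (2 * (2 * Z + 1) * q ^ i) \<le> (real N ^ (e + i - 1)) powr (s + \<delta>)" if i: "i \<in> {1..m}" for i
    proof -
      have "real i * (\<beta> - s) \<le> real m * (\<beta> - s)" using i s by (intro mult_right_mono) (auto simp: \<beta>_def)
      then have ib: "real i * \<beta> \<le> s * (real e + real i) + \<beta>" using m(2) by (simp add: algebra_simps)
      have "real e * (\<delta> * l) \<le> (real e + real i) * (\<delta> * l)" using d l by (intro mult_right_mono) auto
      then have "C1 + \<beta> * l + (s + \<delta>) * l \<le> (real e + real i) * (\<delta> * l)" using elim(1) by linarith
      moreover have "real i * \<beta> * l \<le> (s * (real e + real i) + \<beta>) * l" using ib l by (intro mult_right_mono) auto
      ultimately have main: "C1 + real i * (\<beta> * l) \<le> (s + \<delta>) * ((real e + real i - 1) * l)"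
        by (simp add: algebra_simps)
      have "real (2 * (2 * Z + 1) * q ^ i) = exp (C1 + real i * (\<beta> * l))"
        using q unfolding C1_def exp_add lq[symmetric] by (simp add: exp_of_nat_mult algebra_simps)
      also have "\<dots> \<le> exp ((s + \<delta>) * ((real e + real i - 1) * l))" using main by simp
      also have "\<dots> = (real N ^ (e + i - 1)) powr (s + \<delta>)"
        using i N by (simp add: powr_def l_def ln_realpow of_nat_diff)
      finally show ?thesis .
    qed
    moreover have "(2 * (real Z + 2) * real N ^ (e + m)) powr (s - \<delta>) \<le> real q ^ m"
    proof -
      have "ln (2 * (real Z + 2) * real N ^ (e + m)) = C2 + real (e + m) * l"
        using N by (simp add: ln_mult C2_def l_def ln_realpow)
      then have "(2 * (real Z + 2) * real N ^ (e + m)) powr (s - \<delta>) = exp ((s - \<delta>) * (C2 + real (e + m) * l))"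
        using N by (simp add: powr_def)
      also have "\<dots> \<le> exp (real m * (\<beta> * l))"
      proof -
        have "real e * (\<delta> / 2 * l) \<le> real (e + m) * (\<delta> / 2 * l)" using d l by (intro mult_right_mono) auto
        then have "s * C2 \<le> real (e + m) * (\<delta> / 2 * l)" using elim(2) by linarith
        moreover have "0 \<le> \<delta> * C2" using C2 d by simp
        moreover have "(s - \<delta> / 2) * real (e + m) * l \<le> real m * \<beta> * l" using m(3) l by (intro mult_right_mono) auto
        ultimately show ?thesis by (simp add: algebra_simps add_divide_distrib; linarith)
      qed
      also have "\<dots> = real q ^ m" using q unfolding lq[symmetric] by (simp add: exp_of_nat_mult)
      finally show ?thesis .
    qed
    ultimately show ?case using m(1) by blast
  qed
qed

section \<open>One stage of the construction\<close>

context spectral_tower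
begin

text \<open>Each point is placed beyond \<open>exp\<close> of the number of points already present
  and beyond twice their moduli. If a window of length \<open>h\<close> contains it together with an
  earlier point, then its modulus is below \<open>2 * h\<close>, so the earlier points number less
  than \<open>ln (2 * h)\<close>.\<close>

lemma far_extension:
  fixes v :: "'i \<Rightarrow> real"
  assumes S: "finite S" and J: "finite J" and gd: "good t \<epsilon> c Z"
  shows "\<exists>pos. (\<forall>i\<in>J. (\<exists>z::int. pos i = v i + real N ^ k * of_int z) \<and> b \<le> \<bar>pos i\<bar> \<and>
        (\<epsilon> \<le> g (of_int t * (pos i / real N ^ k)) \<longrightarrow> c \<le> cmod (FT M (of_int t * (pos i / real N ^ k))))) \<and>
      (\<forall>x h. 2 \<le> h \<longrightarrow> real (card (window x h \<inter> (S \<union> pos ` J)))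
         \<le> max (real (card (window x h \<inter> S))) (ln (2 * h) + 1))"
  using J
proof (induction J rule: finite_induct)
  case empty
  show ?case by simp
next
  case (insert i J)
  from insert.IH obtain pos where
    pos: "\<And>i. i \<in> J \<Longrightarrow> (\<exists>z::int. pos i = v i + real N ^ k * of_int z) \<and> b \<le> \<bar>pos i\<bar> \<and>
        (\<epsilon> \<le> g (of_int t * (pos i / real N ^ k)) \<longrightarrow> c \<le> cmod (FT M (of_int t * (pos i / real N ^ k))))"
    and count: "\<And>x h. 2 \<le> h \<Longrightarrow> real (card (window x h \<inter> (S \<union> pos ` J)))
         \<le> max (real (card (window x h \<inter> S))) (ln (2 * h) + 1)" by blast
  define S' where "S' = S \<union> pos ` J"
  have finS': "finite S'" using S insert.hyps by (simp add: S'_def)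
  define B where "B = \<bar>b\<bar> + exp (real (card S')) + (\<Sum>w\<in>S'. 2 * \<bar>w\<bar>)"
  have sum0: "0 \<le> (\<Sum>w\<in>S'. 2 * \<bar>w\<bar>)" by (simp add: sum_nonneg)
  have Npos: "0 < real N ^ k" using N_gt by simp
  define y where "y = v i / real N ^ k"
  obtain z :: int where z: "B / real N ^ k \<le> \<bar>y + of_int z\<bar>"
    "\<epsilon> \<le> g (of_int t * (y + of_int z)) \<longrightarrow> c \<le> cmod (FT M (of_int t * (y + of_int z)))"
  proof (cases "\<epsilon> \<le> g (of_int t * y)")
    case True
    then show ?thesis using gd that unfolding good_def by blast
  next
    \<comment> \<open>Below the threshold nothing is asked of the transform, and any sufficiently
      large shift will do.\<close>
    case False
    define z where "z = \<lceil>\<bar>y\<bar> + B / real N ^ k\<rceil>"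
    have "g (of_int t * (y + of_int z)) = g (of_int t * y)"
      by (rule g_eq_of_diff_int) (simp add: algebra_simps)
    moreover have "\<bar>y\<bar> + B / real N ^ k \<le> of_int z" by (simp add: z_def)
    then have "B / real N ^ k \<le> \<bar>y + of_int z\<bar>" by linarith
    ultimately show ?thesis using False that by metis
  qed
  define p where "p = v i + real N ^ k * of_int z"
  have pN: "p / real N ^ k = y + of_int z" using Npos by (simp add: p_def y_def field_simps)
  have "B \<le> \<bar>p / real N ^ k\<bar> * real N ^ k" using z(1) Npos unfolding pN by (simp add: divide_le_eq)
  moreover have "\<bar>p / real N ^ k\<bar> * real N ^ k = \<bar>p\<bar>" using N_gt by (simp add: abs_divide)
  ultimately have Bp: "B \<le> \<bar>p\<bar>" by simp
  have big: "b \<le> \<bar>p\<bar>" "exp (real (card S')) \<le> \<bar>p\<bar>" 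
    using Bp sum0 exp_gt_zero[of "real (card S')"] unfolding B_def by linarith+
  have twice: "2 * \<bar>w\<bar> \<le> \<bar>p\<bar>" if "w \<in> S'" for w
  proof -
    have "2 * \<bar>w\<bar> \<le> (\<Sum>w\<in>S'. 2 * \<bar>w\<bar>)" using that finS' by (intro member_le_sum) auto
    moreover have "0 \<le> exp (real (card S'))" by simp
    ultimately show ?thesis using Bp unfolding B_def by linarith
  qed
  define pos' where "pos' = pos(i := p)"
  have im: "S \<union> pos' ` insert i J = insert p S'"
    using insert.hyps by (auto simp: pos'_def S'_def)
  show ?case
  proof (intro exI[of _ pos'] conjI ballI allI impI)
    fix i' assume i': "i' \<in> insert i J"
    show "\<exists>z::int. pos' i' = v i' + real N ^ k * of_int z" "b \<le> \<bar>pos' i'\<bar>"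
      using i' pos[of i'] big insert.hyps by (cases "i' = i"; auto simp: pos'_def p_def)+
    assume "\<epsilon> \<le> g (of_int t * (pos' i' / real N ^ k))"
    then show "c \<le> cmod (FT M (of_int t * (pos' i' / real N ^ k)))"
      using i' pos[of i'] z(2) unfolding pN[symmetric] by (cases "i' = i") (auto simp: pos'_def)
  next
    fix x h :: real assume h: "2 \<le> h"
    let ?W = "window x h"
    have l0: "0 \<le> ln (2 * h)" using h by simp
    show "real (card (?W \<inter> (S \<union> pos' ` insert i J))) \<le> max (real (card (?W \<inter> S))) (ln (2 * h) + 1)"
    proof (cases "p \<in> ?W")
      case False
      then have "?W \<inter> insert p S' = ?W \<inter> (S \<union> pos ` J)" by (auto simp: S'_def)
      then show ?thesis unfolding im using count[OF h] by simp
    next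
      case True
      have "real (card (?W \<inter> insert p S')) \<le> ln (2 * h) + 1"
      proof (cases "?W \<inter> S' = {}")
        case True
        then have "?W \<inter> insert p S' \<subseteq> {p}" by auto
        then have "card (?W \<inter> insert p S') \<le> card {p}" by (intro card_mono) auto
        then have "real (card (?W \<inter> insert p S')) \<le> 1" by simp
        then show ?thesis using l0 by linarith
      next
        case False
        then obtain w where w: "w \<in> ?W" "w \<in> S'" by blast
        have "\<bar>p - w\<bar> < h" using w(1) \<open>p \<in> ?W\<close> by (auto simp: abs_less_iff)
        then have "\<bar>p\<bar> < 2 * h" using twice[OF w(2)] by linarith
        then have "exp (real (card S')) < 2 * h" using big by linarith
        then have "real (card S') < ln (2 * h)" using h by (metis exp_gt_zero ln_exp ln_less_cancel_iff order_less_trans)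
        moreover have "card (?W \<inter> insert p S') \<le> card (insert p S')" using finS' by (intro card_mono) auto
        moreover have "card (insert p S') \<le> Suc (card S')" by (rule card_insert_le_m1) auto
        ultimately show ?thesis by simp
      qed
      then show ?thesis unfolding im by simp
    qed
  qed
qed

text \<open>Three ranges of \<open>h\<close>: up to \<open>N ^ e\<close> a window holds at most one
  multiple of \<open>N ^ e\<close>; for \<open>N ^ (e + i - 1) < h \<le> N ^ (e + i)\<close> each of
  the \<open>2 * Z + 1\<close> possible shifts contributes at most \<open>2 * card D ^ i\<close>
  points; beyond \<open>N ^ (e + m)\<close> the whole cluster is counted.\<close>

lemma cluster_count:
  assumes zc: "\<And>c. c \<in> digit_sums N L m \<Longrightarrow> \<bar>zc c\<bar> \<le> int Z"
    and bound: "\<And>i. i \<in> {1..m} \<Longrightarrow> real (2 * (2 * Z + 1) * card D ^ i) \<le> (real N ^ (e + i - 1)) powr a"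
    and a: "0 \<le> a" and h: "2 \<le> h" and m: "1 \<le> m"
  shows "real (card (window x h \<inter> (\<lambda>c. real N ^ e * of_int c + real N ^ (e + m) * of_int (zc c)) ` digit_sums N L m))
      \<le> h powr a" (is "real (card (_ \<inter> ?A)) \<le> _")
proof (cases "h \<le> real N ^ e")
  case True
  have finA: "finite ?A" by (intro finite_imageI finite_digit_sums finite_L)
  have mult: "\<exists>n::int. u = real N ^ e * of_int n" if uA: "u \<in> ?A" for u
  proof -
    obtain c where "u = real N ^ e * of_int c + real N ^ (e + m) * of_int (zc c)" using uA by auto
    then show ?thesis by (intro exI[of _ "c + int N ^ m * zc c"]) (simp add: power_add algebra_simps)
  qed
  have "u = w" if uw: "u \<in> window x h \<inter> ?A" "w \<in> window x h \<inter> ?A" for u w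
  proof -
    obtain n n' :: int where n: "u = real N ^ e * of_int n" "w = real N ^ e * of_int n'"
      using uw mult by blast
    have "\<bar>u - w\<bar> < h" using uw by (auto simp: abs_less_iff)
    then have "\<bar>real N ^ e * of_int (n - n')\<bar> < real N ^ e" using True by (simp add: n algebra_simps)
    then have "\<bar>real_of_int (n - n')\<bar> < 1" using N_gt by (simp add: abs_mult)
    then have "n = n'" by linarith
    then show ?thesis by (simp add: n)
  qed
  then have "card (window x h \<inter> ?A) \<le> 1" using finA by (simp add: card_le_Suc0_iff_eq)
  then have "real (card (window x h \<inter> ?A)) \<le> 1" by simp
  also have "1 \<le> h powr a" using h a by (simp add: ge_one_powr_ge_zero)
  finally show ?thesis .
next
  case False
  have q: "card L = card D" by (rule L(3))
  define C where "C = digit_sums N L m"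
  have finC: "finite C" unfolding C_def by (intro finite_digit_sums finite_L)
  have "\<exists>i\<in>{1..m}. card (window x h \<inter> ?A) \<le> 2 * (2 * Z + 1) * card D ^ i \<and> real N ^ (e + i - 1) < h"
  proof (cases "h \<le> real N ^ (e + m)")
    case True
    define i where "i = (LEAST i. h \<le> real N ^ (e + i))"
    have hi: "h \<le> real N ^ (e + i)" unfolding i_def using True by (rule LeastI)
    have im: "i \<le> m" unfolding i_def using True by (rule Least_le)
    have i0: "i \<noteq> 0" using hi False by (intro notI) simp
    have "\<not> h \<le> real N ^ (e + (i - 1))"
      using not_less_Least[of "i - 1" "\<lambda>i. h \<le> real N ^ (e + i)"] i0 unfolding i_def by simp
    then have low: "real N ^ (e + i - 1) < h" using i0 by simp
    define E where "E = (\<lambda>z. {c \<in> C. (x - h / 2 - real N ^ (e + m) * of_int z) / real N ^ e < of_int c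
        \<and> of_int c < (x - h / 2 - real N ^ (e + m) * of_int z) / real N ^ e + real N ^ i})"
    have finE: "finite (E z)" for z :: int using finC by (simp add: E_def)
    have sub: "window x h \<inter> ?A \<subseteq>
        (\<Union>z\<in>{- int Z..int Z}. (\<lambda>c. real N ^ e * of_int c + real N ^ (e + m) * of_int z) ` E z)"
    proof
      fix u assume u: "u \<in> window x h \<inter> ?A"
      then obtain c where c: "c \<in> C" "u = real N ^ e * of_int c + real N ^ (e + m) * of_int (zc c)"
        by (auto simp: C_def)
      have "x - h / 2 - real N ^ (e + m) * of_int (zc c) < real N ^ e * of_int c"
        "real N ^ e * of_int c < x - h / 2 - real N ^ (e + m) * of_int (zc c) + real N ^ e * real N ^ i"
        using u c hi by (auto simp: power_add)
      then have "c \<in> E (zc c)" using c(1) N_gt by (simp add: E_def field_simps)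
      moreover have "zc c \<in> {- int Z..int Z}" using zc c(1) by (force simp: C_def)
      ultimately show "u \<in> (\<Union>z\<in>{- int Z..int Z}. (\<lambda>c. real N ^ e * of_int c + real N ^ (e + m) * of_int z) ` E z)"
        using c(2) by blast
    qed
    have "card (window x h \<inter> ?A) \<le> card (\<Union>z\<in>{- int Z..int Z}. (\<lambda>c. real N ^ e * of_int c + real N ^ (e + m) * of_int z) ` E z)"
      by (intro card_mono sub finite_UN_I finite_imageI finE) simp
    also have "\<dots> \<le> (\<Sum>z\<in>{- int Z..int Z}. card ((\<lambda>c. real N ^ e * of_int c + real N ^ (e + m) * of_int z) ` E z))"
      by (rule card_UN_le) simp
    also have "\<dots> \<le> (\<Sum>z\<in>{- int Z..int Z}. 2 * card D ^ i)"
    proof (rule sum_mono)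
      fix z :: int
      have "card ((\<lambda>c. real N ^ e * of_int c + real N ^ (e + m) * of_int z) ` E z) \<le> card (E z)"
        by (rule card_image_le[OF finE])
      also have "\<dots> \<le> 2 * card D ^ i"
        unfolding E_def C_def using card_digit_sums_interval[OF L(1) _ im] N2 q by simp
      finally show "card ((\<lambda>c. real N ^ e * of_int c + real N ^ (e + m) * of_int z) ` E z) \<le> 2 * card D ^ i" .
    qed
    also have "\<dots> = 2 * (2 * Z + 1) * card D ^ i"
    proof -
      have "nat (2 * int Z + 1) = 2 * Z + 1" by arith
      then show ?thesis by (simp add: algebra_simps)
    qed
    finally show ?thesis using low i0 im by (intro bexI[of _ i]) auto
  next
    case False
    have "card (window x h \<inter> ?A) \<le> card ?A" using finC by (intro card_mono) (auto simp: C_def)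
    also have "\<dots> \<le> card C" unfolding C_def[symmetric] by (rule card_image_le[OF finC])
    also have "\<dots> = card D ^ m" by (simp add: C_def card_digit_sums[OF L(1)] q)
    also have "\<dots> \<le> 2 * (2 * Z + 1) * card D ^ m" by simp
    finally have 1: "card (window x h \<inter> ?A) \<le> 2 * (2 * Z + 1) * card D ^ m" .
    have "real N ^ (e + m - 1) \<le> real N ^ (e + m)" using N_gt by (intro power_increasing) auto
    then show ?thesis using 1 False m by (intro bexI[of _ m]) auto
  qed
  then obtain i where i: "i \<in> {1..m}" "card (window x h \<inter> ?A) \<le> 2 * (2 * Z + 1) * card D ^ i" "real N ^ (e + i - 1) < h"
    by blast
  have "real (card (window x h \<inter> ?A)) \<le> real (2 * (2 * Z + 1) * card D ^ i)" using i(2) by (simp only: of_nat_le_iff)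
  also have "\<dots> \<le> (real N ^ (e + i - 1)) powr a" by (rule bound[OF i(1)])
  also have "\<dots> \<le> h powr a" using i(3) a by (intro powr_mono2) auto
  finally show ?thesis .
qed

text \<open>The second component of \<open>prod_decode\<close> is discarded, so every pair of a
  multiplier and a threshold index recurs infinitely often.\<close>

definition schedule :: "nat \<Rightarrow> int \<times> nat" where
  "schedule j = from_nat_into (T \<times> UNIV) (fst (prod_decode j))"

lemma schedule_in: "fst (schedule j) \<in> T"
proof -
  have "schedule j \<in> T \<times> UNIV"
    unfolding schedule_def by (rule from_nat_into) (use one_in_T in auto)
  then show ?thesis by auto
qed

lemma schedule_recurs:
  assumes "t \<in> T"
  shows "\<exists>j\<ge>n. schedule j = (t, i)"
proof -
  have "countable (T \<times> (UNIV :: nat set))" by auto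
  then obtain a where a: "from_nat_into (T \<times> (UNIV :: nat set)) a = (t, i)"
    using assms from_nat_into_surj[of "T \<times> (UNIV :: nat set)" "(t, i)"] by auto
  show ?thesis
    by (intro exI[of _ "prod_encode (a, n)"]) (auto simp: schedule_def a le_prod_encode_2)
qed

text \<open>Fixed once for each pair instead of at each stage: all stages devoted to the same pair
  must gain the same proportion of the defect.\<close>

definition lower :: "int \<Rightarrow> nat \<Rightarrow> real" where
  "lower t i = (SOME c. \<exists>Z. good t (1 / Suc i) c Z)"

lemma good_lower: "t \<in> T \<Longrightarrow> \<exists>Z. good t (1 / Suc i) (lower t i) Z"
  unfolding lower_def by (rule someI_ex) (simp add: ex_good)

text \<open>The set \<open>\<Lambda>'\<close> extends \<open>\<Lambda>\<close> by the digits of the levels \<open>k, \<dots>, k' - 1\<close>, shifted by multiples of \<open>N ^ k'\<close>.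
  The bounds on the number of points in windows force the dimension \<open>s\<close>; the lower bound on \<open>FT\<close> at the new points, for
  the multiplier and threshold scheduled at stage \<open>j\<close>, yields completeness.\<close>

definition step :: "real \<Rightarrow> nat \<Rightarrow> real set \<times> nat \<Rightarrow> real set \<times> nat \<Rightarrow> bool" where
  "step s j = (\<lambda>(\<Lambda>, k) (\<Lambda>', k').
     finite \<Lambda>' \<and> \<Lambda> \<subseteq> \<Lambda>' \<and> k < k' \<and> parseval \<Lambda>' k' \<and>
     (\<forall>u\<in>\<Lambda>. \<bar>u\<bar> * real (Suc j) \<le> real N ^ k') \<and>
     (\<forall>u\<in>\<Lambda>' - \<Lambda>. 1 / Suc (snd (schedule j)) \<le> g (of_int (fst (schedule j)) * (u / real N ^ k')) \<longrightarrow>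
        lower (fst (schedule j)) (snd (schedule j)) \<le> cmod (FT M (of_int (fst (schedule j)) * (u / real N ^ k')))) \<and>
     (\<forall>t\<in>T. \<forall>x. (\<Sum>u\<in>\<Lambda>'. (cmod (digit_mask_prod N D k' (x + of_int t * u)))\<^sup>2) \<le> P) \<and>
     (\<forall>x h. 2 \<le> h \<longrightarrow> real (card (window x h \<inter> \<Lambda>'))
        \<le> max (real (card (window x h \<inter> \<Lambda>))) (h powr (s + 1 / Suc j) + ln (2 * h) + 1)) \<and>
     (\<exists>h\<ge>2. real j \<le> h \<and> h powr (s - 1 / Suc j) \<le> real (card (window 0 h \<inter> \<Lambda>'))) \<and>
     (\<forall>u\<in>\<Lambda>' - \<Lambda>. \<forall>v\<in>\<Lambda>. \<bar>v\<bar> < \<bar>u\<bar>))"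

text \<open>Level and cardinality are fixed before \<open>b\<close>, while some element can be
  forced beyond \<open>b\<close>. This yields different extensions of equal level and size.\<close>

lemma step_exists:
  assumes s: "0 \<le> s" "s \<le> ln (real (card D)) / ln (real N)"
    and fin: "finite \<Lambda>" and zero: "0 \<in> \<Lambda>" and par: "parseval \<Lambda> k"
  shows "\<exists>k'. \<forall>b. \<exists>\<Lambda>'. step s j (\<Lambda>, k) (\<Lambda>', k') \<and> card \<Lambda>' = card \<Lambda> * card D ^ (k' - k) \<and> (\<exists>u\<in>\<Lambda>'. b < \<bar>u\<bar>)"
proof -
  obtain t i where ti: "schedule j = (t, i)" by (cases "schedule j")
  have t: "t \<in> T" using schedule_in[of j] ti by simp
  obtain Z where gd: "good t (1 / Suc i) (lower t i) Z" using good_lower[OF t] by blast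
  define \<epsilon> where "\<epsilon> = 1 / real (Suc i)"
  define c0 where "c0 = lower t i"
  have gd': "good t \<epsilon> c0 Z" using gd by (simp add: \<epsilon>_def c0_def)
  define \<delta> where "\<delta> = 1 / real (Suc j)"
  have d: "0 < \<delta>" by (simp add: \<delta>_def)
  define S where "S = (\<Sum>u\<in>\<Lambda>. \<bar>u\<bar>)"
  have S: "\<bar>u\<bar> \<le> S" if "u \<in> \<Lambda>" for u
    unfolding S_def using that fin by (intro member_le_sum) auto
  have S0: "0 \<le> S" by (simp add: S_def sum_nonneg)
  \<comment> \<open>What \<open>N ^ e\<close> has to exceed: twice the old radius, so that new
    points lie outside; \<open>Suc j\<close> times it, so that rescaled old points tend to
    \<open>0\<close>; \<open>exp (card \<Lambda>)\<close>, so that old points count only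
    logarithmically in a window that also meets the cluster; and \<open>j + 2\<close>, so that the
    window of the lower bound is large.\<close>
  define B where "B = 2 * S + real (Suc j) * S + exp (real (card \<Lambda>)) + real j + 2"
  obtain e where blocks: "\<exists>m\<ge>1.
     (\<forall>i\<in>{1..m}. real (2 * (2 * Z + 1) * card D ^ i) \<le> (real N ^ (e + i - 1)) powr (s + \<delta>)) \<and>
     (2 * (real Z + 2) * real N ^ (e + m)) powr (s - \<delta>) \<le> real (card D) ^ m"
    and e: "B \<le> real N ^ e" "k + r + 1 \<le> e"
  proof -
    have "\<forall>\<^sub>F e in sequentially. (\<exists>m\<ge>1.
     (\<forall>i\<in>{1..m}. real (2 * (2 * Z + 1) * card D ^ i) \<le> (real N ^ (e + i - 1)) powr (s + \<delta>)) \<and>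
     (2 * (real Z + 2) * real N ^ (e + m)) powr (s - \<delta>) \<le> real (card D) ^ m) \<and> B \<le> real N ^ e \<and> k + r + 1 \<le> e"
      by (intro eventually_conj ex_block_exponents N2 card_D(1) s d eventually_le_power eventually_ge_at_top)
    from eventually_happens'[OF sequentially_bot this] show ?thesis using that by blast
  qed
  obtain m where m: "1 \<le> m"
    "\<And>i. i \<in> {1..m} \<Longrightarrow> real (2 * (2 * Z + 1) * card D ^ i) \<le> (real N ^ (e + i - 1)) powr (s + \<delta>)"
    "(2 * (real Z + 2) * real N ^ (e + m)) powr (s - \<delta>) \<le> real (card D) ^ m"
    using blocks by blast
  define k' where "k' = e + m"
  define mm where "mm = k' - k"
  have mm: "k + mm = k'" "r \<le> mm" "mm = (e - k) + m" "1 \<le> e - k" "k < k'" using e(2) by (auto simp: mm_def k'_def)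
  have Ne: "0 < real N ^ e" using N_gt by simp
  have Nek: "real N ^ e \<le> real N ^ k'" unfolding k'_def using N_gt by (intro power_increasing) auto
  define C where "C = digit_sums N L m"
  have finC: "finite C" unfolding C_def by (intro finite_digit_sums finite_L)
  have Cr: "0 \<le> c" "c < int N ^ m" if "c \<in> C" for c using that digit_sums_subset[OF L(1), of m] by (auto simp: C_def)
  have C0: "0 \<in> C" unfolding C_def by (rule zero_in_digit_sums[OF L(2)])
  have "\<forall>c\<in>C. \<exists>z::int. \<bar>z\<bar> \<le> int Z \<and> (\<epsilon> \<le> g (of_int t * (of_int c / real N ^ m)) \<longrightarrow>
      c0 \<le> cmod (FT M (of_int t * (of_int c / real N ^ m + of_int z))))"
  proof
    fix c assume c: "c \<in> C"
    have "real_of_int c \<le> real N ^ m"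
      using Cr[OF c] by (metis less_imp_le of_int_le_iff of_int_of_nat_eq of_int_power)
    then have "of_int c / real N ^ m \<in> {0..1}" using Cr[OF c] N_gt by simp
    then show "\<exists>z::int. \<bar>z\<bar> \<le> int Z \<and> (\<epsilon> \<le> g (of_int t * (of_int c / real N ^ m)) \<longrightarrow>
      c0 \<le> cmod (FT M (of_int t * (of_int c / real N ^ m + of_int z))))"
      using gd' unfolding good_def
      by (cases "\<epsilon> \<le> g (of_int t * (of_int c / real N ^ m))") (blast, intro exI[of _ 0], simp)
  qed
  then obtain zc0 where zc0: "\<And>c. c \<in> C \<Longrightarrow> \<bar>zc0 c\<bar> \<le> int Z"
    "\<And>c. c \<in> C \<Longrightarrow> \<epsilon> \<le> g (of_int t * (of_int c / real N ^ m)) \<Longrightarrow>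
      c0 \<le> cmod (FT M (of_int t * (of_int c / real N ^ m + of_int (zc0 c))))"
    by (metis (no_types, lifting))
  \<comment> \<open>The digit \<open>0\<close> stays unshifted, because it represents the old point
    \<open>0\<close>, which must not move.\<close>
  define zc where "zc = (\<lambda>c::int. if c = 0 then 0 else zc0 c)"
  have zc: "\<bar>zc c\<bar> \<le> int Z" if "c \<in> C" for c using zc0(1)[OF that] by (simp add: zc_def)
  define clus where "clus = (\<lambda>c. real N ^ e * of_int c + real N ^ (e + m) * of_int (zc c))"
  have clus0: "clus 0 = 0" by (simp add: clus_def zc_def)
  define A where "A = clus ` C"
  have finA: "finite A" using finC by (simp add: A_def)
  have clus_eq: "clus c = real N ^ e * of_int (c + int N ^ m * zc c)" for c
    by (simp add: clus_def power_add algebra_simps)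
  have inj_clus: "inj_on clus C"
  proof (rule inj_onI)
    fix c d assume cd: "c \<in> C" "d \<in> C" "clus c = clus d"
    then have "c + int N ^ m * zc c = d + int N ^ m * zc d"
      using Ne unfolding clus_eq by (metis less_irrefl mult_left_cancel of_int_eq_iff)
    then have "(c + int N ^ m * zc c) mod int N ^ m = (d + int N ^ m * zc d) mod int N ^ m" by simp
    then show "c = d" using Cr[OF cd(1)] Cr[OF cd(2)] by simp
  qed
  have clus_ge: "real N ^ e \<le> \<bar>clus c\<bar>" if c: "c \<in> C" "c \<noteq> 0" for c
  proof -
    have "clus c \<noteq> clus 0" using inj_onD[OF inj_clus _ c(1) C0] c(2) by blast
    then have "clus c \<noteq> 0" using clus0 by simp
    then have "c + int N ^ m * zc c \<noteq> 0" unfolding clus_eq by (metis mult_zero_right of_int_0)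
    then have "1 \<le> \<bar>real_of_int (c + int N ^ m * zc c)\<bar>" by linarith
    then have "real N ^ e * 1 \<le> real N ^ e * \<bar>real_of_int (c + int N ^ m * zc c)\<bar>" using Ne by (intro mult_left_mono) auto
    then show ?thesis unfolding clus_eq by (simp add: abs_mult)
  qed
  have clus_le: "\<bar>clus c\<bar> < real N ^ k' * (real Z + 2)" if c: "c \<in> C" for c
  proof -
    have "real_of_int c \<le> real N ^ m"
      using Cr[OF c] by (metis less_imp_le of_int_le_iff of_int_of_nat_eq of_int_power)
    then have "real N ^ e * of_int c \<le> real N ^ e * real N ^ m" using Ne by (intro mult_left_mono) auto
    then have 1: "\<bar>real N ^ e * of_int c\<bar> \<le> real N ^ k'" using Cr[OF c] by (simp add: k'_def power_add abs_mult)
    have "\<bar>real_of_int (zc c)\<bar> \<le> real Z" using zc[OF c] by linarith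
    then have "real N ^ k' * \<bar>real_of_int (zc c)\<bar> \<le> real N ^ k' * real Z" by (intro mult_left_mono) auto
    then have 2: "\<bar>real N ^ k' * of_int (zc c)\<bar> \<le> real N ^ k' * real Z" by (simp add: abs_mult)
    have "0 < real N ^ k'" using N_gt by simp
    then show ?thesis using 1 2 unfolding clus_def k'_def[symmetric] by (simp add: algebra_simps; linarith)
  qed
  define CC where "CC = digit_sums N L mm"
  have finCC: "finite CC" unfolding CC_def by (intro finite_digit_sums finite_L)
  have CC0: "0 \<in> CC" unfolding CC_def by (rule zero_in_digit_sums[OF L(2)])
  \<comment> \<open>Relative to level \<open>k\<close>, the cluster occupies only the top
    \<open>m\<close> of the \<open>mm\<close> new levels, over the old point
    \<open>0\<close>.\<close>
  define E where "E = (\<lambda>c. int N ^ (e - k) * c) ` C"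
  have Esub: "E \<subseteq> CC"
  proof
    fix x assume "x \<in> E"
    then obtain c where c: "c \<in> digit_sums N L m" "x = int N ^ (e - k) * c" by (auto simp: E_def C_def)
    from digit_sums_add[OF zero_in_digit_sums[OF L(2), of N "e - k"] c(1)]
    show "x \<in> CC" unfolding CC_def mm(3) c(2) by simp
  qed
  have Npk: "int N ^ (e - k) \<noteq> 0" using N2 by simp
  define I where "I = \<Lambda> \<times> CC"
  define J where "J = {p \<in> I. snd p \<noteq> 0 \<and> \<not> (fst p = 0 \<and> snd p \<in> E)}"
  have finJ: "finite J" using fin finCC by (simp add: J_def I_def)
  have cardE: "card CC = card D ^ mm" unfolding CC_def using card_digit_sums[OF L(1)] L(3) by simp
  \<comment> \<open>A nonzero digit at the lowest new level is not in \<open>E\<close>, since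
    \<open>k < e\<close>. Its element is among those sent far away, and it is the one that can be
    made to exceed \<open>b\<close>.\<close>
  obtain l where l: "l \<in> L" "l \<noteq> 0"
  proof -
    have "\<not> L \<subseteq> {0}"
    proof
      assume "L \<subseteq> {0}"
      then have "card L \<le> card {0::int}" by (intro card_mono) auto
      then show False using L(3) card_D by simp
    qed
    then show ?thesis using that by blast
  qed
  have lJ: "(0, l) \<in> J"
  proof -
    have "l \<in> digit_sums N L 1" using l(1) by force
    from digit_sums_add[OF this zero_in_digit_sums[OF L(2), of N "mm - 1"]]
    have "l + int N ^ 1 * 0 \<in> digit_sums N L (1 + (mm - 1))" .
    moreover have "1 + (mm - 1) = mm" using mm(3,4) by linarith
    ultimately have "l \<in> CC" by (simp only: CC_def mult_zero_right add_0_right)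
    moreover have "l \<notin> E"
    proof
      assume "l \<in> E"
      then obtain c where c: "c \<in> C" "l = int N ^ (e - k) * c" by (auto simp: E_def)
      have "int N dvd l" unfolding c(2) using mm(4) by (intro dvd_mult2 dvd_power disjI1) linarith
      moreover have "0 \<le> l" "l < int N" using l(1) L(1) by auto
      ultimately show False using l(2) zdvd_imp_le[of "int N" l] by linarith
    qed
    ultimately show ?thesis using l(2) zero by (simp add: J_def I_def)
  qed
  have "\<exists>\<Lambda>'. step s j (\<Lambda>, k) (\<Lambda>', k') \<and> card \<Lambda>' = card \<Lambda> * card D ^ (k' - k) \<and> (\<exists>u\<in>\<Lambda>'. b < \<bar>u\<bar>)" for b
  proof -
    \<comment> \<open>\<open>b + 1\<close> makes the element of \<open>(0, l)\<close> exceed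
      \<open>b\<close>; \<open>N ^ e\<close> keeps all far elements outside the old radius.\<close>
    define b' where "b' = max (b + 1) (real N ^ e)"
    obtain posf where
      posf: "\<And>p. p \<in> J \<Longrightarrow> (\<exists>z::int. posf p = (fst p + real N ^ k * of_int (snd p)) + real N ^ k' * of_int z) \<and> b' \<le> \<bar>posf p\<bar> \<and>
        (\<epsilon> \<le> g (of_int t * (posf p / real N ^ k')) \<longrightarrow> c0 \<le> cmod (FT M (of_int t * (posf p / real N ^ k'))))"
      and count: "\<And>x h. 2 \<le> h \<Longrightarrow> real (card (window x h \<inter> ((\<Lambda> \<union> A) \<union> posf ` J)))
         \<le> max (real (card (window x h \<inter> (\<Lambda> \<union> A)))) (ln (2 * h) + 1)"
      using far_extension[OF _ finJ gd', of "\<Lambda> \<union> A" "\<lambda>p. fst p + real N ^ k * of_int (snd p)" k' b'] fin finA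
      by auto
    \<comment> \<open>Old elements stay, the cluster over \<open>0\<close> receives bounded shifts,
      and every other pair is sent far away.\<close>
    define pos where "pos = (\<lambda>p. if snd p = 0 then fst p
      else if fst p = 0 \<and> snd p \<in> E then clus (snd p div int N ^ (e - k)) else posf p)"
    have posE: "pos (0, int N ^ (e - k) * c) = clus c" if "c \<in> C" for c
      using that Npk by (auto simp: pos_def E_def clus0)
    have form: "\<exists>z::int. pos (u, c) = u + real N ^ k * of_int c + real N ^ (k + mm) * of_int z"
      if uc: "u \<in> \<Lambda>" "c \<in> digit_sums N L mm" for u c
    proof -
      consider "c = 0" | "c \<noteq> 0" "u = 0" "c \<in> E" | "(u, c) \<in> J"
        using uc by (auto simp: J_def I_def CC_def)
      then show ?thesis
      proof cases
        case 1
        then show ?thesis by (intro exI[of _ 0]) (simp add: pos_def)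
      next
        case 2
        then obtain c1 where c1: "c1 \<in> C" "c = int N ^ (e - k) * c1" by (auto simp: E_def)
        have "real N ^ e = real N ^ k * real N ^ (e - k)" using e(2) by (simp flip: power_add)
        then show ?thesis
          using posE[OF c1(1)] 2 unfolding c1(2) mm(1)
          by (intro exI[of _ "zc c1"]) (simp add: clus_def k'_def)
      next
        case 3
        then have "pos (u, c) = posf (u, c)" by (auto simp: pos_def J_def)
        then show ?thesis using posf[OF 3] unfolding mm(1) by simp
      qed
    qed
    define \<Lambda>' where "\<Lambda>' = pos ` (\<Lambda> \<times> digit_sums N L mm)"
    have ext1: "inj_on pos (\<Lambda> \<times> digit_sums N L mm)"
      by (rule extend(1)[OF fin par]) (rule form)
    have ext2: "parseval \<Lambda>' k'"
      unfolding \<Lambda>'_def mm(1)[symmetric] by (rule extend(2)[OF fin par]) (rule form)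
    have ext3: "(\<Sum>u\<in>\<Lambda>'. (cmod (digit_mask_prod N D k' (x + of_int t' * u)))\<^sup>2) \<le> P" if "t' \<in> T" for t' x
      unfolding \<Lambda>'_def mm(1)[symmetric] by (rule extend(3)[OF fin par _ mm(2) that]) (rule form)
    have \<Lambda>'_I: "\<Lambda>' = pos ` I" by (simp add: \<Lambda>'_def I_def CC_def)
    have \<Lambda>': "\<Lambda>' = \<Lambda> \<union> A \<union> posf ` J"
    proof (intro equalityI subsetI)
      fix x assume "x \<in> \<Lambda>'"
      then obtain u c where uc: "u \<in> \<Lambda>" "c \<in> CC" "x = pos (u, c)" by (auto simp: \<Lambda>'_I I_def)
      consider "c = 0" | "c \<noteq> 0" "u = 0" "c \<in> E" | "(u, c) \<in> J"
        using uc by (auto simp: J_def I_def)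
      then show "x \<in> \<Lambda> \<union> A \<union> posf ` J"
      proof cases
        case 1
        then show ?thesis using uc by (simp add: pos_def)
      next
        case 2
        then obtain c1 where c1: "c1 \<in> C" "c = int N ^ (e - k) * c1" by (auto simp: E_def)
        then show ?thesis using posE[OF c1(1)] uc(3) 2 by (simp add: A_def)
      next
        case 3
        then have "pos (u, c) = posf (u, c)" by (auto simp: pos_def J_def)
        then show ?thesis using 3 uc(3) by auto
      qed
    next
      fix x assume "x \<in> \<Lambda> \<union> A \<union> posf ` J"
      then consider "x \<in> \<Lambda>" | c where "c \<in> C" "x = clus c" | p where "p \<in> J" "x = posf p"
        by (auto simp: A_def)
      then show "x \<in> \<Lambda>'"
      proof cases
        case 1
        then have "(x, 0) \<in> I" using CC0 by (simp add: I_def)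
        moreover have "pos (x, 0) = x" by (simp add: pos_def)
        ultimately show ?thesis unfolding \<Lambda>'_I by (metis imageI)
      next
        case 2
        then have "(0, int N ^ (e - k) * c) \<in> I" using zero Esub by (auto simp: I_def E_def)
        then show ?thesis unfolding \<Lambda>'_I 2(2) posE[OF 2(1), symmetric] by (rule imageI)
      next
        case 3
        then have "pos p = posf p" "p \<in> I" by (auto simp: pos_def J_def)
        then show ?thesis unfolding \<Lambda>'_I 3(2) by (metis imageI)
      qed
    qed
    have new: "(\<exists>c\<in>C. c \<noteq> 0 \<and> u = clus c) \<or> (\<exists>p\<in>J. u = posf p)" if u: "u \<in> \<Lambda>' - \<Lambda>" for u
    proof -
      have "u \<noteq> 0" using u zero by auto
      have "u \<in> A \<or> u \<in> posf ` J" using u \<Lambda>' by auto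
      then show ?thesis
      proof
        assume "u \<in> A"
        then obtain c where c: "c \<in> C" "u = clus c" by (auto simp: A_def)
        then have "c \<noteq> 0" using \<open>u \<noteq> 0\<close> clus0 by auto
        then show ?thesis using c by blast
      qed auto
    qed
    have new_ge: "real N ^ e \<le> \<bar>u\<bar>" if u: "u \<in> \<Lambda>' - \<Lambda>" for u
      using new[OF u] clus_ge posf by (auto simp: b'_def)
    have Ssmall: "2 * S < real N ^ e" "real (Suc j) * S \<le> real N ^ e" "exp (real (card \<Lambda>)) \<le> real N ^ e"
        "real j + 2 \<le> real N ^ e"
    proof -
      have "0 \<le> real (Suc j) * S" using S0 by simp
      then show "2 * S < real N ^ e" "real (Suc j) * S \<le> real N ^ e" "exp (real (card \<Lambda>)) \<le> real N ^ e"
        "real j + 2 \<le> real N ^ e"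
        using e(1) S0 exp_gt_zero[of "real (card \<Lambda>)"] unfolding B_def by linarith+
    qed
    \<comment> \<open>A window that meets the cluster away from \<open>0\<close> and also contains
      an old point has \<open>N ^ e < 2 * h\<close>, so the old points number less than
      \<open>ln (2 * h)\<close>.\<close>
    have c_count: "real (card (window x h \<inter> (\<Lambda> \<union> A)))
        \<le> max (real (card (window x h \<inter> \<Lambda>))) (h powr (s + \<delta>) + ln (2 * h) + 1)" if h: "2 \<le> h" for x h
    proof (cases "window x h \<inter> (A - {0}) = {}")
      case True
      then have "window x h \<inter> (\<Lambda> \<union> A) = window x h \<inter> \<Lambda>" using zero by auto
      then show ?thesis by simp
    next
      case False
      then obtain w where w: "w \<in> window x h" "w \<in> A" "w \<noteq> 0" by blast
      then have we: "real N ^ e \<le> \<bar>w\<bar>" using clus_ge clus0 by (auto simp: A_def)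
      have cA: "real (card (window x h \<inter> A)) \<le> h powr (s + \<delta>)"
        unfolding A_def clus_def C_def
        by (rule cluster_count[where Z=Z]) (use zc m h s d in \<open>auto simp: C_def\<close>)
      have c\<Lambda>: "real (card (window x h \<inter> \<Lambda>)) \<le> ln (2 * h)"
      proof (cases "window x h \<inter> \<Lambda> = {}")
        case True
        then show ?thesis using h by simp
      next
        case False
        then obtain v where v: "v \<in> window x h" "v \<in> \<Lambda>" by blast
        have "\<bar>w - v\<bar> < h" using w v by (auto simp: abs_less_iff)
        then have "real N ^ e < 2 * h" using we S[OF v(2)] Ssmall(1) by linarith
        then have "exp (real (card \<Lambda>)) < 2 * h" using Ssmall(3) by linarith
        then have "real (card \<Lambda>) < ln (2 * h)" using h by (metis exp_gt_zero ln_exp ln_less_cancel_iff order_less_trans)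
        moreover have "card (window x h \<inter> \<Lambda>) \<le> card \<Lambda>" using fin by (intro card_mono) auto
        ultimately show ?thesis by linarith
      qed
      have "card (window x h \<inter> (\<Lambda> \<union> A)) \<le> card (window x h \<inter> \<Lambda>) + card (window x h \<inter> A)"
        unfolding Int_Un_distrib by (rule card_Un_le)
      then show ?thesis using cA c\<Lambda> by linarith
    qed
    have "step s j (\<Lambda>, k) (\<Lambda>', k')"
      unfolding step_def case_prod_conv ti fst_conv snd_conv
    proof (intro conjI ballI allI impI)
      show "finite \<Lambda>'" unfolding \<Lambda>' using fin finA finJ by simp
      show "\<Lambda> \<subseteq> \<Lambda>'" unfolding \<Lambda>' by auto
      show "k < k'" by (rule mm(5))
      show "parseval \<Lambda>' k'" by (rule ext2)
      show "\<bar>u\<bar> * real (Suc j) \<le> real N ^ k'" if "u \<in> \<Lambda>" for u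
      proof -
        have "\<bar>u\<bar> * real (Suc j) \<le> S * real (Suc j)" using S[OF that] by (intro mult_right_mono) auto
        also have "\<dots> \<le> real N ^ e" using Ssmall(2) by (simp only: mult.commute)
        finally show ?thesis using Nek by linarith
      qed
      show "(\<Sum>u\<in>\<Lambda>'. (cmod (digit_mask_prod N D k' (x + of_int t' * u)))\<^sup>2) \<le> P" if "t' \<in> T" for t' x
        by (rule ext3[OF that])
      show "lower t i \<le> cmod (FT M (of_int t * (u / real N ^ k')))"
        if u: "u \<in> \<Lambda>' - \<Lambda>" and gu: "1 / Suc i \<le> g (of_int t * (u / real N ^ k'))" for u
        using new[OF u]
      proof
        assume "\<exists>c\<in>C. c \<noteq> 0 \<and> u = clus c"
        then obtain c where c: "c \<in> C" "c \<noteq> 0" "u = clus c" by blast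
        have un: "u / real N ^ k' = of_int c / real N ^ m + of_int (zc0 c)"
          using N_gt c by (simp add: clus_def k'_def zc_def power_add field_simps)
        have "g (of_int t * (u / real N ^ k')) = g (of_int t * (of_int c / real N ^ m))"
          unfolding un by (rule g_eq_of_diff_int) (simp add: algebra_simps)
        then show ?thesis using zc0(2)[OF c(1)] gu unfolding un by (simp add: \<epsilon>_def c0_def)
      next
        assume "\<exists>p\<in>J. u = posf p"
        then show ?thesis using posf gu by (auto simp: \<epsilon>_def c0_def)
      qed
      show "real (card (window x h \<inter> \<Lambda>')) \<le> max (real (card (window x h \<inter> \<Lambda>))) (h powr (s + 1 / Suc j) + ln (2 * h) + 1)"
        if h: "2 \<le> h" for x h
      proof -
        have "0 \<le> h powr (s + \<delta>)" by simp
        then show ?thesis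
          using count[OF h, of x] c_count[OF h, of x] unfolding \<Lambda>' \<delta>_def by linarith
      qed
      \<comment> \<open>The witness is twice the bound of \<open>clus_le\<close>, so that the window
        about \<open>0\<close> contains the entire cluster.\<close>
      show "\<exists>h\<ge>2. real j \<le> h \<and> h powr (s - 1 / Suc j) \<le> real (card (window 0 h \<inter> \<Lambda>'))"
      proof (intro exI[of _ "2 * (real Z + 2) * real N ^ k'"] conjI)
        let ?h = "2 * (real Z + 2) * real N ^ k'"
        have "1 * real N ^ k' \<le> ?h" by (intro mult_right_mono) auto
        then show "2 \<le> ?h" "real j \<le> ?h" using Ssmall(4) Nek by linarith+
        have "A \<subseteq> window 0 ?h \<inter> \<Lambda>'"
        proof
          fix x assume x: "x \<in> A"
          then have "\<bar>x\<bar> < real N ^ k' * (real Z + 2)" using clus_le by (auto simp: A_def)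
          moreover have "?h / 2 = real N ^ k' * (real Z + 2)" by simp
          ultimately have "x \<in> window 0 ?h" unfolding greaterThanLessThan_iff by linarith
          then show "x \<in> window 0 ?h \<inter> \<Lambda>'" using x \<Lambda>' by blast
        qed
        then have "card A \<le> card (window 0 ?h \<inter> \<Lambda>')"
          by (intro card_mono) (use fin finA finJ \<Lambda>' in auto)
        moreover have "card A = card D ^ m"
          unfolding A_def card_image[OF inj_clus] unfolding C_def using card_digit_sums[OF L(1)] L(3) by simp
        ultimately have "real (card D) ^ m \<le> real (card (window 0 ?h \<inter> \<Lambda>'))" by (metis of_nat_le_iff of_nat_power)
        then show "?h powr (s - 1 / Suc j) \<le> real (card (window 0 ?h \<inter> \<Lambda>'))"
          using m(3) unfolding k'_def \<delta>_def by linarith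
      qed
      show "\<bar>v\<bar> < \<bar>u\<bar>" if u: "u \<in> \<Lambda>' - \<Lambda>" and v: "v \<in> \<Lambda>" for u v
        using new_ge[OF u] S[OF v] Ssmall(1) S0 by linarith
    qed
    moreover have "card \<Lambda>' = card \<Lambda> * card D ^ (k' - k)"
      unfolding \<Lambda>'_def card_image[OF ext1] using cardE by (simp add: card_cartesian_product CC_def mm_def)
    moreover have "\<exists>u\<in>\<Lambda>'. b < \<bar>u\<bar>"
    proof (intro bexI[of _ "posf (0, l)"])
      show "b < \<bar>posf (0, l)\<bar>" using posf[OF lJ] by (simp add: b'_def)
    qed (use lJ \<Lambda>' in auto)
    ultimately show ?thesis by blast
  qed
  then show ?thesis by blast
qed

lemma two_steps:
  assumes "0 \<le> s" "s \<le> ln (real (card D)) / ln (real N)"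
    and "finite \<Lambda>" "0 \<in> \<Lambda>" "parseval \<Lambda> k"
  shows "\<exists>X Y. step s j (\<Lambda>, k) X \<and> step s j (\<Lambda>, k) Y \<and> fst X \<noteq> fst Y \<and> card (fst X) = card (fst Y)"
proof -
  obtain k' where k': "\<And>b. \<exists>\<Lambda>'. step s j (\<Lambda>, k) (\<Lambda>', k') \<and> card \<Lambda>' = card \<Lambda> * card D ^ (k' - k) \<and> (\<exists>u\<in>\<Lambda>'. b < \<bar>u\<bar>)"
    using step_exists[OF assms, of j] by blast
  obtain X where X: "step s j (\<Lambda>, k) (X, k')" "card X = card \<Lambda> * card D ^ (k' - k)" using k' by blast
  have finX: "finite X" using X(1) by (simp add: step_def)
  \<comment> \<open>The sum of all moduli of \<open>X\<close> bounds each of its elements, so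
    \<open>Y\<close> is forced to contain a point outside \<open>X\<close>.\<close>
  obtain Y where Y: "step s j (\<Lambda>, k) (Y, k')" "card Y = card \<Lambda> * card D ^ (k' - k)"
    "\<exists>u\<in>Y. (\<Sum>u\<in>X. \<bar>u\<bar>) < \<bar>u\<bar>" using k' by blast
  have "\<bar>u\<bar> \<le> (\<Sum>u\<in>X. \<bar>u\<bar>)" if "u \<in> X" for u using that finX by (intro member_le_sum) auto
  then have "X \<noteq> Y" using Y(3) by force
  then show ?thesis using X Y by (intro exI[of _ "(X, k')"] exI[of _ "(Y, k')"]) auto
qed

end

section \<open>Spectra in the limit\<close>

context spectral_tower
begin

text \<open>Bounded support gives a modulus of continuity that is uniform over the line. It permits
  passing from \<open>t * (u / N ^ k)\<close>, where the construction controls the transform, to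
  \<open>(x + t * u) / N ^ k\<close>, however far away \<open>u\<close> is.\<close>

lemma FT_Lipschitz: "cmod (FT M a - FT M b) \<le> 2 * pi * R * \<bar>a - b\<bar>"
proof -
  have "cmod (FT M a - FT M b) = cmod (LINT x|M. expo a x - expo b x)"
    unfolding FT_def using integrable_expo' by simp
  also have "\<dots> \<le> (LINT x|M. cmod (expo a x - expo b x))" by (rule integral_norm_bound)
  also have "\<dots> \<le> (LINT x|M. 2 * pi * R * \<bar>a - b\<bar>)"
  proof (rule integral_mono_AE)
    show "integrable M (\<lambda>x. cmod (expo a x - expo b x))"
      by (intro integrable_norm Bochner_Integration.integrable_diff integrable_expo')
    show "AE x in M. cmod (expo a x - expo b x) \<le> 2 * pi * R * \<bar>a - b\<bar>"
      using supp
    proof eventually_elim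
      fix x assume x: "\<bar>x\<bar> \<le> R"
      have "expo a x - expo b x = expo b x * (expo (a - b) x - 1)"
        by (simp add: right_diff_distrib expo_add_left[symmetric])
      then have "cmod (expo a x - expo b x) = cmod (expo (a - b) x - 1)" by (simp add: norm_mult)
      also have "\<dots> \<le> \<bar>2 * pi * (a - b) * x\<bar>"
        using iexp_approx1[of "2 * pi * (a - b) * x" 0] by (simp add: expo_def cis_conv_exp)
      also have "\<dots> = 2 * pi * \<bar>a - b\<bar> * \<bar>x\<bar>" by (simp add: abs_mult)
      also have "\<dots> \<le> 2 * pi * \<bar>a - b\<bar> * R" using x by (intro mult_left_mono) auto
      finally show "cmod (expo a x - expo b x) \<le> 2 * pi * R * \<bar>a - b\<bar>" by (simp add: mult_ac)
    qed
  qed simp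
  also have "\<dots> = 2 * pi * R * \<bar>a - b\<bar>" by (simp add: prob_space)
  finally show ?thesis .
qed

text \<open>By periodicity two arguments at distance less than \<open>1\<close> can be moved into
  \<open>{0..2}\<close> by the same integer.\<close>

lemma g_uniform: "uniformly_continuous_on UNIV g"
  unfolding uniformly_continuous_on_def
proof (intro allI impI)
  fix e :: real assume e: "0 < e"
  have "uniformly_continuous_on {0..2} g"
    by (rule compact_uniformly_continuous) (auto intro: continuous_on_subset[OF g_continuous])
  then obtain d where d: "0 < d" "\<And>x y. x \<in> {0..2} \<Longrightarrow> y \<in> {0..2} \<Longrightarrow> dist y x < d \<Longrightarrow> dist (g y) (g x) < e"
    unfolding uniformly_continuous_on_def using e by metis
  show "\<exists>d>0. \<forall>x\<in>UNIV. \<forall>y\<in>UNIV. dist y x < d \<longrightarrow> dist (g y) (g x) < e"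
  proof (intro exI[of _ "min d 1"] conjI ballI impI)
    fix x y :: real assume xy: "dist y x < min d 1"
    define n where "n = \<lfloor>min x y\<rfloor>"
    have "x - of_int n \<in> {0..2}" "y - of_int n \<in> {0..2}"
      using xy unfolding n_def dist_real_def by (auto; linarith)+
    moreover have "dist (y - of_int n) (x - of_int n) < d" using xy by (simp add: dist_real_def)
    ultimately have "dist (g (y - of_int n)) (g (x - of_int n)) < e" using d(2) by blast
    moreover have "g (y - of_int n) = g y" "g (x - of_int n) = g x"
      by (auto intro!: g_eq_of_diff_int)
    ultimately show "dist (g y) (g x) < e" by simp
  qed (use d in auto)
qed

end

section \<open>Completeness of the union of a sequence of stages\<close>

locale tower_sequence = spectral_tower +
  fixes s :: real and st :: "nat \<Rightarrow> real set \<times> nat"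
  assumes st_0: "st 0 = (L0, 0)" and st_step: "step s j (st j) (st (Suc j))"
begin

definition Lam :: "nat \<Rightarrow> real set" where "Lam j = fst (st j)"
definition lev :: "nat \<Rightarrow> nat" where "lev j = snd (st j)"

lemma stepj: "step s j (Lam j, lev j) (Lam (Suc j), lev (Suc j))"
  using st_step[of j] by (simp add: Lam_def lev_def)

lemma finite_Lam: "finite (Lam j)"
proof (cases j)
  case (Suc i)
  then show ?thesis using stepj[of i] by (simp add: step_def)
qed (use st_0 L0 in \<open>simp add: Lam_def\<close>)

lemma parseval_Lam: "parseval (Lam j) (lev j)"
proof (cases j)
  case (Suc i)
  then show ?thesis using stepj[of i] by (simp add: step_def)
qed (use st_0 parseval_base in \<open>simp add: Lam_def lev_def\<close>)

lemma Lam_mono: "i \<le> j \<Longrightarrow> Lam i \<subseteq> Lam j"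
proof (rule lift_Suc_mono_le[of Lam])
  show "Lam n \<subseteq> Lam (Suc n)" for n using stepj[of n] by (simp add: step_def)
qed

lemma lev_ge: "j \<le> lev j"
proof (induction j)
  case (Suc j)
  then show ?case using stepj[of j] by (simp add: step_def)
qed simp

lemma zero_in_Lam: "0 \<in> Lam j"
  using Lam_mono[of 0 j] L0 st_0 by (auto simp: Lam_def)

definition Spec :: "real set" where "Spec = (\<Union>j. Lam j)"

text \<open>Moduli increase from stage to stage, so each stage consists of the elements of smallest
  modulus in the union. This is how the union remembers the choices made.\<close>

lemma new_larger: "u \<in> Spec - Lam j \<Longrightarrow> v \<in> Lam j \<Longrightarrow> \<bar>v\<bar> < \<bar>u\<bar>"
proof -
  assume u: "u \<in> Spec - Lam j" and v: "v \<in> Lam j"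
  define n where "n = (LEAST n. u \<in> Lam n)"
  obtain n' where "u \<in> Lam n'" using u by (auto simp: Spec_def)
  then have un: "u \<in> Lam n" unfolding n_def by (rule LeastI)
  have jn: "j < n" using un u Lam_mono[of n j] by (metis DiffD2 not_less subsetD)
  have "u \<notin> Lam (n - 1)" using not_less_Least[of "n - 1" "\<lambda>n. u \<in> Lam n"] jn unfolding n_def by auto
  moreover have "j \<le> n - 1" using jn by linarith
  then have "v \<in> Lam (n - 1)" using Lam_mono v by blast
  moreover have "Suc (n - 1) = n" using jn by simp
  ultimately show ?thesis using stepj[of "n - 1"] un by (auto simp: step_def)
qed

text \<open>If a positive defect persisted, the elements added at the infinitely many stages devoted to \<open>t\<close>
  and to a small threshold \<open>1 / Suc i\<close> would each time carry a fixed proportion of it.\<close>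

lemma frame_sum:
  assumes t: "t \<in> T" and \<eta>: "0 < \<eta>"
  shows "\<exists>j. 1 - \<eta> < (\<Sum>u\<in>Lam j. (cmod (FT M (x + of_int t * u)))\<^sup>2)"
proof (rule ccontr)
  assume contra: "\<not> ?thesis"
  define S where "S = (\<lambda>j. \<Sum>u\<in>Lam j. (cmod (FT M (x + of_int t * u)))\<^sup>2)"
  have Sle: "S j \<le> 1 - \<eta>" for j using contra by (auto simp: S_def not_less)
  have S0: "0 \<le> S j" for j by (simp add: S_def sum_nonneg)
  have \<eta>1: "\<eta> \<le> 1" using Sle[of 0] S0[of 0] by linarith
  have inc: "incseq S"
    unfolding S_def by (rule incseq_SucI, rule sum_mono2[OF finite_Lam]) (use Lam_mono[of _ "Suc _"] in auto)
  have "\<exists>l. S \<longlonglongrightarrow> l"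
  proof (rule incseq_convergent[OF inc, of "1 - \<eta>"])
    show "\<forall>i. S i \<le> 1 - \<eta>" using Sle by blast
  qed blast
  then obtain l where "S \<longlonglongrightarrow> l" by blast
  then have "(\<lambda>j. S (Suc j) - S j) \<longlonglongrightarrow> l - l" by (intro tendsto_diff LIMSEQ_Suc)
  then have diff0: "(\<lambda>j. S (Suc j) - S j) \<longlonglongrightarrow> 0" by simp
  \<comment> \<open>The threshold is so small that elements below twice its value carry at most
    \<open>\<eta> / 4\<close> of the Parseval sum.\<close>
  obtain i :: nat where i: "2 * P / real (Suc i) \<le> \<eta> / 4"
  proof -
    obtain i :: nat where "8 * P / \<eta> < real i" using reals_Archimedean2 by blast
    then have "8 * P \<le> \<eta> * real (Suc i)" using \<eta> P_nonneg by (simp add: field_simps)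
    then have "2 * P / real (Suc i) \<le> \<eta> / 4" by (simp add: field_simps)
    then show ?thesis using that by blast
  qed
  define \<epsilon> where "\<epsilon> = 1 / real (Suc i)"
  have e: "0 < \<epsilon>" by (simp add: \<epsilon>_def)
  define c where "c = lower t i"
  have c: "0 < c" using good_lower[OF t, of i] by (auto simp: c_def good_def)
  obtain \<rho> where \<rho>: "0 < \<rho>" "\<And>a b. \<bar>a - b\<bar> < \<rho> \<Longrightarrow> \<bar>g a - g b\<bar> < \<epsilon>"
    using g_uniform e unfolding uniformly_continuous_on_def dist_real_def by (metis UNIV_I)
  have xN: "(\<lambda>j. y / real N ^ lev (Suc j)) \<longlonglongrightarrow> 0" for y
  proof (rule filterlim_compose[OF inverse_power_tendsto])
    show "filterlim (\<lambda>j. lev (Suc j)) at_top sequentially"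
      by (rule filterlim_at_top_mono[OF filterlim_Suc]) (use lev_ge in auto)
  qed
  \<comment> \<open>Old elements divided by \<open>N ^ k\<close> come close to \<open>0\<close>,
    where the squared transform exceeds \<open>\<theta>\<close>; they realise their Parseval weight
    up to this factor.\<close>
  define \<theta> where "\<theta> = 1 - \<eta> / 2"
  have \<theta>: "\<theta> < 1" "0 \<le> \<theta>" using \<eta> \<eta>1 by (simp_all add: \<theta>_def)
  have "\<forall>\<^sub>F y in nhds 0. \<theta> < (cmod (FT M y))\<^sup>2"
  proof (rule order_tendstoD(1))
    show "((\<lambda>y. (cmod (FT M y))\<^sup>2) \<longlongrightarrow> (cmod (FT M 0))\<^sup>2) (nhds 0)"
      by (intro tendsto_power tendsto_norm) (use isCont_FT[of 0] in \<open>simp add: continuous_at tendsto_at_iff_tendsto_nhds\<close>)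
  qed (use \<theta> FT_zero in simp)
  then obtain \<sigma> where \<sigma>: "0 < \<sigma>" "\<And>y. \<bar>y\<bar> < \<sigma> \<Longrightarrow> \<theta> < (cmod (FT M y))\<^sup>2"
    unfolding eventually_nhds_metric dist_real_def by auto
  have "(\<lambda>j. \<bar>x\<bar> / real N ^ lev (Suc j) + \<bar>real_of_int t\<bar> * inverse (real (Suc j))) \<longlonglongrightarrow> 0 + \<bar>real_of_int t\<bar> * 0"
    by (intro tendsto_intros xN LIMSEQ_inverse_real_of_nat)
  then have ev1: "\<forall>\<^sub>F j in sequentially. \<bar>x\<bar> / real N ^ lev (Suc j) + \<bar>real_of_int t\<bar> * inverse (real (Suc j)) < \<sigma>"
    by (rule order_tendstoD(2)) (use \<sigma> in simp)
  have ev2: "\<forall>\<^sub>F j in sequentially. \<bar>x\<bar> / real N ^ lev (Suc j) < \<rho>"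
    by (rule order_tendstoD(2)[OF xN \<rho>(1)])
  have "(\<lambda>j. 2 * pi * R * (\<bar>x\<bar> / real N ^ lev (Suc j))) \<longlonglongrightarrow> 2 * pi * R * 0"
    by (intro tendsto_intros xN)
  then have ev3: "\<forall>\<^sub>F j in sequentially. 2 * pi * R * (\<bar>x\<bar> / real N ^ lev (Suc j)) < c / 2"
    by (rule order_tendstoD(2)) (use c in simp)
  have ev4: "\<forall>\<^sub>F j in sequentially. S (Suc j) - S j < c\<^sup>2 * \<eta> / 16"
    by (rule order_tendstoD(2)[OF diff0]) (use c \<eta> in simp)
  obtain n where n: "\<And>j. n \<le> j \<Longrightarrow> (\<bar>x\<bar> / real N ^ lev (Suc j) + \<bar>real_of_int t\<bar> * inverse (real (Suc j)) < \<sigma>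
      \<and> \<bar>x\<bar> / real N ^ lev (Suc j) < \<rho>) \<and> (2 * pi * R * (\<bar>x\<bar> / real N ^ lev (Suc j)) < c / 2 \<and> S (Suc j) - S j < c\<^sup>2 * \<eta> / 16)"
    using eventually_conj[OF eventually_conj[OF ev1 ev2] eventually_conj[OF ev3 ev4]]
    unfolding eventually_sequentially by blast
  obtain j where j: "n \<le> j" "schedule j = (t, i)" using schedule_recurs[OF t] by blast
  define k where "k = lev (Suc j)"
  have nj: "\<bar>x\<bar> / real N ^ k + \<bar>real_of_int t\<bar> * inverse (real (Suc j)) < \<sigma>"
    "\<bar>x\<bar> / real N ^ k < \<rho>" "2 * pi * R * (\<bar>x\<bar> / real N ^ k) < c / 2" "S (Suc j) - S j < c\<^sup>2 * \<eta> / 16"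
    using n[OF j(1)] unfolding k_def by blast+
  have Nk: "0 < real N ^ k" using N_gt by simp
  have st: "\<forall>u\<in>Lam j. \<bar>u\<bar> * real (Suc j) \<le> real N ^ k"
    "\<forall>u\<in>Lam (Suc j) - Lam j. \<epsilon> \<le> g (of_int t * (u / real N ^ k)) \<longrightarrow> c \<le> cmod (FT M (of_int t * (u / real N ^ k)))"
    "\<forall>x. (\<Sum>u\<in>Lam (Suc j). (cmod (digit_mask_prod N D k (x + of_int t * u)))\<^sup>2) \<le> P"
    using stepj[of j] t unfolding step_def case_prod_conv j(2) fst_conv snd_conv k_def[symmetric] \<epsilon>_def c_def by blast+
  let ?H = "\<lambda>u. (cmod (digit_mask_prod N D k (x + of_int t * u)))\<^sup>2"
  let ?g = "\<lambda>u. g ((x + of_int t * u) / real N ^ k)"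
  have FTsq: "(cmod (FT M (x + of_int t * u)))\<^sup>2 = ?H u * (cmod (FT M ((x + of_int t * u) / real N ^ k)))\<^sup>2" for u
    using FT_prod[of "x + of_int t * u" k] by (simp add: norm_mult power_mult_distrib)
  have par: "(\<Sum>u\<in>Lam (Suc j). ?H u * ?g u) = 1"
    using parseval_Lam[of "Suc j"] t unfolding parseval_def weight_def k_def by blast
  have sub: "Lam j \<subseteq> Lam (Suc j)" by (rule Lam_mono) simp
  \<comment> \<open>The old weight \<open>W\<close> satisfies
    \<open>\<theta> * W \<le> S j \<le> 1 - \<eta>\<close> and
    \<open>(1 - \<theta>) * W \<le> \<eta> / 2\<close>. At least \<open>\<eta> / 2\<close> of the
    Parseval sum therefore falls on the new elements.\<close>
  have old: "(\<Sum>u\<in>Lam j. ?H u * ?g u) \<le> 1 - \<eta> / 2"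
  proof -
    have "\<theta> * (\<Sum>u\<in>Lam j. ?H u * ?g u) \<le> S j"
      unfolding S_def sum_distrib_left
    proof (rule sum_mono)
      fix u assume u: "u \<in> Lam j"
      have "\<bar>u\<bar> \<le> real N ^ k * inverse (real (Suc j))"
        using st(1) u by (simp add: field_simps)
      then have "\<bar>of_int t * u\<bar> \<le> \<bar>real_of_int t\<bar> * (real N ^ k * inverse (real (Suc j)))"
        unfolding abs_mult by (intro mult_left_mono) auto
      then have "\<bar>of_int t * u\<bar> / real N ^ k \<le> \<bar>real_of_int t\<bar> * inverse (real (Suc j))"
        using Nk by (simp add: divide_le_eq mult_ac)
      moreover have "\<bar>(x + of_int t * u) / real N ^ k\<bar> \<le> \<bar>x\<bar> / real N ^ k + \<bar>of_int t * u\<bar> / real N ^ k"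
      proof -
        have "\<bar>x + of_int t * u\<bar> / real N ^ k \<le> (\<bar>x\<bar> + \<bar>of_int t * u\<bar>) / real N ^ k"
          using Nk by (intro divide_right_mono) auto
        moreover have "\<bar>(x + of_int t * u) / real N ^ k\<bar> = \<bar>x + of_int t * u\<bar> / real N ^ k"
          using Nk by (simp only: abs_divide abs_of_pos)
        ultimately show ?thesis by (simp only: add_divide_distrib)
      qed
      ultimately have "\<bar>(x + of_int t * u) / real N ^ k\<bar> < \<sigma>" using nj by linarith
      then have "\<theta> \<le> (cmod (FT M ((x + of_int t * u) / real N ^ k)))\<^sup>2" using \<sigma>(2) by fastforce
      moreover have "?g u * \<theta> \<le> \<theta>" using g_le_1 g_nonneg \<theta> by (simp add: mult_left_le_one_le)
      ultimately have "?g u * \<theta> \<le> (cmod (FT M ((x + of_int t * u) / real N ^ k)))\<^sup>2" by linarith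
      then have "?H u * (?g u * \<theta>) \<le> ?H u * (cmod (FT M ((x + of_int t * u) / real N ^ k)))\<^sup>2"
        by (intro mult_left_mono) auto
      then show "\<theta> * (?H u * ?g u) \<le> (cmod (FT M (x + of_int t * u)))\<^sup>2"
        unfolding FTsq by (simp add: mult_ac)
    qed
    then have "\<theta> * (\<Sum>u\<in>Lam j. ?H u * ?g u) \<le> 1 - \<eta>" using Sle[of j] by linarith
    moreover have "(\<Sum>u\<in>Lam j. ?H u * ?g u) \<le> 1"
      unfolding par[symmetric] by (rule sum_mono2[OF finite_Lam sub]) (simp add: g_nonneg)
    then have "\<eta> / 2 * (\<Sum>u\<in>Lam j. ?H u * ?g u) \<le> \<eta> / 2 * 1" using \<eta> by (intro mult_left_mono) auto
    ultimately show ?thesis unfolding \<theta>_def left_diff_distrib by linarith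
  qed
  define New where "New = Lam (Suc j) - Lam j"
  have finNew: "finite New" using finite_Lam by (simp add: New_def)
  have "(\<Sum>u\<in>Lam (Suc j). ?H u * ?g u) = (\<Sum>u\<in>New. ?H u * ?g u) + (\<Sum>u\<in>Lam j. ?H u * ?g u)"
    unfolding New_def by (rule sum.subset_diff[OF sub finite_Lam])
  then have new: "\<eta> / 2 \<le> (\<Sum>u\<in>New. ?H u * ?g u)" using old par by linarith
  \<comment> \<open>An element with \<open>g\<close> below \<open>2 * \<epsilon>\<close> makes its
    term on the left nonpositive. For the others uniform continuity gives \<open>g\<close> at least
    \<open>\<epsilon>\<close> at \<open>t * (u / N ^ k)\<close>, hence a transform of modulus at
    least \<open>c\<close> there and at least \<open>c / 2\<close> at the nearby point.\<close>
  have "c\<^sup>2 / 4 * ((\<Sum>u\<in>New. ?H u * ?g u) - 2 * \<epsilon> * (\<Sum>u\<in>New. ?H u)) \<le> (\<Sum>u\<in>New. (cmod (FT M (x + of_int t * u)))\<^sup>2)"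
    unfolding sum_distrib_left sum_subtractf[symmetric]
  proof (rule sum_mono)
    fix u assume u: "u \<in> New"
    let ?v = "(x + of_int t * u) / real N ^ k"
    show "c\<^sup>2 / 4 * (?H u * ?g u - 2 * \<epsilon> * ?H u) \<le> (cmod (FT M (x + of_int t * u)))\<^sup>2"
    proof (cases "2 * \<epsilon> \<le> ?g u")
      case False
      then have "?H u * ?g u \<le> ?H u * (2 * \<epsilon>)" by (intro mult_left_mono) auto
      then have "c\<^sup>2 / 4 * (?H u * ?g u - 2 * \<epsilon> * ?H u) \<le> 0"
        by (intro mult_nonneg_nonpos) (auto simp: mult_ac)
      then show ?thesis by (rule order_trans) simp
    next
      case True
      have vd: "?v - of_int t * (u / real N ^ k) = x / real N ^ k" by (simp add: add_divide_distrib)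
      then have "\<bar>?v - of_int t * (u / real N ^ k)\<bar> < \<rho>" using nj(2) Nk by (simp add: abs_divide)
      from \<rho>(2)[OF this] have "\<epsilon> \<le> g (of_int t * (u / real N ^ k))" using True by linarith
      then have cF: "c \<le> cmod (FT M (of_int t * (u / real N ^ k)))" using st(2) u by (simp add: New_def)
      have "cmod (FT M (of_int t * (u / real N ^ k)) - FT M ?v) \<le> 2 * pi * R * \<bar>of_int t * (u / real N ^ k) - ?v\<bar>"
        by (rule FT_Lipschitz)
      also have "\<bar>of_int t * (u / real N ^ k) - ?v\<bar> = \<bar>x\<bar> / real N ^ k"
        using vd Nk by (metis abs_divide abs_minus_commute abs_of_pos)
      finally have "cmod (FT M (of_int t * (u / real N ^ k)) - FT M ?v) < c / 2" using nj by linarith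
      then have "c / 2 \<le> cmod (FT M ?v)"
        using cF norm_triangle_ineq2[of "FT M (of_int t * (u / real N ^ k))" "FT M ?v"] by linarith
      then have "(c / 2)\<^sup>2 \<le> (cmod (FT M ?v))\<^sup>2" using c by (intro power_mono) auto
      then have c4: "?H u * (c\<^sup>2 / 4) \<le> ?H u * (cmod (FT M ?v))\<^sup>2"
        by (intro mult_left_mono) (auto simp: power_divide)
      have "?H u * ?g u \<le> ?H u * 1" by (intro mult_left_mono g_le_1) simp
      moreover have "0 \<le> 2 * \<epsilon> * ?H u" using e by simp
      ultimately have "?H u * ?g u - 2 * \<epsilon> * ?H u \<le> ?H u" by linarith
      then have "c\<^sup>2 / 4 * (?H u * ?g u - 2 * \<epsilon> * ?H u) \<le> c\<^sup>2 / 4 * ?H u" by (intro mult_left_mono) auto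
      then show ?thesis using c4 unfolding FTsq by (simp add: mult_ac)
    qed
  qed
  moreover have "(\<Sum>u\<in>New. (cmod (FT M (x + of_int t * u)))\<^sup>2) = S (Suc j) - S j"
    unfolding S_def New_def using sum.subset_diff[OF sub finite_Lam, of "\<lambda>u. (cmod (FT M (x + of_int t * u)))\<^sup>2"] by simp
  moreover have "\<eta> / 4 \<le> (\<Sum>u\<in>New. ?H u * ?g u) - 2 * \<epsilon> * (\<Sum>u\<in>New. ?H u)"
  proof -
    have "(\<Sum>u\<in>New. ?H u) \<le> (\<Sum>u\<in>Lam (Suc j). ?H u)"
      by (rule sum_mono2[OF finite_Lam]) (auto simp: New_def)
    then have "(\<Sum>u\<in>New. ?H u) \<le> P" using st(3) by (meson order_trans)
    then have "2 * \<epsilon> * (\<Sum>u\<in>New. ?H u) \<le> 2 * \<epsilon> * P" using e by (intro mult_left_mono) auto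
    also have "\<dots> \<le> \<eta> / 4" using i by (simp add: \<epsilon>_def)
    finally show ?thesis using new by linarith
  qed
  \<comment> \<open>A gain of \<open>c\<^sup>2 * \<eta> / 16\<close> at stage \<open>j\<close>
    contradicts the convergence of \<open>S\<close>.\<close>
  then have "c\<^sup>2 / 4 * (\<eta> / 4) \<le> c\<^sup>2 / 4 * ((\<Sum>u\<in>New. ?H u * ?g u) - 2 * \<epsilon> * (\<Sum>u\<in>New. ?H u))"
    by (intro mult_left_mono) auto
  ultimately show False using nj by simp
qed

lemma spectrum_dilate:
  assumes t: "t \<in> T"
  shows "is_spectrum M (real_of_int t *o Spec)"
proof (rule is_spectrumI[OF supp])
  have eq: "real_of_int t *o Spec = (\<Union>j. (\<lambda>u. of_int t * u) ` Lam j)"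
    by (auto simp: elt_set_times_def Spec_def)
  show "countable (real_of_int t *o Spec)"
    unfolding eq by (rule countable_UN[OF _ countable_image[OF countable_finite[OF finite_Lam]]]) simp
  fix \<xi> \<xi>' assume xi: "\<xi> \<in> real_of_int t *o Spec" "\<xi>' \<in> real_of_int t *o Spec" "\<xi> \<noteq> \<xi>'"
  then obtain i j u v where uv: "u \<in> Lam i" "v \<in> Lam j" "\<xi> = of_int t * u" "\<xi>' = of_int t * v"
    unfolding eq by auto
  then have "u \<in> Lam (max i j)" "v \<in> Lam (max i j)" using Lam_mono[of i "max i j"] Lam_mono[of j "max i j"] by auto
  then show "FT M (\<xi> - \<xi>') = 0"
    using parseval_orthogonal[OF finite_Lam parseval_Lam t, of u "max i j" v] uv xi(3) by auto
next
  fix \<eta> \<epsilon> :: real assume "0 < \<epsilon>"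
  from frame_sum[OF t this, of "- \<eta>"] obtain j where
    j: "1 - \<epsilon> < (\<Sum>u\<in>Lam j. (cmod (FT M (- \<eta> + of_int t * u)))\<^sup>2)" by blast
  have inj: "inj_on (\<lambda>u. of_int t * u) (Lam j)" using T_nonzero[OF t] by (auto simp: inj_on_def)
  have "cmod (FT M (\<eta> - of_int t * u)) = cmod (FT M (- \<eta> + of_int t * u))" for u
    using FT_minus[of M "- \<eta> + of_int t * u"] by (simp add: complex_mod_cnj)
  then have "1 - \<epsilon> < (\<Sum>\<xi>\<in>(\<lambda>u. of_int t * u) ` Lam j. (cmod (FT M (\<eta> - \<xi>)))\<^sup>2)"
    using j by (simp add: sum.reindex[OF inj])
  moreover have "(\<lambda>u. of_int t * u) ` Lam j \<subseteq> real_of_int t *o Spec"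
    by (auto simp: elt_set_times_def Spec_def)
  ultimately show "\<exists>F. finite F \<and> F \<subseteq> real_of_int t *o Spec \<and> 1 - \<epsilon> < (\<Sum>\<xi>\<in>F. (cmod (FT M (\<eta> - \<xi>)))\<^sup>2)"
    by (intro exI[of _ "(\<lambda>u. of_int t * u) ` Lam j"] conjI finite_imageI finite_Lam)
qed

lemma Spec_in_V: "Spec \<in> V M (real_of_int ` T)"
proof -
  have "real_of_int 1 *o Spec = Spec" by (auto simp: elt_set_times_def)
  then have "is_spectrum M Spec" using spectrum_dilate[OF one_in_T] by simp
  then show ?thesis using spectrum_dilate by (auto simp: V_def)
qed

end

section \<open>Beurling dimension and cardinality\<close>

lemma beurling_dim_leI:
  assumes "\<And>\<eta>. 0 < \<eta> \<Longrightarrow> \<forall>\<^sub>F h in at_top. \<forall>x. finite (\<Lambda> \<inter> window x h) \<and> real (card (\<Lambda> \<inter> window x h)) \<le> h powr (s + \<eta>)"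
  shows "beurling_dim \<Lambda> \<le> ereal s"
proof (rule ereal_le_epsilon2)
  fix \<eta> :: real assume "0 < \<eta>"
  from assms[OF this] have "\<forall>\<^sub>F h in at_top. (SUP x. log_card (\<Lambda> \<inter> window x h) / ereal (ln h)) \<le> ereal (s + \<eta>)"
    using eventually_gt_at_top[of 1]
  proof eventually_elim
    case (elim h)
    have l: "0 < ln h" using elim by simp
    show ?case
    proof (rule SUP_least)
      fix x
      let ?S = "\<Lambda> \<inter> window x h"
      show "log_card ?S / ereal (ln h) \<le> ereal (s + \<eta>)"
      proof (cases "?S = {}")
        case True
        then show ?thesis using l by (simp add: log_card_def)
      next
        case False
        then have pos: "0 < real (card ?S)" using elim by (auto simp: card_gt_0_iff)
        have "ln (real (card ?S)) \<le> ln (h powr (s + \<eta>))"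
          using elim pos by (intro ln_mono) auto
        also have "\<dots> = (s + \<eta>) * ln h" using elim by (simp add: ln_powr)
        finally have "ln (real (card ?S)) / ln h \<le> s + \<eta>" using l by (simp add: divide_le_eq)
        then show ?thesis using False elim l by (simp add: log_card_def)
      qed
    qed
  qed
  then show "beurling_dim \<Lambda> \<le> ereal s + ereal \<eta>"
    unfolding beurling_dim_def by (simp add: Limsup_bounded)
qed

lemma beurling_dim_geI:
  assumes "\<And>\<eta> H. 0 < \<eta> \<Longrightarrow> \<exists>h\<ge>H. 1 < h \<and> (\<exists>x. finite (\<Lambda> \<inter> window x h) \<and> h powr (s - \<eta>) \<le> real (card (\<Lambda> \<inter> window x h)))"
  shows "ereal s \<le> beurling_dim \<Lambda>"
proof (rule ereal_le_epsilon2)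
  fix \<eta> :: real assume \<eta>: "0 < \<eta>"
  let ?f = "\<lambda>h. SUP x. log_card (\<Lambda> \<inter> window x h) / ereal (ln h)"
  have "ereal (s - \<eta>) \<le> beurling_dim \<Lambda>"
    unfolding beurling_dim_def Limsup_def
  proof (rule INF_greatest)
    fix P :: "real \<Rightarrow> bool" assume "P \<in> {P. eventually P at_top}"
    then obtain H where H: "\<And>h. H \<le> h \<Longrightarrow> P h" by (auto simp: eventually_at_top_linorder)
    obtain h x where h: "H \<le> h" "1 < h" "finite (\<Lambda> \<inter> window x h)" "h powr (s - \<eta>) \<le> real (card (\<Lambda> \<inter> window x h))"
      using assms[OF \<eta>] by metis
    let ?S = "\<Lambda> \<inter> window x h"
    have l: "0 < ln h" using h by simp
    have "0 < h powr (s - \<eta>)" using h by simp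
    then have "ln (h powr (s - \<eta>)) \<le> ln (real (card ?S))" using h by (intro ln_mono) auto
    then have "(s - \<eta>) * ln h \<le> ln (real (card ?S))" using h by (simp add: ln_powr)
    then have "s - \<eta> \<le> ln (real (card ?S)) / ln h" using l by (simp add: le_divide_eq)
    moreover have "?S \<noteq> {}" using h(4) \<open>0 < h powr (s - \<eta>)\<close> by auto
    ultimately have "ereal (s - \<eta>) \<le> log_card ?S / ereal (ln h)" using h l by (simp add: log_card_def)
    also have "\<dots> \<le> ?f h" by (rule SUP_upper) simp
    also have "\<dots> \<le> Sup (?f ` Collect P)" using H h(1) by (intro SUP_upper) simp
    finally show "ereal (s - \<eta>) \<le> Sup (?f ` Collect P)" .
  qed
  then show "ereal s \<le> beurling_dim \<Lambda> + ereal \<eta>"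
    by (cases "beurling_dim \<Lambda>") auto
qed

section \<open>Dimension of the union\<close>

context tower_sequence
begin

text \<open>The bound for each stage is a maximum and not a sum, so nothing accumulates; from stage
  \<open>J\<close> on all exponents are at most \<open>s + 1 / Suc J\<close>.\<close>

lemma card_window_Lam:
  assumes "J \<le> n" "2 \<le> h"
  shows "real (card (window x h \<inter> Lam n)) \<le> max (real (card (Lam J))) (h powr (s + 1 / Suc J) + ln (2 * h) + 1)"
  using assms(1)
proof (induction n rule: dec_induct)
  case base
  have "card (window x h \<inter> Lam J) \<le> card (Lam J)" by (intro card_mono finite_Lam) auto
  then show ?case by simp
next
  case (step n)
  have "1 / real (Suc n) \<le> 1 / real (Suc J)" using step.hyps by (simp add: field_simps)
  then have "h powr (s + 1 / Suc n) \<le> h powr (s + 1 / Suc J)" using assms(2) by (intro powr_mono) auto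
  moreover have "real (card (window x h \<inter> Lam (Suc n)))
      \<le> max (real (card (window x h \<inter> Lam n))) (h powr (s + 1 / Suc n) + ln (2 * h) + 1)"
    using stepj[of n] assms(2) unfolding step_def case_prod_conv by blast
  ultimately show ?case using step.IH by linarith
qed

text \<open>Every finite part of the union lies in a single stage, so the bound for stages passes to
  the union and makes its windows finite.\<close>

lemma card_window_Spec:
  assumes "2 \<le> h"
  shows "finite (Spec \<inter> window x h) \<and>
    real (card (Spec \<inter> window x h)) \<le> max (real (card (Lam J))) (h powr (s + 1 / Suc J) + ln (2 * h) + 1)"
proof -
  define b where "b = max (real (card (Lam J))) (h powr (s + 1 / Suc J) + ln (2 * h) + 1)"
  have fin: "real (card F) \<le> b" if F: "finite F" "F \<subseteq> Spec \<inter> window x h" for F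
  proof -
    have "\<exists>n\<ge>J. F \<subseteq> Lam n" using F
    proof (induction F rule: finite_induct)
      case (insert u F)
      then obtain n m where "J \<le> n" "F \<subseteq> Lam n" "u \<in> Lam m" by (auto simp: Spec_def)
      then have "insert u F \<subseteq> Lam (max n m)" "J \<le> max n m"
        using Lam_mono[of n "max n m"] Lam_mono[of m "max n m"] by auto
      then show ?case by blast
    qed auto
    then obtain n where n: "J \<le> n" "F \<subseteq> Lam n" by blast
    have "card F \<le> card (window x h \<inter> Lam n)" using n F finite_Lam by (intro card_mono) auto
    then show ?thesis using card_window_Lam[OF n(1) assms, of x] unfolding b_def by linarith
  qed
  have "finite (Spec \<inter> window x h)"
  proof (rule ccontr)
    assume "infinite (Spec \<inter> window x h)"
    then obtain F where F: "finite F" "card F = nat \<lceil>b\<rceil> + 1" "F \<subseteq> Spec \<inter> window x h"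
      using infinite_arbitrarily_large by blast
    then have "real (nat \<lceil>b\<rceil> + 1) \<le> b" using fin[of F] by simp
    then show False by linarith
  qed
  then show ?thesis using fin[of "Spec \<inter> window x h"] unfolding b_def by blast
qed

lemma beurling_dim_Spec:
  assumes s: "0 \<le> s"
  shows "beurling_dim Spec = ereal s"
proof (rule antisym)
  show "beurling_dim Spec \<le> ereal s"
  proof (rule beurling_dim_leI)
    fix \<eta> :: real assume \<eta>: "0 < \<eta>"
    obtain J where J: "1 / real (Suc J) < \<eta>" using nat_approx_posE[OF \<eta>] by blast
    define a where "a = s + 1 / real (Suc J)"
    define b where "b = s + \<eta>"
    have ab: "0 < a" "a < b" using J s by (auto simp: a_def b_def add_nonneg_pos)
    define C where "C = real (card (Lam J))"
    have "\<forall>\<^sub>F h::real in at_top. h powr a + ln (2 * h) + 1 \<le> h powr b" using ab by real_asymp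
    moreover have "\<forall>\<^sub>F h::real in at_top. C \<le> h powr b" using ab by real_asymp
    ultimately show "\<forall>\<^sub>F h in at_top. \<forall>x. finite (Spec \<inter> window x h) \<and> real (card (Spec \<inter> window x h)) \<le> h powr (s + \<eta>)"
      using eventually_ge_at_top[of 2]
    proof eventually_elim
      case (elim h)
      then show ?case using card_window_Spec[of h _ J] unfolding a_def b_def C_def by (meson max.boundedI order_trans)
    qed
  qed
  show "ereal s \<le> beurling_dim Spec"
  proof (rule beurling_dim_geI)
    fix \<eta> H :: real assume \<eta>: "0 < \<eta>"
    obtain J where J: "1 / real (Suc J) < \<eta>" using nat_approx_posE[OF \<eta>] by blast
    define j where "j = max J (nat \<lceil>H\<rceil>)"
    have "1 / real (Suc j) \<le> 1 / real (Suc J)" by (simp add: j_def field_simps)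
    then have j: "1 / real (Suc j) < \<eta>" "H \<le> real j" using J by (auto simp: j_def) linarith+
    obtain h where h: "2 \<le> h" "real j \<le> h" "h powr (s - 1 / Suc j) \<le> real (card (window 0 h \<inter> Lam (Suc j)))"
      using stepj[of j] unfolding step_def case_prod_conv by blast
    have fin: "finite (Spec \<inter> window 0 h)" using card_window_Spec[OF h(1)] by blast
    have "card (window 0 h \<inter> Lam (Suc j)) \<le> card (Spec \<inter> window 0 h)"
      by (rule card_mono[OF fin]) (auto simp: Spec_def)
    moreover have "h powr (s - \<eta>) \<le> h powr (s - 1 / Suc j)" using h j by (intro powr_mono) auto
    ultimately have "h powr (s - \<eta>) \<le> real (card (Spec \<inter> window 0 h))" using h(3) by linarith
    then show "\<exists>h\<ge>H. 1 < h \<and> (\<exists>x. finite (Spec \<inter> window x h) \<and> h powr (s - \<eta>) \<le> real (card (Spec \<inter> window x h)))"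
      using h(1,2) j fin by (intro exI[of _ h] conjI exI[of _ 0]) linarith+
  qed
qed

lemma Spec_in_V_dim: "0 \<le> s \<Longrightarrow> Spec \<in> V_dim s M (real_of_int ` T)"
  using Spec_in_V beurling_dim_Spec by (simp add: V_dim_def)

lemma zero_in_Spec: "0 \<in> Spec"
  using zero_in_Lam[of 0] by (auto simp: Spec_def)

end

section \<open>Binary choices at every stage\<close>

context spectral_tower
begin

text \<open>Where two choice sequences first differ, the stages \<open>X\<close> and
  \<open>Y\<close> are distinct of equal cardinality, so each has an element that the other lacks.
  If the unions agreed, each of the two elements would join after the other's stage and so have the
  larger modulus.\<close>

lemma continuum_of_spectra:
  assumes s: "0 \<le> s" "s \<le> ln (real (card D)) / ln (real N)"
  shows "\<exists>f::(nat \<Rightarrow> bool) \<Rightarrow> real set. inj f \<and> (\<forall>\<theta>. f \<theta> \<in> V_dim s M (real_of_int ` T) \<and> 0 \<in> f \<theta>)"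
proof -
  define valid where "valid = (\<lambda>X. finite (fst X) \<and> 0 \<in> fst X \<and> parseval (fst X) (snd X))"
  have "\<exists>Y Z. valid X \<longrightarrow> step s j X Y \<and> step s j X Z \<and> fst Y \<noteq> fst Z \<and> card (fst Y) = card (fst Z)" for j X
    using two_steps[OF s, of "fst X" "snd X" j] by (auto simp: valid_def)
  then have "\<forall>p. \<exists>q. valid (snd p) \<longrightarrow> step s (fst p) (snd p) (fst q) \<and> step s (fst p) (snd p) (snd q)
      \<and> fst (fst q) \<noteq> fst (snd q) \<and> card (fst (fst q)) = card (fst (snd q))" by simp
  from choice[OF this] obtain Q where Q: "\<And>p. valid (snd p) \<Longrightarrow> step s (fst p) (snd p) (fst (Q p)) \<and> step s (fst p) (snd p) (snd (Q p))
      \<and> fst (fst (Q p)) \<noteq> fst (snd (Q p)) \<and> card (fst (fst (Q p))) = card (fst (snd (Q p)))" by blast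
  define F where "F = (\<lambda>j X. fst (Q (j, X)))"
  define G where "G = (\<lambda>j X. snd (Q (j, X)))"
  have FG: "step s j X (F j X)" "step s j X (G j X)" "fst (F j X) \<noteq> fst (G j X)" "card (fst (F j X)) = card (fst (G j X))"
    if "valid X" for j X
    using Q[of "(j, X)"] that by (simp_all add: F_def G_def)
  define st where "st = (\<lambda>\<theta>. rec_nat (L0, 0::nat) (\<lambda>j X. if \<theta> j then F j X else G j X))"
  have st0: "st \<theta> 0 = (L0, 0)" and stS: "st \<theta> (Suc j) = (if \<theta> j then F j (st \<theta> j) else G j (st \<theta> j))" for \<theta> j
    by (simp_all add: st_def)
  have valid_st: "valid (st \<theta> j)" for \<theta> j
  proof (induction j)
    case 0
    then show ?case using L0 parseval_base by (simp add: st0 valid_def)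
  next
    case (Suc j)
    then have "step s j (st \<theta> j) (st \<theta> (Suc j))" using FG by (simp add: stS)
    then show ?case using Suc by (auto simp: step_def valid_def split: prod.splits)
  qed
  have ts: "tower_sequence M N D L g L0 T r P R s (st \<theta>)" for \<theta>
  proof
    show "st \<theta> 0 = (L0, 0)" by (rule st0)
    show "step s j (st \<theta> j) (st \<theta> (Suc j))" for j using valid_st FG by (simp add: stS)
  qed
  define f where "f = (\<lambda>\<theta>. \<Union>j. fst (st \<theta> j))"
  have f: "f \<theta> = tower_sequence.Spec (st \<theta>)" for \<theta>
    using tower_sequence.Spec_def[OF ts] tower_sequence.Lam_def[OF ts] by (simp add: f_def)
  have "inj f"
  proof (rule injI, rule ccontr)
    fix \<theta> \<theta>' assume eq: "f \<theta> = f \<theta>'" and ne: "\<theta> \<noteq> \<theta>'"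
    define j where "j = (LEAST j. \<theta> j \<noteq> \<theta>' j)"
    have "\<exists>j. \<theta> j \<noteq> \<theta>' j" using ne by auto
    then have j: "\<theta> j \<noteq> \<theta>' j" unfolding j_def by (rule LeastI_ex)
    have lt: "\<theta> i = \<theta>' i" if "i < j" for i using not_less_Least[of i] that unfolding j_def by blast
    have "st \<theta> i = st \<theta>' i" if "i \<le> j" for i
      using that by (induction i) (simp_all add: st0 stS lt)
    then have sj: "st \<theta> j = st \<theta>' j" by simp
    define X where "X = fst (st \<theta> (Suc j))"
    define Y where "Y = fst (st \<theta>' (Suc j))"
    have XY: "X \<noteq> Y" "card X = card Y"
      using j FG(3,4)[OF valid_st[of \<theta> j], of j] by (auto simp: X_def Y_def stS sj[symmetric])
    have fin: "finite X" "finite Y" using valid_st by (auto simp: X_def Y_def valid_def)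
    have "\<not> X \<subseteq> Y" "\<not> Y \<subseteq> X" using card_subset_eq[OF fin(2), of X] card_subset_eq[OF fin(1), of Y] XY by auto
    then obtain a b where ab: "a \<in> X" "a \<notin> Y" "b \<in> Y" "b \<notin> X" by blast
    have "X \<subseteq> f \<theta>" "Y \<subseteq> f \<theta>'" by (auto simp: f_def X_def Y_def)
    then have "b \<in> f \<theta> - X" "a \<in> f \<theta>' - Y" using ab eq by auto
    then have "\<bar>a\<bar> < \<bar>b\<bar>" "\<bar>b\<bar> < \<bar>a\<bar>"
      using tower_sequence.new_larger[OF ts, of b \<theta> "Suc j" a] tower_sequence.new_larger[OF ts, of a \<theta>' "Suc j" b] ab
      by (auto simp: f X_def Y_def tower_sequence.Lam_def[OF ts])
    then show False by simp
  qed
  moreover have "f \<theta> \<in> V_dim s M (real_of_int ` T) \<and> 0 \<in> f \<theta>" for \<theta>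
    unfolding f using tower_sequence.Spec_in_V_dim[OF ts s(1)] tower_sequence.zero_in_Spec[OF ts] by blast
  ultimately show ?thesis by blast
qed

end

section \<open>Cardinalities of families of countable sets and of their translation classes\<close>

lemma reals_eqpoll_bool_sequences: "(UNIV :: (nat \<Rightarrow> bool) set) \<approx> (UNIV :: real set)"
proof -
  have "bij_betw Collect (UNIV :: (nat \<Rightarrow> bool) set) UNIV"
    by (rule bij_betwI[of _ _ _ "\<lambda>A n. n \<in> A"]) auto
  then have "(UNIV :: (nat \<Rightarrow> bool) set) \<approx> (UNIV :: nat set set)" unfolding eqpoll_def by blast
  then show ?thesis using nat_sets_eqpoll_reals eqpoll_trans by blast
qed

text \<open>A countable set is determined by an enumeration, a sequence of reals; each real is coded
  by a set of naturals, and pairing packs the sequence into one such set.\<close>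

lemma countable_real_sets_lepoll: "{\<Lambda> :: real set. countable \<Lambda>} \<lesssim> (UNIV :: real set)"
proof -
  obtain e :: "real \<Rightarrow> nat set" where e: "inj e"
    using eqpoll_imp_lepoll[OF eqpoll_sym[OF nat_sets_eqpoll_reals]] unfolding lepoll_def by blast
  \<comment> \<open>\<open>from_nat_into\<close> says nothing useful about the empty set, which is
    coded separately; the \<open>0\<close>, never a successor, keeps the codes of nonempty sets
    nonempty.\<close>
  define code where "code = (\<lambda>\<Lambda> :: real set. if \<Lambda> = {} then {}
    else insert 0 {Suc (prod_encode (i, n)) |i n. n \<in> e (from_nat_into \<Lambda> i)})"
  have "inj_on code {\<Lambda>. countable \<Lambda>}"
  proof (rule inj_onI, clarsimp)
    fix A B :: "real set" assume AB: "countable A" "countable B" and eq: "code A = code B"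
    show "A = B"
    proof (cases "A = {} \<or> B = {}")
      case True
      then show ?thesis using eq by (auto simp: code_def split: if_splits)
    next
      case False
      have dec: "n \<in> e (from_nat_into C i) \<longleftrightarrow> Suc (prod_encode (i, n)) \<in> code C" if "C \<noteq> {}" for C i n
        using that by (auto simp: code_def)
      have "e (from_nat_into A i) = e (from_nat_into B i)" for i
        using dec[of A _ i] dec[of B _ i] False eq by blast
      then have "from_nat_into A i = from_nat_into B i" for i using injD[OF e] by blast
      then have "range (from_nat_into A) = range (from_nat_into B)" by simp
      then show ?thesis using False AB by simp
    qed
  qed
  then have "{\<Lambda> :: real set. countable \<Lambda>} \<lesssim> (UNIV :: nat set set)" unfolding lepoll_def by blast
  then show ?thesis using nat_sets_eqpoll_reals lepoll_trans2 by blast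
qed

lemma V_dim_countable: "\<Lambda> \<in> V_dim s M A \<Longrightarrow> countable \<Lambda>"
  by (simp add: V_dim_def V_def is_spectrum_def)

lemma V_dim_lepoll: "V_dim s M A \<lesssim> (UNIV :: real set)"
  by (rule lepoll_trans[OF subset_imp_lepoll countable_real_sets_lepoll]) (auto dest: V_dim_countable)

text \<open>All \<open>f \<theta>\<close> contain \<open>0\<close>, so one that is a translate of
  \<open>f \<theta>\<close> is its shift by \<open>- a\<close> for some \<open>a\<close> in
  \<open>f \<theta>\<close>, and each class contains only countably many of them. The reals thus
  embed into the product of the quotient with \<open>nat\<close>, and the second factor is absorbed
  because the quotient is infinite.\<close>

lemma continuum_V_dim:
  fixes f :: "(nat \<Rightarrow> bool) \<Rightarrow> real set"
  assumes inj: "inj f" and f: "\<And>\<theta>. f \<theta> \<in> V_dim s M A" and zero: "\<And>\<theta>. 0 \<in> f \<theta>"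
  shows "V_dim s M A \<approx> (UNIV :: real set)"
    and "V_dim s M A // translation_rel \<approx> (UNIV :: real set)"
proof -
  let ?V = "V_dim s M A"
  let ?Q = "?V // translation_rel"
  have reals: "(UNIV :: real set) \<approx> (UNIV :: (nat \<Rightarrow> bool) set)"
    by (rule eqpoll_sym[OF reals_eqpoll_bool_sequences])
  have "(UNIV :: (nat \<Rightarrow> bool) set) \<lesssim> ?V" unfolding lepoll_def using inj f by blast
  then show "?V \<approx> (UNIV :: real set)"
    by (intro lepoll_antisym V_dim_lepoll lepoll_trans1[OF reals])
  have Q_le: "?Q \<lesssim> (UNIV :: real set)"
  proof -
    have "?Q = (\<lambda>x. translation_rel `` {x}) ` ?V" by (auto simp: quotient_def)
    then show ?thesis using image_lepoll V_dim_lepoll lepoll_trans by metis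
  qed
  define h where "h = (\<lambda>\<theta>. translation_rel `` {f \<theta>})"
  have hQ: "h \<theta> \<in> ?Q" for \<theta> unfolding h_def by (rule quotientI[OF f])
  have fibre: "countable {\<theta>'. h \<theta>' = h \<theta>}" for \<theta>
  proof -
    have "f ` {\<theta>'. h \<theta>' = h \<theta>} \<subseteq> (\<lambda>a. (- a) +o f \<theta>) ` f \<theta>"
    proof clarify
      fix \<theta>' assume "h \<theta>' = h \<theta>"
      moreover have "f \<theta>' \<in> h \<theta>'"
        unfolding h_def translation_rel_def by (auto intro!: exI[of _ 0] simp: elt_set_plus_def)
      ultimately obtain c where c: "f \<theta>' = c +o f \<theta>" by (auto simp: h_def translation_rel_def)
      then obtain a where a: "a \<in> f \<theta>" "0 = c + a" using zero[of \<theta>'] by (auto simp: elt_set_plus_def)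
      then have "c = - a" by linarith
      then have "f \<theta>' = (- a) +o f \<theta>" using c by (simp only:)
      then show "f \<theta>' \<in> (\<lambda>a. (- a) +o f \<theta>) ` f \<theta>" using a(1) by (rule image_eqI)
    qed
    then have "countable (f ` {\<theta>'. h \<theta>' = h \<theta>})"
      using V_dim_countable[OF f] by (meson countable_image countable_subset)
    then show ?thesis using countable_image_inj_on inj inj_on_subset by blast
  qed
  define k where "k = (\<lambda>\<theta>. (h \<theta>, to_nat_on {\<theta>'. h \<theta>' = h \<theta>} \<theta>))"
  have "inj k"
  proof (rule injI)
    fix \<theta> \<theta>' assume eq: "k \<theta> = k \<theta>'"
    then have "h \<theta> = h \<theta>'" "to_nat_on {\<theta>''. h \<theta>'' = h \<theta>} \<theta> = to_nat_on {\<theta>''. h \<theta>'' = h \<theta>} \<theta>'"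
      by (auto simp: k_def)
    then show "\<theta> = \<theta>'" by (intro inj_onD[OF inj_on_to_nat_on[OF fibre[of \<theta>]]]) simp_all
  qed
  moreover have "range k \<subseteq> ?Q \<times> (UNIV :: nat set)" using hQ by (auto simp: k_def)
  ultimately have k: "(UNIV :: (nat \<Rightarrow> bool) set) \<lesssim> ?Q \<times> (UNIV :: nat set)" unfolding lepoll_def by blast
  then have rQ: "(UNIV :: real set) \<lesssim> ?Q \<times> (UNIV :: nat set)" by (rule lepoll_trans1[OF reals])
  have inf: "infinite ?Q"
  proof
    assume "finite ?Q"
    then have "countable (?Q \<times> (UNIV :: nat set))" by (simp add: countable_finite)
    then have "countable (UNIV :: real set)" using rQ countable_lepoll by blast
    then show False using uncountable_UNIV_real by blast
  qed
  have "?Q \<times> (UNIV :: nat set) \<lesssim> ?Q \<times> ?Q"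
    using inf by (intro times_lepoll_mono lepoll_refl) (simp add: infinite_le_lepoll)
  also have "?Q \<times> ?Q \<approx> ?Q"
    using card_of_Times_same_infinite[OF inf] by (simp add: eqpoll_iff_card_of_ordIso)
  finally have "(UNIV :: real set) \<lesssim> ?Q" using rQ lepoll_trans by blast
  then show "?Q \<approx> (UNIV :: real set)" using Q_le lepoll_antisym by blast
qed

section \<open>Hadamard triples and product forms\<close>

text \<open>Parseval for a Gram matrix that is \<open>W\<close> times the identity. It is applied
  both to dilated Hadamard sets, where \<open>W\<close> is their size, and to the digits
  \<open>\<bar>t\<bar> * l\<close> with \<open>l < N\<close>, where \<open>W = N\<close>.\<close>

lemma sum_norm_square_kernel:
  fixes f :: "'c \<Rightarrow> complex" and W :: real
  assumes C: "finite C"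
    and orth: "\<And>c c'. c \<in> C \<Longrightarrow> c' \<in> C \<Longrightarrow> (\<Sum>k\<in>K. E c k * cnj (E c' k)) = (if c = c' then of_real W else 0)"
  shows "(\<Sum>k\<in>K. (cmod (\<Sum>c\<in>C. f c * E c k))\<^sup>2) = W * (\<Sum>c\<in>C. (cmod (f c))\<^sup>2)"
proof -
  have "complex_of_real (\<Sum>k\<in>K. (cmod (\<Sum>c\<in>C. f c * E c k))\<^sup>2)
      = (\<Sum>k\<in>K. (\<Sum>c\<in>C. f c * E c k) * cnj (\<Sum>c\<in>C. f c * E c k))"
    by (simp only: of_real_sum complex_norm_square)
  also have "\<dots> = (\<Sum>k\<in>K. \<Sum>c\<in>C. \<Sum>c'\<in>C. f c * cnj (f c') * (E c k * cnj (E c' k)))"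
    by (simp add: cnj_sum sum_product mult_ac)
  also have "\<dots> = (\<Sum>c\<in>C. \<Sum>k\<in>K. \<Sum>c'\<in>C. f c * cnj (f c') * (E c k * cnj (E c' k)))"
    by (rule sum.swap)
  also have "\<dots> = (\<Sum>c\<in>C. \<Sum>c'\<in>C. \<Sum>k\<in>K. f c * cnj (f c') * (E c k * cnj (E c' k)))"
    by (rule sum.cong[OF refl], rule sum.swap)
  also have "\<dots> = (\<Sum>c\<in>C. \<Sum>c'\<in>C. if c' = c then f c * cnj (f c') * of_real W else 0)"
    unfolding sum_distrib_left[symmetric] by (intro sum.cong refl) (simp add: orth)
  also have "\<dots> = (\<Sum>c\<in>C. f c * cnj (f c) * of_real W)"
    using C by simp
  also have "\<dots> = complex_of_real (W * (\<Sum>c\<in>C. (cmod (f c))\<^sup>2))"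
    by (simp only: of_real_mult of_real_sum complex_norm_square sum_distrib_left) (simp add: mult_ac)
  finally show ?thesis unfolding of_real_eq_iff .
qed

lemma hadamard_tripleD:
  assumes "hadamard_triple N C K"
  shows "2 \<le> N" "finite C" "finite K" "C \<noteq> {}" "card C = card K" "0 < card C"
  using assms by (auto simp: hadamard_triple_def card_gt_0_iff)

lemma hadamard_entry_eq:
  "hadamard_entry N C k c = of_real (1 / sqrt (real (card C))) * cnj (expo (of_int k / real N) (of_int c))"
  by (simp add: hadamard_entry_def expo_def cis_cnj mult_ac)

lemma hadamard_columns:
  assumes H: "hadamard_triple N C K" and c: "c \<in> C" "c' \<in> C"
  shows "(\<Sum>k\<in>K. expo (of_int k / real N) (of_int c) * cnj (expo (of_int k / real N) (of_int c')))
    = (if c = c' then of_nat (card C) else 0)"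
proof -
  define q where "q = complex_of_real (1 / sqrt (real (card C)))"
  have qq: "q * q * of_nat (card C) = 1"
  proof -
    have "(1 / sqrt (real (card C))) * (1 / sqrt (real (card C))) * real (card C) = 1"
      using hadamard_tripleD(6)[OF H] by simp
    then show ?thesis unfolding q_def by (metis of_real_1 of_real_mult of_real_of_nat_eq)
  qed
  have "q * q * (\<Sum>k\<in>K. expo (of_int k / real N) (of_int c) * cnj (expo (of_int k / real N) (of_int c')))
      = (\<Sum>k\<in>K. cnj (hadamard_entry N C k c) * hadamard_entry N C k c')"
    unfolding sum_distrib_left hadamard_entry_eq q_def by (intro sum.cong refl) (simp add: mult_ac)
  also have "\<dots> = (if c = c' then 1 else 0)" using H c by (simp add: hadamard_triple_def)
  finally have *: "q * q * (\<Sum>k\<in>K. expo (of_int k / real N) (of_int c) * cnj (expo (of_int k / real N) (of_int c')))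
      = (if c = c' then 1 else 0)" .
  have "S = of_nat (card C) * (q * q * S)" for S :: complex
  proof -
    have "of_nat (card C) * (q * q * S) = q * q * of_nat (card C) * S" by (simp only: mult_ac)
    then show ?thesis by (simp only: qq mult_1)
  qed
  from this[of "\<Sum>k\<in>K. expo (of_int k / real N) (of_int c) * cnj (expo (of_int k / real N) (of_int c'))"]
  show ?thesis unfolding * by simp
qed

lemma expo_product: "expo x y = expo (x * y) 1"
  by (simp add: expo_def mult.assoc)

lemma expo_quotient_int:
  assumes "int N dvd k * c" "0 < N"
  shows "expo (of_int k / real N) (of_int c) = 1"
proof -
  obtain z where z: "k * c = int N * z" using assms(1) by blast
  have "of_int k / real N * of_int c = of_int (k * c) / real N" by simp
  also have "\<dots> = of_int z" unfolding z using assms(2) by simp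
  finally have "expo (of_int k / real N) (of_int c) = expo (of_int z) (of_int 1)"
    unfolding expo_product[of "of_int k / real N"] by (simp only: of_int_1)
  then show ?thesis by (simp only: expo_int)
qed

text \<open>Otherwise the two columns would coincide and have inner product \<open>card C\<close>
  instead of \<open>0\<close>. This allows the sum over the digits in \<open>L\<close> to be
  replaced by one over all \<open>l < N\<close>.\<close>

lemma hadamard_columns_distinct:
  assumes H: "hadamard_triple N C (t *o K)" and c: "c \<in> C" "c' \<in> C" "c \<noteq> c'"
  shows "\<not> int N dvd t * (c - c')"
proof
  assume d: "int N dvd t * (c - c')"
  have N: "0 < N" using hadamard_tripleD(1)[OF H] by simp
  have "expo (of_int k / real N) (of_int c) * cnj (expo (of_int k / real N) (of_int c')) = 1" if k: "k \<in> t *o K" for k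
  proof -
    obtain l where "k = t * l" using k by (auto simp: elt_set_times_def)
    then have "int N dvd k * (c - c')" using d by (metis dvd_mult2 mult.assoc mult.commute)
    then have "expo (of_int k / real N) (of_int (c - c')) = 1" using N by (rule expo_quotient_int)
    then show ?thesis
      by (simp add: expo_swap[of "of_int k / real N"] expo_mult_cnj)
  qed
  then have "of_nat (card (t *o K)) = (0 :: complex)"
    using hadamard_columns[OF H c(1,2)] c(3) by simp
  then show False using hadamard_tripleD(5,6)[OF H] by simp
qed

text \<open>Rows with congruent indices coincide, which contradicts their orthogonality; reducing
  digits modulo \<open>N\<close> therefore loses none of them.\<close>

lemma hadamard_rows_distinct:
  assumes H: "hadamard_triple N C K" and k: "k \<in> K" "k' \<in> K" "k mod int N = k' mod int N"
  shows "k = k'"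
proof (rule ccontr)
  assume ne: "k \<noteq> k'"
  define q where "q = complex_of_real (1 / sqrt (real (card C)))"
  have q0: "q \<noteq> 0" using hadamard_tripleD(6)[OF H] by (simp add: q_def)
  have N: "0 < N" using hadamard_tripleD(1)[OF H] by simp
  have "hadamard_entry N C k c * cnj (hadamard_entry N C k' c) = q * q" for c
  proof -
    have "int N dvd (k' - k) * c" using k(3) by (metis dvd_mult2 mod_eq_dvd_iff)
    then have "expo (of_int (k' - k) / real N) (of_int c) = 1" using N by (rule expo_quotient_int)
    then have "expo (of_int k' / real N) (of_int c) * cnj (expo (of_int k / real N) (of_int c)) = 1"
      by (simp add: expo_mult_cnj diff_divide_distrib)
    then show ?thesis unfolding hadamard_entry_eq q_def by (simp add: mult_ac)
  qed
  moreover have "(\<Sum>c\<in>C. hadamard_entry N C k c * cnj (hadamard_entry N C k' c)) = (if k = k' then 1 else 0)"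
    using H k(1,2) unfolding hadamard_triple_def by blast
  ultimately have "of_nat (card C) * (q * q) = 0" using ne by simp
  then show False using q0 hadamard_tripleD(6)[OF H] by simp
qed

text \<open>A geometric sum over the powers of an \<open>N\<close>-th root of unity, which differs
  from \<open>1\<close> exactly because of the assumption on divisibility.\<close>

lemma residue_columns:
  assumes N: "0 < N" and d: "c \<noteq> c' \<Longrightarrow> \<not> int N dvd \<tau> * (c - c')"
  shows "(\<Sum>l<N. expo (of_int (\<tau> * int l) / real N) (of_int c) * cnj (expo (of_int (\<tau> * int l) / real N) (of_int c')))
    = (if c = c' then of_nat N else 0)"
proof (cases "c = c'")
  case True
  then show ?thesis by (simp add: expo_mult_cnj expo_swap[of _ "of_int c'"])
next
  case False
  define \<omega> where "\<omega> = expo (of_int \<tau> / real N) (of_int (c - c'))"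
  have pow: "\<omega> ^ l = expo (of_int (\<tau> * int l) / real N) (of_int (c - c'))" for l
  proof (induction l)
    case (Suc l)
    have "of_int (\<tau> * int (Suc l)) / real N = of_int \<tau> / real N + of_int (\<tau> * int l) / real N"
      by (simp add: add_divide_distrib algebra_simps)
    then show ?case using Suc by (simp only: power_Suc expo_add_left \<omega>_def)
  qed simp
  have "\<omega> ^ N = expo (of_int (\<tau> * int N) / real N) (of_int (c - c'))" by (rule pow)
  also have "\<dots> = 1" using N by (intro expo_quotient_int) auto
  finally have wN: "\<omega> ^ N = 1" .
  have w1: "\<omega> \<noteq> 1"
  proof
    assume "\<omega> = 1"
    then have "cos (2 * pi * (of_int \<tau> / real N) * of_int (c - c')) = 1" by (simp add: \<omega>_def expo_def complex_eq_iff)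
    then obtain z :: int where "2 * pi * (of_int \<tau> / real N) * of_int (c - c') = of_int z * 2 * pi"
      using cos_one_2pi_int by blast
    then have "2 * pi * ((of_int \<tau> / real N) * of_int (c - c')) = 2 * pi * of_int z" by (simp only: mult_ac)
    then have "(of_int \<tau> / real N) * of_int (c - c') = real_of_int z" by (simp only: mult_cancel_left) simp
    then have "real_of_int (\<tau> * (c - c')) = real_of_int (int N * z)" using N by (simp add: field_simps)
    then have "\<tau> * (c - c') = int N * z" by (simp only: of_int_eq_iff)
    then show False using d[OF False] by simp
  qed
  have "(\<Sum>l<N. expo (of_int (\<tau> * int l) / real N) (of_int c) * cnj (expo (of_int (\<tau> * int l) / real N) (of_int c')))
      = (\<Sum>l<N. \<omega> ^ l)"
    unfolding pow by (simp add: expo_swap[of "_ / real N"] expo_mult_cnj)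
  also have "\<dots> = 0" using w1 wN by (simp add: geometric_sum)
  finally show ?thesis using False by simp
qed

lemma sum_mask_kernel:
  assumes C: "finite C" "C \<noteq> {}"
    and orth: "\<And>c c'. c \<in> C \<Longrightarrow> c' \<in> C \<Longrightarrow>
      (\<Sum>k\<in>K. expo (\<kappa> k) (of_int c) * cnj (expo (\<kappa> k) (of_int c'))) = (if c = c' then of_real W else 0)"
  shows "(\<Sum>k\<in>K. (cmod (digit_mask C (y + \<kappa> k)))\<^sup>2) = W / real (card C)"
proof -
  have card: "0 < real (card C)" using C by (simp add: card_gt_0_iff)
  have "cmod (digit_mask C (y + \<kappa> k)) = cmod (\<Sum>c\<in>C. expo y (of_int c) * expo (\<kappa> k) (of_int c)) / real (card C)" for k
    by (simp add: digit_mask_def expo_add_left norm_divide)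
  then have "(\<Sum>k\<in>K. (cmod (digit_mask C (y + \<kappa> k)))\<^sup>2)
      = (\<Sum>k\<in>K. (cmod (\<Sum>c\<in>C. expo y (of_int c) * expo (\<kappa> k) (of_int c)))\<^sup>2) / (real (card C))\<^sup>2"
    by (simp add: power_divide sum_divide_distrib)
  also have "\<dots> = W * real (card C) / (real (card C))\<^sup>2"
    by (subst sum_norm_square_kernel[OF C(1) orth]) auto
  also have "\<dots> = W / real (card C)" using card by (simp add: power2_eq_square)
  finally show ?thesis .
qed

text \<open>The set \<open>L\<close> is replaced by the residues modulo \<open>N\<close> of a translate that contains \<open>0\<close>.\<close>

lemma spectral_towerI:
  fixes u :: "nat \<Rightarrow> real \<Rightarrow> real" and p :: real
  assumes N: "2 \<le> N" and D: "finite D" "2 \<le> card D" "card D < N"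
    and L: "finite L" "card L = card D" "\<And>l l'. l \<in> L \<Longrightarrow> l' \<in> L \<Longrightarrow> l mod int N = l' mod int N \<Longrightarrow> l = l'"
    and cont: "continuous_on UNIV (u 0)" and per: "\<And>i x z. u i (x + of_int z) = u i x"
    and nonneg: "\<And>x. 0 \<le> u 0 x" and le1: "\<And>x. u 0 x \<le> 1" and u00: "u 0 0 = 1"
    and zero: "\<And>x. u 0 x = 0 \<Longrightarrow> FT (self_similar_measure N D) x = 0"
    and ur: "\<And>x. u r x = 1" and p: "0 \<le> p"
    and T: "1 \<in> T"
    and transfer: "\<And>t i x. t \<in> T \<Longrightarrow> i \<le> r \<Longrightarrow>
      (\<Sum>l\<in>L. (cmod (digit_mask D ((x + of_int t * of_int l) / real N)))\<^sup>2 * u i ((x + of_int t * of_int l) / real N))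
      = (if i = 0 then u 0 x else p * u (i - 1) x)"
    and transfer_full: "\<And>t x. t \<in> T \<Longrightarrow>
      (\<Sum>l<N. (cmod (digit_mask D ((x + of_int \<bar>t\<bar> * real l) / real N)))\<^sup>2 * u 0 ((x + of_int \<bar>t\<bar> * real l) / real N))
        = real N / real (card D) * u 0 x"
    and L0: "finite L0" "0 \<in> L0" "\<And>t x. t \<in> T \<Longrightarrow> (\<Sum>v\<in>L0. u 0 (x + of_int t * v)) = 1"
  shows "\<exists>L' R. spectral_tower (self_similar_measure N D) N D L' (u 0) L0 T r (p ^ r) R"
proof -
  let ?M = "self_similar_measure N D"
  have D0: "D \<noteq> {}" using D by auto
  have ss: "is_self_similar_measure N D ?M" by (rule self_similar_measure[OF D(1) D0 N])
  obtain R where R: "AE x in ?M. \<bar>x\<bar> \<le> R" using self_similar_measure_bounded[OF D(1) D0 N] by blast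
  interpret borel_prob ?M
    using ss by (auto simp: is_self_similar_measure_def borel_prob_def borel_prob_axioms_def)
  have "L \<noteq> {}" using L D by auto
  then obtain l0 where l0: "l0 \<in> L" by blast
  define \<phi> where "\<phi> = (\<lambda>l. (l - l0) mod int N)"
  define L' where "L' = \<phi> ` L"
  have inj: "inj_on \<phi> L"
  proof (rule inj_onI)
    fix l l' assume l: "l \<in> L" "l' \<in> L" "\<phi> l = \<phi> l'"
    then have "(l - l0 + l0) mod int N = (l' - l0 + l0) mod int N"
      unfolding \<phi>_def by (metis mod_add_left_eq)
    then show "l = l'" using L(3)[OF l(1,2)] by simp
  qed
  have L': "L' \<subseteq> {0..<int N}" "0 \<in> L'" "card L' = card D"
    using N l0 L(2) card_image[OF inj] by (auto simp: L'_def \<phi>_def intro!: image_eqI[of _ _ l0])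
  have tr': "(\<Sum>l\<in>L'. (cmod (digit_mask D ((x + of_int t * of_int l) / real N)))\<^sup>2 * u i ((x + of_int t * of_int l) / real N))
      = (if i = 0 then u 0 x else p * u (i - 1) x)" if t: "t \<in> T" and i: "i \<le> r" for t i x
  proof -
    \<comment> \<open>The translation by \<open>l0\<close> is absorbed by an integer shift of
      \<open>x\<close>, under which \<open>u\<close> is invariant; reduction modulo \<open>N\<close>
      shifts the arguments by integers after the division by \<open>N\<close>.\<close>
    let ?x = "x + of_int (- (t * l0))"
    have "(x + of_int t * of_int (\<phi> l)) / real N = (?x + of_int t * of_int l) / real N + of_int (- (t * ((l - l0) div int N)))" for l
    proof -
      have eq: "real_of_int (\<phi> l) = of_int (l - l0) - real N * of_int ((l - l0) div int N)"
        unfolding \<phi>_def by (simp add: minus_div_mult_eq_mod[symmetric] mult.commute)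
      show ?thesis unfolding eq using N by (simp add: field_simps)
    qed
    then have "(\<Sum>l\<in>L'. (cmod (digit_mask D ((x + of_int t * of_int l) / real N)))\<^sup>2 * u i ((x + of_int t * of_int l) / real N))
      = (\<Sum>l\<in>L. (cmod (digit_mask D ((?x + of_int t * of_int l) / real N)))\<^sup>2 * u i ((?x + of_int t * of_int l) / real N))"
      unfolding L'_def sum.reindex[OF inj] comp_def by (simp only: digit_mask_periodic per)
    also have "\<dots> = (if i = 0 then u 0 ?x else p * u (i - 1) ?x)" by (rule transfer[OF t i])
    finally show ?thesis by (simp only: per)
  qed
  \<comment> \<open>At index \<open>r\<close> the weight is \<open>1\<close>, so the general digit
    identity becomes one for the unweighted sum.\<close>
  have unw: "(\<Sum>c\<in>digit_sums N L' m. (cmod (digit_mask_prod N D m (x + of_int t * of_int c)))\<^sup>2) \<le> p ^ r * u 0 x"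
    if t: "t \<in> T" and m: "r \<le> m" for t m x
    using digit_sum_transfer[OF N L'(1) tr'[OF t] m order_refl, of x] by (simp add: ur)
  have "spectral_tower ?M N D L' (u 0) L0 T r (p ^ r) R"
    by unfold_locales
      (use N D ss R L' cont per nonneg le1 u00 zero T tr'[of _ 0] transfer_full L0 p unw in auto)
  then show ?thesis by blast
qed

lemma elt_times_image: "(t :: int) *o X = (\<lambda>x. t * x) ` X"
  by (auto simp: elt_set_times_def)

lemma one_elt_times [simp]: "(1 :: int) *o X = X"
  by (simp add: elt_times_image)

lemma elt_times_plus: "(t :: int) *o (X + Y) = t *o X + t *o Y"
  by (auto simp: elt_set_times_def set_plus_def) (metis distrib_left)+

text \<open>Dilation by \<open>t\<close> is injective on \<open>L\<close>, because the dilated set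
  again has as many elements as \<open>C\<close>; sums over it may be indexed by
  \<open>L\<close>.\<close>

lemma hadamard_columns_dilate:
  assumes H: "hadamard_triple N C (t *o L)" and L: "finite L" "card L = card C" and c: "c \<in> C" "c' \<in> C"
  shows "(\<Sum>l\<in>L. expo (of_int (t * l) / real N) (of_int c) * cnj (expo (of_int (t * l) / real N) (of_int c')))
    = (if c = c' then of_real (real (card C)) else 0)"
proof -
  have "card ((\<lambda>x. t * x) ` L) = card L"
    using hadamard_tripleD(5)[OF H] L(2) by (simp add: elt_times_image)
  then have inj: "inj_on (\<lambda>x. t * x) L" using L(1) by (simp add: inj_on_iff_eq_card)
  show ?thesis
    using hadamard_columns[OF H c] by (simp add: elt_times_image sum.reindex[OF inj])
qed

lemma not_dvd_abs_mult:
  assumes "\<not> int N dvd t * d"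
  shows "\<not> int N dvd \<bar>t\<bar> * d"
  using assms by (simp add: abs_if)

text \<open>Here \<open>D\<close> is itself a Hadamard digit set for every multiplier, so the
  constant weight \<open>1\<close> is invariant and the tower starts from \<open>0\<close>
  alone.\<close>

lemma spectral_tower_hadamard:
  assumes N: "2 \<le> N" and D: "finite D" "2 \<le> card D" "card D < N" and L: "finite L" and T: "1 \<in> T"
    and H: "\<And>t. t \<in> T \<Longrightarrow> hadamard_triple N D (t *o L)"
  shows "\<exists>L' R. spectral_tower (self_similar_measure N D) N D L' (\<lambda>x. 1) {0} T 0 1 R"
proof -
  have H1: "hadamard_triple N D L" using H[OF T] by simp
  have cL: "card L = card D" using hadamard_tripleD(5)[OF H1] by simp
  have D0: "D \<noteq> {}" using D by auto
  have transfer: "(\<Sum>l\<in>L. (cmod (digit_mask D ((x + of_int t * of_int l) / real N)))\<^sup>2) = 1" if t: "t \<in> T" for t x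
    using sum_mask_kernel[OF D(1) D0 hadamard_columns_dilate[OF H[OF t] L cL], of "x / real N"] D D0
    by (simp add: add_divide_distrib)
  have full: "(\<Sum>l<N. (cmod (digit_mask D ((x + of_int \<bar>t\<bar> * real l) / real N)))\<^sup>2) = real N / real (card D)" if t: "t \<in> T" for t x
  proof -
    have "(\<Sum>l<N. (cmod (digit_mask D (x / real N + of_int (\<bar>t\<bar> * int l) / real N)))\<^sup>2) = real N / real (card D)"
    proof (rule sum_mask_kernel[OF D(1) D0])
      fix c c' assume c: "c \<in> D" "c' \<in> D"
      have "\<not> int N dvd \<bar>t\<bar> * (c - c')" if "c \<noteq> c'"
        using hadamard_columns_distinct[OF H[OF t] c that] by (rule not_dvd_abs_mult)
      then show "(\<Sum>l<N. expo (of_int (\<bar>t\<bar> * int l) / real N) (of_int c) * cnj (expo (of_int (\<bar>t\<bar> * int l) / real N) (of_int c')))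
          = (if c = c' then of_real (real N) else 0)"
        using residue_columns[of N c c' "\<bar>t\<bar>"] N by simp
    qed
    then show ?thesis by (simp add: add_divide_distrib)
  qed
  have "\<exists>L' R. spectral_tower (self_similar_measure N D) N D L' ((\<lambda>i x. 1) (0::nat)) {0} T 0 (1 ^ 0) R"
  proof (rule spectral_towerI[OF N D L cL, where p=1 and u="\<lambda>i x. 1"])
    show "l = l'" if "l \<in> L" "l' \<in> L" "l mod int N = l' mod int N" for l l'
      using hadamard_rows_distinct[OF H1 that] .
  qed (use T transfer full in auto)
  then show ?thesis by simp
qed

text \<open>The exponent \<open>r\<close> of a product form is written \<open>Suc r\<close> here.\<close>

locale product_form =
  fixes N n r :: nat and a :: "nat \<Rightarrow> int" and B :: "nat \<Rightarrow> int set" and L1 L2 D :: "int set" and T :: "int set"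
  assumes n: "1 \<le> n" and inj_a: "inj_on a {..<n}" and fin_L: "finite L1" "finite L2"
    and D_eq: "D = (\<Union>s<n. a s +o ((int N ^ Suc r) *o B s))"
    and T_eq: "T = multiplier_set N n a B L1 L2"
    and sys: "hadamard_system N n a B L1 L2"
begin

section \<open>The digit set of a product form and its mask\<close>

abbreviation A :: "int set" where "A \<equiv> a ` {..<n}"

definition m :: nat where "m = card L2"

lemma one_in_T: "1 \<in> T"
  using sys by (simp add: T_eq multiplier_set_def)

lemma
  assumes "t \<in> T" "s < n"
  shows HA: "hadamard_triple N A (t *o L1)" and HB: "hadamard_triple N (B s) (t *o L2)"
    and HAB: "hadamard_triple N (A + B s) (t *o (L1 + L2))"
  using assms by (auto simp: T_eq multiplier_set_def hadamard_system_def elt_times_plus)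

lemma direct: "s < n \<Longrightarrow> direct_sum A (B s)" "direct_sum L1 L2"
  using sys n by (auto simp: hadamard_system_def)

lemma N2: "2 \<le> N"
  using hadamard_tripleD(1)[OF HA[OF one_in_T, of 0]] n by simp

lemma fin_B: "s < n \<Longrightarrow> finite (B s)" and B_nonempty: "s < n \<Longrightarrow> B s \<noteq> {}" and card_B: "s < n \<Longrightarrow> card (B s) = m"
  using hadamard_tripleD(2,4,5)[OF HB[OF one_in_T]] by (auto simp: m_def)

lemma m_pos: "0 < m"
  using hadamard_tripleD(6)[OF HB[OF one_in_T, of 0]] n card_B[of 0] by simp

lemma card_A: "card A = n"
  using card_image[OF inj_a] by simp

lemma card_L1: "card L1 = n"
  using hadamard_tripleD(5)[OF HA[OF one_in_T, of 0]] n card_A by simp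

lemma card_sum: "direct_sum X Y \<Longrightarrow> card (X + Y) = card X * card Y"
proof -
  assume "direct_sum X Y"
  moreover have "X + Y = (\<lambda>(x, y). x + y) ` (X \<times> Y)" by (auto simp: set_plus_def)
  ultimately show ?thesis by (simp add: direct_sum_def card_image card_cartesian_product)
qed

lemma card_L: "card (L1 + L2) = n * m"
  using card_sum[OF direct(2)] by (simp add: card_L1 m_def)

lemma card_AB: "s < n \<Longrightarrow> card (A + B s) = n * m"
  using card_sum[OF direct(1)] by (simp add: card_A card_B)

lemma fin_sum: "finite (L1 + L2)"
  using fin_L by (simp add: finite_set_plus)

lemma a_distinct: "s < n \<Longrightarrow> s' < n \<Longrightarrow> int N dvd a s - a s' \<Longrightarrow> s = s'"
  using hadamard_columns_distinct[of N A 1 L1 "a s" "a s'"] HA[OF one_in_T, of s] inj_onD[OF inj_a, of s s'] by auto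

text \<open>The exponent being positive, all elements of a piece are congruent to \<open>a s\<close>
  modulo \<open>N\<close>, and the Hadamard property of \<open>A\<close> makes the
  \<open>a s\<close> incongruent.\<close>

lemma disjoint_pieces:
  assumes "s < n" "s' < n" "s \<noteq> s'"
  shows "(a s +o ((int N ^ Suc r) *o B s)) \<inter> (a s' +o ((int N ^ Suc r) *o B s')) = {}"
proof (rule ccontr)
  assume "\<not> ?thesis"
  then obtain b b' where "a s + int N ^ Suc r * b = a s' + int N ^ Suc r * b'"
    by (auto simp: elt_set_plus_def elt_set_times_def)
  then have "a s - a s' = int N * (int N ^ r * (b' - b))" by (simp add: algebra_simps)
  then show False using a_distinct assms by (metis dvd_triv_left)
qed

lemma piece_image: "a s +o ((int N ^ Suc r) *o B s) = (\<lambda>b. a s + int N ^ Suc r * b) ` B s"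
  by (auto simp: elt_set_plus_def elt_set_times_def)

lemma inj_piece: "inj_on (\<lambda>b. a s + int N ^ Suc r * b) (B s)"
  using N2 by (auto simp: inj_on_def)

lemma sum_D: "sum f D = (\<Sum>s<n. \<Sum>b\<in>B s. f (a s + int N ^ Suc r * b))"
proof -
  have "sum f D = (\<Sum>s<n. sum f (a s +o ((int N ^ Suc r) *o B s)))"
    unfolding D_eq by (rule sum.UNION_disjoint) (use fin_B disjoint_pieces in \<open>auto simp: piece_image simp del: power_Suc\<close>)
  also have "\<dots> = (\<Sum>s<n. \<Sum>b\<in>B s. f (a s + int N ^ Suc r * b))"
    unfolding piece_image sum.reindex[OF inj_piece] comp_def ..
  finally show ?thesis .
qed

lemma finite_D: "finite D"
  unfolding D_eq piece_image using fin_B by auto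

lemma card_D: "card D = n * m"
  using sum_D[of "\<lambda>d. 1 :: nat"] by (simp add: card_B)

lemma digit_mask_D: "digit_mask D x = (\<Sum>s<n. expo x (of_int (a s)) * digit_mask (B s) (real N ^ Suc r * x)) / of_nat n"
proof -
  have "expo x (of_int (a s + int N ^ Suc r * b)) = expo x (of_int (a s)) * expo (real N ^ Suc r * x) (of_int b)" for s b
    by (simp add: expo_add) (simp add: expo_def mult_ac)
  then have "digit_mask D x = (\<Sum>s<n. \<Sum>b\<in>B s. expo x (of_int (a s)) * expo (real N ^ Suc r * x) (of_int b)) / of_nat (n * m)"
    unfolding digit_mask_def sum_D card_D by simp
  also have "\<dots> = (\<Sum>s<n. expo x (of_int (a s)) * digit_mask (B s) (real N ^ Suc r * x)) / of_nat n"
    by (simp add: digit_mask_def card_B sum_distrib_left sum_divide_distrib mult.commute[of "complex_of_nat n"])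
  finally show ?thesis .
qed

text \<open>This is what remains of the squared mask of \<open>D\<close> after summation over the
  digits of \<open>L1\<close>, by \<open>digit_mask_D_kernel\<close>; the invariant weight is built
  from it.\<close>

definition G :: "real \<Rightarrow> real" where
  "G x = (\<Sum>s<n. (cmod (digit_mask (B s) x))\<^sup>2) / real n"

lemma G_periodic: "G (x + of_int z) = G x"
  by (simp add: G_def digit_mask_periodic)

lemma G_nonneg: "0 \<le> G x"
  by (simp add: G_def sum_nonneg)

lemma G_le_1: "G x \<le> 1"
proof -
  have "(\<Sum>s<n. (cmod (digit_mask (B s) x))\<^sup>2) \<le> (\<Sum>s<n. 1)"
    by (intro sum_mono power_le_one) (auto simp: norm_mask_le)
  then show ?thesis using n by (simp add: G_def divide_le_eq)
qed

lemma G_0: "G 0 = 1"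
  using n fin_B B_nonempty by (simp add: G_def)

lemma G_continuous: "continuous_on UNIV G"
  unfolding G_def[abs_def] digit_mask_def expo_def cis_conv_exp using n m_pos
  by (intro continuous_intros) (auto simp: card_B)

lemma digit_mask_D_shift:
  "digit_mask D ((y + of_int \<kappa>) / real N)
    = (\<Sum>s<n. digit_mask (B s) (real N ^ r * y) * expo (y / real N) (of_int (a s)) * expo (of_int \<kappa> / real N) (of_int (a s))) / of_nat n"
proof -
  have "real N ^ Suc r * ((y + of_int \<kappa>) / real N) = real N ^ r * y + of_int (int N ^ r * \<kappa>)"
    using N2 by (simp add: field_simps)
  then have "digit_mask (B s) (real N ^ Suc r * ((y + of_int \<kappa>) / real N)) = digit_mask (B s) (real N ^ r * y)" for s
    by (metis digit_mask_periodic)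
  then show ?thesis
    unfolding digit_mask_D add_divide_distrib[of y] expo_add_left by (simp add: mult_ac)
qed

text \<open>At the points \<open>(y + \<kappa> k) / N\<close> the masks of the \<open>B s\<close>
  are evaluated at arguments that differ by integers, so they do not depend on \<open>k\<close>.
  Only the frequencies \<open>a s\<close> vary, and their orthogonality suffices.\<close>

lemma digit_mask_D_kernel:
  assumes orth: "\<And>s s'. s < n \<Longrightarrow> s' < n \<Longrightarrow>
      (\<Sum>k\<in>K. expo (of_int (\<kappa> k) / real N) (of_int (a s)) * cnj (expo (of_int (\<kappa> k) / real N) (of_int (a s'))))
      = (if s = s' then of_real (real n) else 0)"
  shows "(\<Sum>k\<in>K. (cmod (digit_mask D ((y + of_int (\<kappa> k)) / real N)))\<^sup>2) = G (real N ^ r * y)"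
proof -
  have "(\<Sum>k\<in>K. (cmod (digit_mask D ((y + of_int (\<kappa> k)) / real N)))\<^sup>2)
      = (\<Sum>k\<in>K. (cmod (\<Sum>s\<in>{..<n}. digit_mask (B s) (real N ^ r * y) * expo (y / real N) (of_int (a s))
          * expo (of_int (\<kappa> k) / real N) (of_int (a s))))\<^sup>2) / (real n)\<^sup>2"
    unfolding digit_mask_D_shift norm_divide power_divide norm_of_nat sum_divide_distrib[symmetric] ..
  also have "\<dots> = real n * (\<Sum>s<n. (cmod (digit_mask (B s) (real N ^ r * y)))\<^sup>2) / (real n)\<^sup>2"
    by (subst sum_norm_square_kernel[where W="real n"]) (auto simp: orth norm_mult)
  also have "\<dots> = G (real N ^ r * y)" using n by (simp add: G_def power2_eq_square)
  finally show ?thesis .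
qed

text \<open>\<open>G\<close> is an average over \<open>s'\<close>. For fixed \<open>s'\<close> the
  product of the mask of \<open>D\<close> with that of \<open>B s'\<close> is an exponential sum
  over \<open>A + B s'\<close> whose coefficients do not depend on \<open>k\<close>; here the
  Hadamard property of each \<open>A + B s'\<close> enters.\<close>

lemma product_kernel:
  assumes orth: "\<And>s c c'. s < n \<Longrightarrow> c \<in> A + B s \<Longrightarrow> c' \<in> A + B s \<Longrightarrow>
      (\<Sum>k\<in>K. expo (of_int (\<kappa> k) / real N) (of_int c) * cnj (expo (of_int (\<kappa> k) / real N) (of_int c')))
      = (if c = c' then of_real W else 0)"
  shows "(\<Sum>k\<in>K. (cmod (digit_mask D ((y + of_int (\<kappa> k)) / real N)))\<^sup>2 * G ((y + of_int (\<kappa> k)) / real N))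
    = W / (real n * real m) * G (real N ^ r * y)"
proof -
  define w where "w = (\<lambda>s. digit_mask (B s) (real N ^ r * y))"
  have one: "(\<Sum>k\<in>K. (cmod (digit_mask D ((y + of_int (\<kappa> k)) / real N)))\<^sup>2 * (cmod (digit_mask (B s') ((y + of_int (\<kappa> k)) / real N)))\<^sup>2)
      = W / (real n * real m) * G (real N ^ r * y)" if s': "s' < n" for s'
  proof -
    let ?C = "{..<n} \<times> B s'"
    let ?E = "\<lambda>p k. expo (of_int (\<kappa> k) / real N) (of_int (a (fst p) + snd p))"
    let ?f = "\<lambda>p. w (fst p) * expo (y / real N) (of_int (a (fst p) + snd p))"
    have prod: "digit_mask D ((y + of_int (\<kappa> k)) / real N) * digit_mask (B s') ((y + of_int (\<kappa> k)) / real N)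
        = (\<Sum>p\<in>?C. ?f p * ?E p k) / of_nat (n * m)" for k
    proof -
      have "digit_mask (B s') ((y + of_int (\<kappa> k)) / real N)
          = (\<Sum>b\<in>B s'. expo (y / real N) (of_int b) * expo (of_int (\<kappa> k) / real N) (of_int b)) / of_nat m"
        by (simp add: digit_mask_def card_B s' add_divide_distrib expo_add_left)
      then have "digit_mask D ((y + of_int (\<kappa> k)) / real N) * digit_mask (B s') ((y + of_int (\<kappa> k)) / real N)
        = (\<Sum>s<n. \<Sum>b\<in>B s'. (w s * expo (y / real N) (of_int (a s)) * expo (of_int (\<kappa> k) / real N) (of_int (a s)))
            * (expo (y / real N) (of_int b) * expo (of_int (\<kappa> k) / real N) (of_int b))) / of_nat (n * m)"
        unfolding digit_mask_D_shift w_def by (simp add: sum_product)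
      also have "\<dots> = (\<Sum>s<n. \<Sum>b\<in>B s'. ?f (s, b) * ?E (s, b) k) / of_nat (n * m)"
        by (simp add: expo_add mult_ac)
      finally show ?thesis by (simp add: sum.cartesian_product case_prod_unfold)
    qed
    have inj: "inj_on (\<lambda>p. a (fst p) + snd p) ?C"
    proof (rule inj_onI)
      fix p p' assume p: "p \<in> ?C" "p' \<in> ?C" "a (fst p) + snd p = a (fst p') + snd p'"
      then have "(a (fst p), snd p) = (a (fst p'), snd p')"
        using direct(1)[OF s'] unfolding direct_sum_def by (intro inj_onD[where f="\<lambda>(x, y). x + y"]) auto
      then show "p = p'" using inj_onD[OF inj_a] p by (auto simp: prod_eq_iff)
    qed
    have "(\<Sum>k\<in>K. (cmod (digit_mask D ((y + of_int (\<kappa> k)) / real N)))\<^sup>2 * (cmod (digit_mask (B s') ((y + of_int (\<kappa> k)) / real N)))\<^sup>2)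
        = (\<Sum>k\<in>K. (cmod (\<Sum>p\<in>?C. ?f p * ?E p k))\<^sup>2) / (real (n * m))\<^sup>2"
      unfolding power_mult_distrib[symmetric] norm_mult[symmetric] prod
        norm_divide power_divide norm_of_nat sum_divide_distrib[symmetric] ..
    also have "(\<Sum>k\<in>K. (cmod (\<Sum>p\<in>?C. ?f p * ?E p k))\<^sup>2) = W * (\<Sum>p\<in>?C. (cmod (?f p))\<^sup>2)"
    proof (rule sum_norm_square_kernel)
      show "finite ?C" using fin_B s' by simp
      fix p p' assume p: "p \<in> ?C" "p' \<in> ?C"
      then have "a (fst p) + snd p \<in> A + B s'" "a (fst p') + snd p' \<in> A + B s'"
        by (auto intro: set_plus_intro)
      from orth[OF s' this] show "(\<Sum>k\<in>K. ?E p k * cnj (?E p' k)) = (if p = p' then of_real W else 0)"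
        using inj_onD[OF inj, of p p'] p by auto
    qed
    also have "(\<Sum>p\<in>?C. (cmod (?f p))\<^sup>2) = (\<Sum>s<n. \<Sum>b\<in>B s'. (cmod (w s))\<^sup>2)"
      unfolding sum.cartesian_product by (simp add: norm_mult case_prod_unfold)
    also have "\<dots> = real m * (real n * G (real N ^ r * y))"
      using n by (simp add: card_B s' G_def w_def sum_distrib_left[symmetric])
    finally show ?thesis using n m_pos by (simp add: power2_eq_square)
  qed
  have "(\<Sum>k\<in>K. (cmod (digit_mask D ((y + of_int (\<kappa> k)) / real N)))\<^sup>2 * G ((y + of_int (\<kappa> k)) / real N))
      = (\<Sum>s'<n. \<Sum>k\<in>K. (cmod (digit_mask D ((y + of_int (\<kappa> k)) / real N)))\<^sup>2 * (cmod (digit_mask (B s') ((y + of_int (\<kappa> k)) / real N)))\<^sup>2) / real n"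
    unfolding G_def by (subst sum.swap) (simp add: sum_distrib_left sum_divide_distrib)
  also have "\<dots> = W / (real n * real m) * G (real N ^ r * y)" using n by (simp add: one)
  finally show ?thesis .
qed

text \<open>\<open>u i\<close> is \<open>u 0\<close> with its first \<open>i\<close> factors removed; summing over one digit level turns \<open>u (Suc i)\<close> into
  \<open>u i\<close>, up to the factor \<open>m\<close>, and fixes \<open>u 0\<close>.\<close>

definition u :: "nat \<Rightarrow> real \<Rightarrow> real" where
  "u i x = (\<Prod>j\<in>{i..<Suc r}. G (real N ^ j * x))"

lemma u_periodic: "u i (x + of_int z) = u i x"
proof -
  have "real N ^ j * (x + of_int z) = real N ^ j * x + of_int (int N ^ j * z)" for j by (simp add: algebra_simps)
  then show ?thesis unfolding u_def by (simp only: G_periodic)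
qed

lemma G_shift: "G (real N ^ Suc j * ((y + of_int \<kappa>) / real N)) = G (real N ^ j * y)"
proof -
  have "real N ^ Suc j * ((y + of_int \<kappa>) / real N) = real N ^ j * y + of_int (int N ^ j * \<kappa>)"
    using N2 by (simp add: field_simps)
  then show ?thesis by (simp only: G_periodic)
qed

lemma u_Suc_shift: "u (Suc i) ((y + of_int \<kappa>) / real N) = (\<Prod>j\<in>{i..<r}. G (real N ^ j * y))"
  unfolding u_def prod.shift_bounds_Suc_ivl G_shift ..

lemma u_0_shift: "u 0 ((y + of_int \<kappa>) / real N) = G ((y + of_int \<kappa>) / real N) * (\<Prod>j\<in>{0..<r}. G (real N ^ j * y))"
proof -
  have "u 0 ((y + of_int \<kappa>) / real N) = G (real N ^ 0 * ((y + of_int \<kappa>) / real N)) * u (Suc 0) ((y + of_int \<kappa>) / real N)"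
    unfolding u_def by (rule prod.atLeast_Suc_lessThan) simp
  then show ?thesis unfolding u_Suc_shift by simp
qed

lemma u_split: "i \<le> r \<Longrightarrow> u i y = (\<Prod>j\<in>{i..<r}. G (real N ^ j * y)) * G (real N ^ r * y)"
  unfolding u_def by (rule prod.atLeastLessThan_Suc)

section \<open>Invariance of the weight and the base points\<close>

lemma L_distinct:
  "l \<in> L1 + L2 \<Longrightarrow> l' \<in> L1 + L2 \<Longrightarrow> l mod int N = l' mod int N \<Longrightarrow> l = l'"
  using hadamard_rows_distinct[of N "A + B 0" "L1 + L2" l l'] HAB[OF one_in_T, of 0] n by simp

text \<open>For \<open>i = 0\<close> the weight contains \<open>G\<close> at the new point, and the
  triples with \<open>A + B s\<close> are needed. For \<open>i > 0\<close> the factors of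
  \<open>u i\<close> do not depend on the digit: the digits of \<open>L1\<close> act through
  \<open>A\<close> alone, and each of the \<open>m\<close> digits of \<open>L2\<close> contributes
  the same amount.\<close>

lemma transfer:
  assumes t: "t \<in> T" and i: "i \<le> Suc r"
  shows "(\<Sum>l\<in>L1 + L2. (cmod (digit_mask D ((x + of_int t * of_int l) / real N)))\<^sup>2 * u i ((x + of_int t * of_int l) / real N))
      = (if i = 0 then u 0 x else real m * u (i - 1) x)"
proof (cases i)
  case 0
  have "(\<Sum>l\<in>L1 + L2. (cmod (digit_mask D ((x + of_int (t * l)) / real N)))\<^sup>2 * G ((x + of_int (t * l)) / real N))
      = real (n * m) / (real n * real m) * G (real N ^ r * x)"
  proof (rule product_kernel)
    fix s c c' assume s: "s < n" and c: "c \<in> A + B s" "c' \<in> A + B s"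
    show "(\<Sum>l\<in>L1 + L2. expo (of_int (t * l) / real N) (of_int c) * cnj (expo (of_int (t * l) / real N) (of_int c')))
      = (if c = c' then of_real (real (n * m)) else 0)"
      using hadamard_columns_dilate[OF HAB[OF t s] fin_sum _ c] card_L card_AB[OF s] by simp
  qed
  also have "\<dots> = G (real N ^ r * x)" using n m_pos by simp
  finally have *: "(\<Sum>l\<in>L1 + L2. (cmod (digit_mask D ((x + of_int (t * l)) / real N)))\<^sup>2 * G ((x + of_int (t * l)) / real N))
      = G (real N ^ r * x)" .
  have "(\<Sum>l\<in>L1 + L2. (cmod (digit_mask D ((x + of_int (t * l)) / real N)))\<^sup>2 * u 0 ((x + of_int (t * l)) / real N))
      = G (real N ^ r * x) * (\<Prod>j\<in>{0..<r}. G (real N ^ j * x))"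
    unfolding u_0_shift *[symmetric] sum_distrib_right by (simp add: mult_ac)
  then show ?thesis using 0 u_split[of 0 x] by (simp add: mult_ac)
next
  case (Suc i')
  have fixed: "(\<Sum>l1\<in>L1. (cmod (digit_mask D ((x + of_int (t * (l1 + l2))) / real N)))\<^sup>2) = G (real N ^ r * x)" for l2
  proof -
    have "(\<Sum>l1\<in>L1. (cmod (digit_mask D ((x + of_int (t * l2) + of_int (t * l1)) / real N)))\<^sup>2)
        = G (real N ^ r * (x + of_int (t * l2)))"
    proof (rule digit_mask_D_kernel)
      fix s s' assume s: "s < n" "s' < n"
      then show "(\<Sum>l1\<in>L1. expo (of_int (t * l1) / real N) (of_int (a s)) * cnj (expo (of_int (t * l1) / real N) (of_int (a s'))))
        = (if s = s' then of_real (real n) else 0)"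
        using hadamard_columns_dilate[OF HA[OF t s(1)] fin_L(1), of "a s" "a s'"] card_L1 card_A inj_onD[OF inj_a, of s s']
        by auto
    qed
    also have "real N ^ r * (x + of_int (t * l2)) = real N ^ r * x + of_int (int N ^ r * (t * l2))" by (simp add: algebra_simps)
    finally show ?thesis by (simp only: G_periodic) (simp add: algebra_simps)
  qed
  have inj: "inj_on (\<lambda>(l1, l2). l1 + l2) (L1 \<times> L2)" using direct(2) by (simp add: direct_sum_def)
  have L: "L1 + L2 = (\<lambda>(l1, l2). l1 + l2) ` (L1 \<times> L2)" by (auto simp: set_plus_def)
  have "(\<Sum>l\<in>L1 + L2. (cmod (digit_mask D ((x + of_int (t * l)) / real N)))\<^sup>2)
      = (\<Sum>l1\<in>L1. \<Sum>l2\<in>L2. (cmod (digit_mask D ((x + of_int (t * (l1 + l2))) / real N)))\<^sup>2)"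
    unfolding L sum.reindex[OF inj] by (simp add: sum.cartesian_product case_prod_unfold comp_def)
  also have "\<dots> = (\<Sum>l2\<in>L2. \<Sum>l1\<in>L1. (cmod (digit_mask D ((x + of_int (t * (l1 + l2))) / real N)))\<^sup>2)"
    by (rule sum.swap)
  also have "\<dots> = real m * G (real N ^ r * x)" unfolding fixed by (simp add: m_def)
  finally have *: "(\<Sum>l\<in>L1 + L2. (cmod (digit_mask D ((x + of_int (t * l)) / real N)))\<^sup>2) = real m * G (real N ^ r * x)" .
  have "(\<Sum>l\<in>L1 + L2. (cmod (digit_mask D ((x + of_int (t * l)) / real N)))\<^sup>2 * u (Suc i') ((x + of_int (t * l)) / real N))
      = real m * G (real N ^ r * x) * (\<Prod>j\<in>{i'..<r}. G (real N ^ j * x))"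
    unfolding u_Suc_shift *[symmetric] sum_distrib_right ..
  then show ?thesis using Suc i u_split[of i' x] by (simp add: mult_ac)
qed

lemma transfer_full:
  assumes t: "t \<in> T"
  shows "(\<Sum>l<N. (cmod (digit_mask D ((x + of_int \<bar>t\<bar> * real l) / real N)))\<^sup>2 * u 0 ((x + of_int \<bar>t\<bar> * real l) / real N))
        = real N / real (card D) * u 0 x"
proof -
  have *: "(\<Sum>l<N. (cmod (digit_mask D ((x + of_int (\<bar>t\<bar> * int l)) / real N)))\<^sup>2 * G ((x + of_int (\<bar>t\<bar> * int l)) / real N))
      = real N / (real n * real m) * G (real N ^ r * x)"
  proof (rule product_kernel)
    fix s c c' assume s: "s < n" and c: "c \<in> A + B s" "c' \<in> A + B s"
    have "\<not> int N dvd \<bar>t\<bar> * (c - c')" if "c \<noteq> c'"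
      using hadamard_columns_distinct[OF HAB[OF t s] c that] by (rule not_dvd_abs_mult)
    then show "(\<Sum>l<N. expo (of_int (\<bar>t\<bar> * int l) / real N) (of_int c) * cnj (expo (of_int (\<bar>t\<bar> * int l) / real N) (of_int c')))
      = (if c = c' then of_real (real N) else 0)"
      using residue_columns[of N c c' "\<bar>t\<bar>"] N2 by simp
  qed
  have "(\<Sum>l<N. (cmod (digit_mask D ((x + of_int (\<bar>t\<bar> * int l)) / real N)))\<^sup>2 * u 0 ((x + of_int (\<bar>t\<bar> * int l)) / real N))
      = real N / (real n * real m) * G (real N ^ r * x) * (\<Prod>j\<in>{0..<r}. G (real N ^ j * x))"
    unfolding u_0_shift *[symmetric] sum_distrib_right by (simp add: mult_ac)
  then show ?thesis using u_split[of 0 x] by (simp add: card_D mult_ac)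
qed

lemma sum_G:
  assumes t: "t \<in> T"
  shows "(\<Sum>l\<in>L2. G (y + of_int (t * l) / real N)) = 1"
proof -
  have "(\<Sum>l\<in>L2. (cmod (digit_mask (B s) (y + of_int (t * l) / real N)))\<^sup>2) = 1" if s: "s < n" for s
    using sum_mask_kernel[OF fin_B[OF s] B_nonempty[OF s] hadamard_columns_dilate[OF HB[OF t s] fin_L(2)], of y]
      card_B[OF s] m_pos by (simp add: m_def)
  then show ?thesis
    unfolding G_def sum_divide_distrib[symmetric] using n by (subst sum.swap) simp
qed

text \<open>One more factor \<open>G\<close> is compensated by one more fractional level: the points
  are divided by \<open>N\<close> and receive a digit of \<open>L2\<close>, over which
  \<open>sum_G\<close> sums. Subtracting \<open>l0\<close> keeps \<open>0\<close> in the
  set.\<close>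

lemma ex_base:
  "\<exists>L0. finite L0 \<and> 0 \<in> L0 \<and> (\<forall>t\<in>T. \<forall>x. (\<Sum>v\<in>L0. \<Prod>j\<in>{0..<k}. G (real N ^ j * (x + of_int t * v))) = 1)"
proof (induction k)
  case 0
  show ?case by (intro exI[of _ "{0}"]) simp
next
  case (Suc k)
  then obtain L0 where L0: "finite L0" "0 \<in> L0"
    "\<And>t x. t \<in> T \<Longrightarrow> (\<Sum>v\<in>L0. \<Prod>j\<in>{0..<k}. G (real N ^ j * (x + of_int t * v))) = 1" by blast
  have "L2 \<noteq> {}" using m_pos by (auto simp: m_def)
  then obtain l0 where l0: "l0 \<in> L2" by blast
  define f where "f = (\<lambda>(v, l). (v + of_int (l - l0)) / real N)"
  let ?F = "\<lambda>x. \<Prod>j\<in>{0..<Suc k}. G (real N ^ j * x)"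
  have sum1: "(\<Sum>p\<in>L0 \<times> L2. ?F (x + of_int t * f p)) = 1" if t: "t \<in> T" for t x
  proof -
    have F: "?F (x + of_int t * f (v, l)) = (\<Prod>j\<in>{0..<k}. G (real N ^ j * (real N * x + of_int t * v)))
        * G ((x + of_int t * (v - of_int l0) / real N) + of_int (t * l) / real N)" for v l
    proof -
      let ?x = "x + of_int t * f (v, l)"
      have x: "?x = ((real N * x + of_int t * v) + of_int (t * (l - l0))) / real N"
        using N2 by (simp add: f_def field_simps)
      have "?F ?x = G (real N ^ 0 * ?x) * (\<Prod>j\<in>{Suc 0..<Suc k}. G (real N ^ j * ?x))"
        by (rule prod.atLeast_Suc_lessThan) simp
      also have "(\<Prod>j\<in>{Suc 0..<Suc k}. G (real N ^ j * ?x)) = (\<Prod>j\<in>{0..<k}. G (real N ^ j * (real N * x + of_int t * v)))"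
        unfolding prod.shift_bounds_Suc_ivl x G_shift ..
      also have "real N ^ 0 * ?x = (x + of_int t * (v - of_int l0) / real N) + of_int (t * l) / real N"
        unfolding x using N2 by (simp add: field_simps)
      finally show ?thesis by (simp add: mult.commute)
    qed
    have "(\<Sum>p\<in>L0 \<times> L2. ?F (x + of_int t * f p)) = (\<Sum>v\<in>L0. \<Sum>l\<in>L2. ?F (x + of_int t * f (v, l)))"
      by (simp only: sum.cartesian_product case_prod_unfold prod.collapse)
    also have "\<dots> = (\<Sum>v\<in>L0. \<Prod>j\<in>{0..<k}. G (real N ^ j * (real N * x + of_int t * v)))"
      unfolding F sum_distrib_left[symmetric] sum_G[OF t] by simp
    also have "\<dots> = 1" by (rule L0(3)[OF t])
    finally show ?thesis .
  qed
  have inj: "inj_on f (L0 \<times> L2)"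
  proof (rule inj_on_of_sum_eq_1[where F="?F"])
    show "(\<Sum>p\<in>L0 \<times> L2. ?F (x + f p)) = 1" for x using sum1[OF one_in_T, of x] by simp
    show "0 \<le> ?F x" for x by (rule prod_nonneg) (simp add: G_nonneg)
  qed (use L0(1) fin_L in \<open>simp_all add: G_0\<close>)
  show ?case
  proof (intro exI[of _ "f ` (L0 \<times> L2)"] conjI ballI allI)
    show "finite (f ` (L0 \<times> L2))" using L0(1) fin_L by simp
    show "0 \<in> f ` (L0 \<times> L2)" using L0(2) l0 by (intro image_eqI[of _ _ "(0, l0)"]) (auto simp: f_def)
    show "(\<Sum>v\<in>f ` (L0 \<times> L2). \<Prod>j\<in>{0..<Suc k}. G (real N ^ j * (x + of_int t * v))) = 1" if "t \<in> T" for t x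
      unfolding sum.reindex[OF inj] comp_def by (rule sum1[OF that])
  qed
qed

text \<open>If \<open>G\<close> vanishes at \<open>N ^ j * x\<close>, so do the masks of all
  \<open>B s\<close>, and hence the mask of \<open>D\<close> at \<open>x / N ^ (Suc r - j)\<close>,
  which is a factor of the transform at \<open>x\<close> because \<open>j < Suc r\<close>.\<close>

lemma u_zero:
  assumes "u 0 x = 0"
  shows "FT (self_similar_measure N D) x = 0"
proof -
  have "\<exists>j\<in>{0..<Suc r}. G (real N ^ j * x) = 0"
    using assms unfolding u_def by (subst (asm) prod_zero_iff) simp_all
  then obtain j where j: "j < Suc r" "G (real N ^ j * x) = 0" by (meson atLeastLessThan_iff)
  have zero: "digit_mask (B s) (real N ^ j * x) = 0" if "s < n" for s
    using j(2) that n by (simp add: G_def sum_nonneg_eq_0_iff)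
  define k where "k = Suc r - j"
  have k: "1 \<le> k" using j by (simp add: k_def)
  have "real N ^ Suc r = real N ^ j * real N ^ k" using j(1) by (simp add: k_def flip: power_add)
  then have "real N ^ Suc r * (x / real N ^ k) = real N ^ j * x" using N2 by simp
  then have "digit_mask D (x / real N ^ k) = 0" unfolding digit_mask_D by (simp only:) (simp add: zero)
  then have "digit_mask_prod N D k x = 0" using k by (auto simp: digit_mask_prod_def)
  moreover have "D \<noteq> {}" using card_D n m_pos by auto
  ultimately show ?thesis
    using FT_eq_mask_prod[OF self_similar_measure[OF finite_D _ N2] finite_D, of x k] by simp
qed

lemma ex_spectral_tower:
  assumes D: "2 \<le> card D" "card D < N"
  shows "\<exists>L' g L0 P R. spectral_tower (self_similar_measure N D) N D L' g L0 T (Suc r) P R"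
proof -
  obtain L0 where L0: "finite L0" "0 \<in> L0" "\<And>t x. t \<in> T \<Longrightarrow> (\<Sum>v\<in>L0. u 0 (x + of_int t * v)) = 1"
    using ex_base[of "Suc r"] unfolding u_def by blast
  have "\<exists>L' R. spectral_tower (self_similar_measure N D) N D L' (u 0) L0 T (Suc r) (real m ^ Suc r) R"
  proof (rule spectral_towerI[OF N2 finite_D D fin_sum])
    show "card (L1 + L2) = card D" by (simp add: card_L card_D)
    show "continuous_on UNIV (u 0)" unfolding u_def[abs_def]
      by (intro continuous_intros continuous_on_compose2[OF G_continuous]) auto
    show "0 \<le> u 0 x" for x unfolding u_def by (rule prod_nonneg) (simp add: G_nonneg)
    show "u 0 x \<le> 1" for x unfolding u_def by (rule prod_le_1) (simp add: G_nonneg G_le_1)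
    show "u 0 0 = 1" "u (Suc r) x = 1" for x by (simp_all add: u_def G_0)
  qed (use L_distinct u_periodic u_zero one_in_T transfer transfer_full L0 in auto)
  then show ?thesis by blast
qed

end

text \<open>The measure is a point mass and its transform has modulus \<open>1\<close>, so every
  singleton is a spectrum of dimension \<open>0\<close>. These singletons are all translates of one
  another.\<close>

lemma spectra_singleton:
  assumes N: "2 \<le> N" and D: "card D = 1"
  shows "V_dim 0 (self_similar_measure N D) A \<approx> (UNIV :: real set)"
proof -
  let ?M = "self_similar_measure N D"
  obtain d where d: "D = {d}" using D card_1_singletonE by blast
  then have fin: "finite D" "D \<noteq> {}" by auto
  have ss: "is_self_similar_measure N D ?M" by (rule self_similar_measure[OF fin N])
  obtain R where R: "AE x in ?M. \<bar>x\<bar> \<le> R" using self_similar_measure_bounded[OF fin N] by blast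
  interpret borel_prob ?M
    using ss by (auto simp: is_self_similar_measure_def borel_prob_def borel_prob_axioms_def)
  \<comment> \<open>The mask of a singleton has modulus \<open>1\<close>, so the modulus of the
    transform is unchanged by division by \<open>N\<close>; letting the argument tend to
    \<open>0\<close> gives the value.\<close>
  have FT1: "cmod (FT ?M x) = 1" for x
  proof -
    have "(\<lambda>k. x * (1 / real N) ^ k) \<longlonglongrightarrow> x * 0"
      using N by (intro tendsto_mult tendsto_const LIMSEQ_power_zero) auto
    then have "(\<lambda>k. x / real N ^ k) \<longlonglongrightarrow> 0" by (simp add: power_divide)
    from tendsto_norm[OF isCont_tendsto_compose[OF FT_continuous[OF prob_space_axioms sets_eq] this]]
    have "(\<lambda>k. cmod (FT ?M (x / real N ^ k))) \<longlonglongrightarrow> 1" by (simp add: FT_0[OF prob_space_axioms])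
    moreover have eq: "cmod (FT ?M (x / real N ^ k)) = cmod (FT ?M x)" for k
      using FT_eq_mask_prod[OF ss fin, of x k]
      by (simp add: norm_mult digit_mask_prod_def prod_norm[symmetric] digit_mask_def d)
    ultimately show ?thesis unfolding eq by (simp add: LIMSEQ_const_iff)
  qed
  have spec: "is_spectrum ?M {c}" for c
    by (rule is_spectrumI[OF R]) (auto intro!: exI[of _ "{c}"] simp: FT1)
  have dim: "beurling_dim {c} = ereal 0" for c
  proof (rule antisym)
    show "beurling_dim {c} \<le> ereal 0"
    proof (rule beurling_dim_leI)
      fix \<eta> :: real assume "0 < \<eta>"
      show "\<forall>\<^sub>F h in at_top. \<forall>x. finite ({c} \<inter> window x h) \<and> real (card ({c} \<inter> window x h)) \<le> h powr (0 + \<eta>)"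
        using eventually_ge_at_top[of 1]
      proof eventually_elim
        case (elim h)
        have "1 \<le> h powr \<eta>" using elim \<open>0 < \<eta>\<close> by (simp add: ge_one_powr_ge_zero)
        moreover have "card ({c} \<inter> window x h) \<le> card {c}" for x by (rule card_mono) auto
        ultimately show ?case by (auto intro: order_trans[of _ 1])
      qed
    qed
    show "ereal 0 \<le> beurling_dim {c}"
    proof (rule beurling_dim_geI)
      fix \<eta> H :: real assume \<eta>: "0 < \<eta>"
      define h where "h = max H 2"
      have h: "H \<le> h" "1 < h" by (simp_all add: h_def)
      have W: "{c} \<inter> window c h = {c}" using h by auto
      have "h powr (0 - \<eta>) \<le> h powr 0" using \<eta> h by (intro powr_mono) auto
      then have le: "h powr (0 - \<eta>) \<le> real (card ({c} \<inter> window c h))" unfolding W using h by simp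
      show "\<exists>h\<ge>H. 1 < h \<and> (\<exists>x. finite ({c} \<inter> window x h) \<and> h powr (0 - \<eta>) \<le> real (card ({c} \<inter> window x h)))"
        by (intro exI[of _ h] conjI exI[of _ c] h le) simp
    qed
  qed
  have "b *o {c} = {b * c}" for b c :: real by (auto simp: elt_set_times_def)
  then have "{c} \<in> V_dim 0 ?M A" for c using spec dim by (simp add: V_dim_def V_def)
  then have "(UNIV :: real set) \<lesssim> V_dim 0 ?M A" unfolding lepoll_def by (intro exI[of _ "\<lambda>c. {c}"]) auto
  then show ?thesis using V_dim_lepoll lepoll_antisym by blast
qed

theorem theorem1p7:
  fixes N n r :: nat and a :: "nat \<Rightarrow> int" and B :: "nat \<Rightarrow> int set"
    and D L1 L2 :: "int set" and s :: real
  assumes "product_form_hadamard N n a B L1 L2 r D"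
    and "r = 0 \<longrightarrow> (\<forall>t\<in>multiplier_set N n a B L1 L2. hadamard_triple N D (t *o (L1 + L2)))"
    and "N > card D"
    and "s \<in> {0 .. ln (real (card D)) / ln (real N)}"
  shows "V_dim s (self_similar_measure N D) (real_of_int ` multiplier_set N n a B L1 L2)
           \<approx> (UNIV :: real set) \<and>
         (2 \<le> card D \<longrightarrow>
            V_dim s (self_similar_measure N D) (real_of_int ` multiplier_set N n a B L1 L2)
              // translation_rel \<approx> (UNIV :: real set))"
proof -
  let ?T = "multiplier_set N n a B L1 L2"
  have pf: "2 \<le> N" "1 \<le> n" "inj_on a {..<n}" "\<forall>s<n. finite (B s)" "finite L1" "finite L2"
    "D = (\<Union>s<n. a s +o ((int N ^ r) *o B s))" "hadamard_system N n a B L1 L2"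
    using assms(1) by (auto simp: product_form_hadamard_def)
  have T1: "1 \<in> ?T" using pf(8) by (simp add: multiplier_set_def)
  have finD: "finite D" unfolding pf(7) using pf(4) by (auto simp: elt_set_plus_def elt_set_times_def)
  have "D \<noteq> {}"
  proof -
    have "B 0 \<noteq> {}" using pf(2,8) by (auto simp: hadamard_system_def hadamard_triple_def)
    then obtain b where "b \<in> B 0" by blast
    then have "a 0 + int N ^ r * b \<in> a 0 +o ((int N ^ r) *o B 0)"
      by (auto simp: elt_set_plus_def elt_set_times_def)
    then have "a 0 + int N ^ r * b \<in> D" unfolding pf(7) using pf(2) by (intro UN_I[of 0]) simp_all
    then show ?thesis by blast
  qed
  then have "1 \<le> card D" using finD by (simp add: Suc_le_eq card_gt_0_iff)
  then consider "card D = 1" | "2 \<le> card D" by linarith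
  then show ?thesis
  proof cases
    case 1
    then have "s = 0" using assms(4) by simp
    then show ?thesis using spectra_singleton[OF pf(1) 1] 1 by simp
  next
    case 2
    \<comment> \<open>For \<open>r = 0\<close> the constant weight serves; for positive
      \<open>r\<close> the weight is a product of \<open>r\<close> factors \<open>G\<close>.\<close>
    have "\<exists>L' g L0 r' P R. spectral_tower (self_similar_measure N D) N D L' g L0 ?T r' P R"
    proof (cases r)
      case 0
      then have "\<exists>L' R. spectral_tower (self_similar_measure N D) N D L' (\<lambda>x. 1) {0} ?T 0 1 R"
        using assms(2) by (intro spectral_tower_hadamard[OF pf(1) finD 2 assms(3) _ T1, of "L1 + L2"])
          (auto simp: finite_set_plus pf)
      then show ?thesis by blast
    next
      case (Suc r')
      interpret product_form N n r' a B L1 L2 D ?T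
        by unfold_locales (use pf Suc in auto)
      show ?thesis using ex_spectral_tower[OF 2 assms(3)] by blast
    qed
    then obtain L' g L0 r' P R where "spectral_tower (self_similar_measure N D) N D L' g L0 ?T r' P R" by blast
    then interpret spectral_tower "self_similar_measure N D" N D L' g L0 ?T r' P R .
    obtain f :: "(nat \<Rightarrow> bool) \<Rightarrow> real set" where f: "inj f"
      "\<And>\<theta>. f \<theta> \<in> V_dim s (self_similar_measure N D) (real_of_int ` ?T) \<and> 0 \<in> f \<theta>"
      using continuum_of_spectra[of s] assms(4) by auto
    show ?thesis using continuum_V_dim[OF f(1)] f(2) by blast
  qed
qed

end
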